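(* Fix an action $a\in\mathcal A$, a score function $g:\mathcal X\times\mathbb R\times\mathbb R^d\to\mathbb R^d$, and let $\theta_a^*\in\mathbb R^d$ satisfy $\mathbb E[g(X,Y(a);\theta_a^* )]=0$. Assume: (1) (Unconfoundedness) $A_t\perp\{Y_t(a')\}_{a'\in\mathcal A}\mid(\mathcal H_{t-1},X_t)$ for all $t$. (2) (Well-separated solution) For all $\epsilon>0$, $\inf_{\|\theta-\theta_a^*\|_2>\epsilon}\|\mathbb E[g(X_t,Y_t(a);\theta)]\|_2>0$. (3) (Bounded moments) There are constants $R_\theta,M_2$ such that (i) $\|\mathbb E[g(X_t,Y_t(a);\theta_a^* )g(X_t,Y_t(a);\theta_a^* )^\top\mid X_t]\|_2\le M_2$ for a.e. $X_t$; (ii) $\|\theta_a^*\|_2<R_\theta$ and $\sup_{\|\theta\|_2\le R_\theta}\mathbb E[\|g(X_t,Y_t(a);\theta)\|_2^2]<\infty$; (iii) $\mathbb E[\|g(X_t,Y_t(a);\theta_a^* )\|_2^4]<\infty$. (4) (Smoothness) (i) $g(x,y;\theta)$ is twice differentiable in $\theta$, and $\mathbb E[\nabla g(X_t,Y_t(a);\theta_a^* )]$ is nonsingular; (ii) there is $\phi:\mathbb R^{d_X}\times\mathbb R\to\mathbb R$ with $\sup_{\|\theta\|_2\le R_\theta}\|\nabla g(x,y;\theta)\|_2\le\phi(x,y)$ for all $x,y$ and $\mathbb E[\phi(X_t,Y_t(a))^2]<\infty$; (iii) there are $\epsilon_0>0$ and $\Phi:\mathbb R^{d_X}\times\mathbb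 R\to\mathbb R$ with $\sup_{\|\theta-\theta_a^*\|_2\le\epsilon_0,\,i\in[d]}\|\nabla^2g^{(i)}(x,y;\theta)\|_2\le\Phi(x,y)$ and $\mathbb E[\Phi(X_t,Y_t(a))]<\infty$, where $g^{(i)}$ is the $i$-th entry of $g$. (5) (Minimum sampling probability) $\pi_t(a)\ge\pi_{\min}$ almost surely for some constant $\pi_{\min}\in(0,1)$. Suppose the behavior policy converges at action $a$ to a stationary policy $\bar\pi:\mathcal X\to\Delta(\mathcal A)$, i.e. $\pi_t(a\mid X_t,\mathcal H_{t-1})-\bar\pi(a\mid X_t)\xrightarrow{p}0$ as $t\to\infty$. Then there exists an estimator sequence $\{\hat\theta_a^{(T)}\}_{T\ge1}$ with $\|\hat\theta_a^{(T)}\|_2\le R_\theta$ for all $T$ satisfying $$G_T(\hat\theta_a^{(T)})=o_p(1/\sqrt T),\qquad G_T(\theta):=\frac1T\sum_{t=1}^T\frac{1_{\{A_t=a\}}}{\pi_t(A_t)}g(X_t,Y_t;\theta).$$ Moreover, for any such sequence, as $T\to\infty$, $$\sqrt T(\hat\theta_a^{(T)}-\theta_a^* )\xrightarrow{d}\mathcal N(0,\Sigma_a^* ),\qquad \Sigma_a^*=J_a^{-1}\bar I_a(J_a^{-1})^\top,$$ where $\bar I_a=\mathbb E\big[\frac1{\bar\pi(a\mid X_t)}g(X_t,Y_t(a);\theta_a^* )g(X_t,Y_t(a);\theta_a^* )^\top\big]$ and $J_a=\mathbb E[\nabla g(X_t,Y_t(a);\theta_a^* )]$.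
   Context: Contextual bandit setting. Contexts $X_t\in\mathcal X\subseteq\mathbb R^{d_X}$, finite action set $\mathcal A=\{1,\dots,K\}$, potential outcomes $Y_t(a)\in\mathbb R$; the tuples $(X_t,\{Y_t(a)\}_{a\in\mathcal A})$, $t\ge1$, are i.i.d., with generic copy $(X,\{Y(a)\})$. At time $t$, given the history $\mathcal H_{t-1}=\{X_\tau,\pi_\tau,A_\tau,Y_\tau\}_{\tau<t}$ and $X_t$, the action $A_t$ is drawn from the behavior policy $\pi_t(\cdot\mid X_t,\mathcal H_{t-1})\in\Delta(\mathcal A)$ (probability distributions on $\mathcal A$), and the outcome $Y_t=Y_t(A_t)$ is observed. The tuple $(X_t,\{Y_t(a)\}_a)$ is independent of $\mathcal H_{t-1}$. We abbreviate $\pi_t(a)=\pi_t(a\mid X_t,\mathcal H_{t-1})$. $\nabla g$ denotes the Jacobian of $g$ in $\theta$, $\nabla^2 g^{(i)}$ the Hessian in $\theta$; $\|\cdot\|_2$ is the Euclidean norm of vectors and the spectral norm of matrices. No outcome model is assumed. *)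

theory Defs
  imports "HOL-Probability.Probability"
begin

section \<open>Matrices and derivatives\<close>

definition spectral_norm :: "real^'n^'m \<Rightarrow> real" where
  "spectral_norm B = onorm ((*v) B)"

definition outer_prod :: "real^'n \<Rightarrow> real^'n^'n" where
  "outer_prod v = (\<chi> i j. v $ i * v $ j)"

definition gradient :: "(real^'n \<Rightarrow> real) \<Rightarrow> real^'n \<Rightarrow> real^'n" where
  "gradient f \<theta> = (\<chi> j. frechet_derivative f (at \<theta>) (axis j 1))"

definition hessian :: "(real^'n \<Rightarrow> real) \<Rightarrow> real^'n \<Rightarrow> real^'n^'n" where
  "hessian f \<theta> = jacobian (gradient f) (at \<theta>)"

definition twice_differentiable :: "(real^'n \<Rightarrow> real^'m) \<Rightarrow> bool" where
  "twice_differentiable f \<longleftrightarrow>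
     (\<forall>\<theta>. f differentiable (at \<theta>)) \<and>
     (\<forall>\<theta>. (\<lambda>\<theta>'. jacobian f (at \<theta>')) differentiable (at \<theta>))"

section \<open>Probability distributions on a finite set, modes of convergence, conditioning\<close>

definition prob_simplex :: "(real^'k) set" where
  "prob_simplex = {p. (\<forall>b. 0 \<le> p $ b) \<and> (\<Sum>b\<in>UNIV. p $ b) = 1}"

definition tendsto_zero_in_prob ::
  "'w measure \<Rightarrow> (nat \<Rightarrow> 'w \<Rightarrow> 'b::real_normed_vector) \<Rightarrow> bool" where
  "tendsto_zero_in_prob M Z \<longleftrightarrow>
     (\<forall>\<epsilon>>0. (\<lambda>n. measure M {\<omega> \<in> space M. norm (Z n \<omega>) > \<epsilon>}) \<longlonglongrightarrow> 0)"

text \<open>Weak convergence of the laws of the random vectors \<open>Z n\<close> to the probability measure \<open>N\<close>; the library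
  notion \<open>weak_conv_m\<close> only covers the real line.\<close>

definition tendsto_in_distribution ::
  "'w measure \<Rightarrow> (nat \<Rightarrow> 'w \<Rightarrow> 'b::euclidean_space) \<Rightarrow> 'b measure \<Rightarrow> bool" where
  "tendsto_in_distribution M Z N \<longleftrightarrow>
     (\<forall>f :: 'b \<Rightarrow> real. continuous_on UNIV f \<longrightarrow> bounded (range f) \<longrightarrow>
        (\<lambda>n. \<integral>\<omega>. f (Z n \<omega>) \<partial>M) \<longlonglongrightarrow> (\<integral>x. f x \<partial>N))"

text \<open>The law of \<open>\<mu> + B Z\<close> with \<open>Z\<close> a vector of independent standard normals and
  \<open>B B\<^sup>T = \<Sigma>\<close>. Such a \<open>B\<close> exists iff \<open>\<Sigma>\<close> is symmetric positive semidefinite, and the law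
  does not depend on which one is picked. A singular \<open>\<Sigma>\<close> is allowed, so there need not be a
  density.\<close>

definition multivariate_normal :: "real^'n \<Rightarrow> real^'n^'n \<Rightarrow> (real^'n) measure" where
  "multivariate_normal \<mu> \<Sigma> =
     (let B = (SOME B :: real^'n^'n. B ** transpose B = \<Sigma>)
      in distr (Pi\<^sub>M (UNIV :: 'n set) (\<lambda>_. density lborel std_normal_density)) borel
           (\<lambda>z. \<mu> + B *v (\<chi> i. z i)))"

definition cond_indep_var ::
  "'w measure \<Rightarrow> 'w measure \<Rightarrow> 'b measure \<Rightarrow> ('w \<Rightarrow> 'b) \<Rightarrow> 'c measure \<Rightarrow> ('w \<Rightarrow> 'c) \<Rightarrow> bool" where
  "cond_indep_var M F S U S' V \<longleftrightarrow>
     (\<forall>B\<in>sets S. \<forall>C\<in>sets S'. AE \<omega> in M.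
        real_cond_exp M F (\<lambda>\<omega>. indicator B (U \<omega>) * indicator C (V \<omega>)) \<omega> =
        real_cond_exp M F (\<lambda>\<omega>. indicator B (U \<omega>)) \<omega> *
        real_cond_exp M F (\<lambda>\<omega>. indicator C (V \<omega>)) \<omega>)"

section \<open>Contextual bandits\<close>

text \<open>Contexts live in \<open>real^'p\<close>, the finite type \<open>'k\<close> is the action set, and a family of
  potential outcomes (or of action probabilities) is a vector in \<open>real^'k\<close>. Time runs through
  1, 2, \dots; index 0 of the time-indexed sequences is never used. The record of one time step
  is (context, action probabilities used, action taken, observed outcome), and a history of length
  \<open>n\<close> is a function on \<open>{1..n}\<close>, extended by \<open>undefined\<close>.\<close>

type_synonym ('p, 'k) step = "(real^'p) \<times> (real^'k) \<times> 'k \<times> real"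
type_synonym ('p, 'k) hist = "nat \<Rightarrow> ('p, 'k) step"

type_synonym ('p, 'k) policies = "nat \<Rightarrow> real^'p \<Rightarrow> ('p, 'k) hist \<Rightarrow> real^'k"

definition hist_space :: "nat \<Rightarrow> ('p::finite, 'k::finite) hist measure" where
  "hist_space n = Pi\<^sub>M {1..n} (\<lambda>_. borel \<Otimes>\<^sub>M borel \<Otimes>\<^sub>M count_space UNIV \<Otimes>\<^sub>M borel)"

primrec history ::
  "('p::finite, 'k::finite) policies \<Rightarrow> (nat \<Rightarrow> 'w \<Rightarrow> real^'p) \<Rightarrow> (nat \<Rightarrow> 'w \<Rightarrow> real^'k) \<Rightarrow> (nat \<Rightarrow> 'w \<Rightarrow> 'k)
    \<Rightarrow> nat \<Rightarrow> 'w \<Rightarrow> ('p, 'k) hist" where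
  "history \<pi> X Y A 0 \<omega> = (\<lambda>_. undefined)"
| "history \<pi> X Y A (Suc n) \<omega> =
     (history \<pi> X Y A n \<omega>)(Suc n :=
        (X (Suc n) \<omega>, \<pi> (Suc n) (X (Suc n) \<omega>) (history \<pi> X Y A n \<omega>),
         A (Suc n) \<omega>, Y (Suc n) \<omega> $ A (Suc n) \<omega>))"

text \<open>\<open>action_prob \<pi> X Y A t \<omega> $ b\<close> is the probability of action \<open>b\<close> at time \<open>t\<close> given the
  context at time \<open>t\<close> and the history up to time \<open>t - 1\<close>.\<close>

definition action_prob ::
  "('p::finite, 'k::finite) policies \<Rightarrow> (nat \<Rightarrow> 'w \<Rightarrow> real^'p) \<Rightarrow> (nat \<Rightarrow> 'w \<Rightarrow> real^'k) \<Rightarrow> (nat \<Rightarrow> 'w \<Rightarrow> 'k)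
    \<Rightarrow> nat \<Rightarrow> 'w \<Rightarrow> real^'k" where
  "action_prob \<pi> X Y A t \<omega> = \<pi> t (X t \<omega>) (history \<pi> X Y A (t - 1) \<omega>)"

definition sigma_hist_context ::
  "'w measure \<Rightarrow> ('p::finite, 'k::finite) policies \<Rightarrow> (nat \<Rightarrow> 'w \<Rightarrow> real^'p) \<Rightarrow> (nat \<Rightarrow> 'w \<Rightarrow> real^'k)
    \<Rightarrow> (nat \<Rightarrow> 'w \<Rightarrow> 'k) \<Rightarrow> nat \<Rightarrow> 'w measure" where
  "sigma_hist_context M \<pi> X Y A t =
     vimage_algebra (space M) (\<lambda>\<omega>. (history \<pi> X Y A (t - 1) \<omega>, X t \<omega>)) (hist_space (t - 1) \<Otimes>\<^sub>M borel)"

text \<open>\<open>Y t \<omega> $ b\<close> is the potential outcome of action \<open>b\<close>, and \<open>(X0, Y0)\<close> is the generic copy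
  of \<open>(X t, Y t)\<close>; the library's \<open>indep_var\<close> needs both variables to have the same value type,
  so independence of the tuple from the history is stated for the generated sigma-algebras. The context set \<open>XX\<close> need not be a Borel set.\<close>

locale contextual_bandit = prob_space M for M :: "'w measure" +
  fixes XX :: "(real^'p::finite) set"
    and X :: "nat \<Rightarrow> 'w \<Rightarrow> real^'p"
    and Y :: "nat \<Rightarrow> 'w \<Rightarrow> real^'k::finite"
    and A :: "nat \<Rightarrow> 'w \<Rightarrow> 'k"
    and \<pi> :: "('p, 'k) policies"
    and X0 :: "'w \<Rightarrow> real^'p"
    and Y0 :: "'w \<Rightarrow> real^'k"
  assumes context_mem: "t \<ge> 1 \<Longrightarrow> \<omega> \<in> space M \<Longrightarrow> X t \<omega> \<in> XX"
    and generic_context_mem: "\<omega> \<in> space M \<Longrightarrow> X0 \<omega> \<in> XX"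
    and generic_context_rv: "random_variable borel X0"
    and generic_outcomes_rv: "random_variable borel Y0"
    and tuples_indep:
      "indep_vars (\<lambda>_. borel \<Otimes>\<^sub>M borel) (\<lambda>t \<omega>. (X t \<omega>, Y t \<omega>)) {1..}"
    and tuples_identically_distributed:
      "t \<ge> 1 \<Longrightarrow> distr M (borel \<Otimes>\<^sub>M borel) (\<lambda>\<omega>. (X t \<omega>, Y t \<omega>)) =
                  distr M (borel \<Otimes>\<^sub>M borel) (\<lambda>\<omega>. (X0 \<omega>, Y0 \<omega>))"
    and tuple_indep_history:
      "t \<ge> 1 \<Longrightarrow> indep_set
         (sets (vimage_algebra (space M) (\<lambda>\<omega>. (X t \<omega>, Y t \<omega>)) (borel \<Otimes>\<^sub>M borel)))
         (sets (vimage_algebra (space M) (history \<pi> X Y A (t - 1)) (hist_space (t - 1))))"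
    and action_rv: "t \<ge> 1 \<Longrightarrow> random_variable (count_space UNIV) (A t)"
    and policy_measurable:
      "t \<ge> 1 \<Longrightarrow> (\<lambda>(x, h). \<pi> t x h) \<in> borel_measurable (restrict_space borel XX \<Otimes>\<^sub>M hist_space (t - 1))"
    and policy_simplex:
      "t \<ge> 1 \<Longrightarrow> x \<in> XX \<Longrightarrow> h \<in> space (hist_space (t - 1)) \<Longrightarrow> \<pi> t x h \<in> prob_simplex"
    and action_drawn_from_policy:
      "t \<ge> 1 \<Longrightarrow> AE \<omega> in M.
         real_cond_exp M (sigma_hist_context M \<pi> X Y A t) (\<lambda>\<omega>. indicator {b} (A t \<omega>)) \<omega> =
         action_prob \<pi> X Y A t \<omega> $ b"

section \<open>Inverse-probability-weighted Z-estimation\<close>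

type_synonym ('p, 'd) score = "real^'p \<Rightarrow> real \<Rightarrow> real^'d \<Rightarrow> real^'d"

definition weighted_score ::
  "('p::finite, 'k::finite) policies \<Rightarrow> (nat \<Rightarrow> 'w \<Rightarrow> real^'p) \<Rightarrow> (nat \<Rightarrow> 'w \<Rightarrow> real^'k) \<Rightarrow> (nat \<Rightarrow> 'w \<Rightarrow> 'k)
    \<Rightarrow> 'k \<Rightarrow> ('p, 'd::finite) score \<Rightarrow> nat \<Rightarrow> real^'d \<Rightarrow> 'w \<Rightarrow> real^'d" where
  "weighted_score \<pi> X Y A a g T \<theta> \<omega> =
     (1 / real T) *\<^sub>R (\<Sum>t=1..T.
        (of_bool (A t \<omega> = a) / action_prob \<pi> X Y A t \<omega> $ A t \<omega>) *\<^sub>R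
          g (X t \<omega>) (Y t \<omega> $ A t \<omega>) \<theta>)"

text \<open>An estimator at time \<open>T\<close> is a measurable function of the data observed up to time \<open>T\<close>.
  The last condition says that the weighted score at the estimator is of order
  \<open>o\<^sub>p(1 / sqrt T)\<close>.\<close>

definition approx_root_estimator ::
  "'w measure \<Rightarrow> ('p::finite, 'k::finite) policies \<Rightarrow> (nat \<Rightarrow> 'w \<Rightarrow> real^'p) \<Rightarrow> (nat \<Rightarrow> 'w \<Rightarrow> real^'k) \<Rightarrow> (nat \<Rightarrow> 'w \<Rightarrow> 'k)
    \<Rightarrow> 'k \<Rightarrow> ('p, 'd::finite) score \<Rightarrow> real \<Rightarrow> (nat \<Rightarrow> ('p, 'k) hist \<Rightarrow> real^'d) \<Rightarrow> bool" where
  "approx_root_estimator M \<pi> X Y A a g R \<theta>hat \<longleftrightarrow>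
     (\<forall>T\<ge>1. \<theta>hat T \<in> borel_measurable (hist_space T)) \<and>
     (\<forall>T\<ge>1. \<forall>\<omega>\<in>space M. norm (\<theta>hat T (history \<pi> X Y A T \<omega>)) \<le> R) \<and>
     tendsto_zero_in_prob M
       (\<lambda>T \<omega>. sqrt (real T) *\<^sub>R
          weighted_score \<pi> X Y A a g T (\<theta>hat T (history \<pi> X Y A T \<omega>)) \<omega>)"

definition score_jacobian ::
  "'w measure \<Rightarrow> ('w \<Rightarrow> real^'p) \<Rightarrow> ('w \<Rightarrow> real^'k) \<Rightarrow> 'k \<Rightarrow> ('p, 'd::finite) score
    \<Rightarrow> real^'d \<Rightarrow> real^'d^'d" where
  "score_jacobian M X0 Y0 a g \<theta> = (\<integral>\<omega>. jacobian (g (X0 \<omega>) (Y0 \<omega> $ a)) (at \<theta>) \<partial>M)"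

definition weighted_information ::
  "'w measure \<Rightarrow> ('w \<Rightarrow> real^'p) \<Rightarrow> ('w \<Rightarrow> real^'k) \<Rightarrow> (real^'p \<Rightarrow> real^'k) \<Rightarrow> 'k \<Rightarrow> ('p, 'd::finite) score
    \<Rightarrow> real^'d \<Rightarrow> real^'d^'d" where
  "weighted_information M X0 Y0 \<pi>bar a g \<theta> =
     (\<integral>\<omega>. (1 / \<pi>bar (X0 \<omega>) $ a) *\<^sub>R outer_prod (g (X0 \<omega>) (Y0 \<omega> $ a) \<theta>) \<partial>M)"

end

theory Submission
  imports Defs
begin

text \<open>
  Unconfoundedness turns the weighted score into a martingale: for functions \<open>F\<close> of the history and
  the current context and outcomes, weighting by the indicator of \<open>a\<close> divided by its probability does
  not change the expectation of \<open>F\<close>. Uncorrelated increments give a law of large numbers in mean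
  square and, together with a finite net and the Lipschitz bound \<open>\<phi>\<close>, consistency of every approximate
  root. The limit policy enters only through the conditional variance of the increments, which is
  compared with \<open>1 / \<pi>bar\<close> in mean; characteristic functions then give the martingale central limit
  theorem for the score at \<open>\<theta>s\<close>. A second order expansion around \<open>\<theta>s\<close> transfers it to the
  estimator, and shows that a single Newton step from \<open>\<theta>s\<close> is an approximate root.
\<close>

section \<open>Extension of functions measurable for a generated sigma-algebra\<close>

text \<open>Three obstacles shape the argument. The propensities converge only in probability and
  without a rate. The conditional variances are therefore compared with their limit in mean, tested
  against a unimodular function of the past; the fourth moment of the score turns convergence in
  probability of the bounded propensities into such a comparison through Young's inequality. Next,
  the estimator depends on the whole sample, so the martingale identities do not apply to the score
  evaluated at it. They are used at fixed parameters only, and the passage to the estimator is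
  pathwise, through random Lipschitz and Hessian envelopes. Finally, contexts range over a set that
  may fail to be Borel, while independence, changes of weight and limits call for Borel functions of
  history, context and outcomes; extensions off that set supply these. Weak convergence rests on a
  second moment bound uniform in the sample size: an approximation error that is quadratic in the
  argument integrates directly against it, and the same bound drives the Slutsky argument.\<close>

lemma vimage_algebra_factorization:
  fixes f :: "'a \<Rightarrow> 'b::{banach, second_countable_topology}"
  assumes H: "H \<in> \<Omega> \<rightarrow> space N" and f: "f \<in> borel_measurable (vimage_algebra \<Omega> H N)"
  obtains F where "F \<in> borel_measurable N" "\<And>x. x \<in> \<Omega> \<Longrightarrow> F (H x) = f x"
proof -
  let ?V = "vimage_algebra \<Omega> H N"
  obtain s where s: "\<And>i. simple_function ?V (s i)" "\<And>x. x \<in> space ?V \<Longrightarrow> (\<lambda>i. s i x) \<longlonglongrightarrow> f x"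
    using borel_measurable_implies_sequence_metric[OF f, of 0] by blast
  \<comment> \<open>Doob-Dynkin for a simple function: each of its finitely many level sets is the
    preimage under \<open>H\<close> of some \<open>B v\<close>, and the same linear combination of
    the indicators of the \<open>B v\<close> is the lift.\<close>
  have "\<exists>F. F \<in> borel_measurable N \<and> (\<forall>x\<in>\<Omega>. F (H x) = s i x)" for i
  proof -
    have "\<exists>B\<in>sets N. s i -` {v} \<inter> \<Omega> = H -` B \<inter> \<Omega>" for v
    proof -
      have "s i -` {v} \<inter> \<Omega> \<in> sets ?V" using simple_functionD(2)[OF s(1)[of i], of "{v}"] by simp
      then show ?thesis unfolding sets_vimage_algebra2[OF H] by blast
    qed
    then obtain B where B: "\<And>v. B v \<in> sets N" "\<And>v. s i -` {v} \<inter> \<Omega> = H -` B v \<inter> \<Omega>" by metis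
    have fin: "finite (s i ` \<Omega>)" using s(1)[of i] by (simp add: simple_function_def)
    show ?thesis
    proof (intro exI[of _ "\<lambda>y. \<Sum>v\<in>s i ` \<Omega>. indicator (B v) y *\<^sub>R v"] conjI ballI)
      show "(\<lambda>y. \<Sum>v\<in>s i ` \<Omega>. indicator (B v) y *\<^sub>R v) \<in> borel_measurable N"
        by (intro borel_measurable_sum borel_measurable_scaleR borel_measurable_indicator B(1) borel_measurable_const)
      fix x assume x: "x \<in> \<Omega>"
      have "(\<Sum>v\<in>s i ` \<Omega>. indicator (B v) (H x) *\<^sub>R v) = (\<Sum>v\<in>s i ` \<Omega>. if v = s i x then v else 0)"
      proof (rule sum.cong)
        fix v assume "v \<in> s i ` \<Omega>"
        have "H x \<in> B v \<longleftrightarrow> s i x = v" using B(2)[of v] x by blast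
        thus "indicator (B v) (H x) *\<^sub>R v = (if v = s i x then v else 0)" by (auto simp: indicator_def)
      qed simp
      also have "\<dots> = s i x" using fin x by simp
      finally show "(\<Sum>v\<in>s i ` \<Omega>. indicator (B v) (H x) *\<^sub>R v) = s i x" .
    qed
  qed
  then obtain G where G: "\<And>i. G i \<in> borel_measurable N" "\<And>i x. x \<in> \<Omega> \<Longrightarrow> G i (H x) = s i x" by metis
  show thesis
  proof
    \<comment> \<open>Off the range of \<open>H\<close> the lifted sequence may diverge;
      \<open>lim\<close> is measurable regardless, and on the range it is the true limit.\<close>
    show "(\<lambda>y. lim (\<lambda>i. G i y)) \<in> borel_measurable N" by (rule borel_measurable_lim_metric[OF G(1)])
    fix x assume "x \<in> \<Omega>"
    thus "lim (\<lambda>i. G i (H x)) = f x" using s(2)[of x] by (simp add: G(2) limI)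
  qed
qed

text \<open>\<open>restrict_space N S\<close> is the sigma-algebra pulled back along the inclusion
  of \<open>S\<close>, so the factorization applies with \<open>H\<close> the identity. This covers
  sets \<open>S\<close> that are not measurable, as the context space may be.\<close>

lemma borel_measurable_restrict_space_extend:
  fixes f :: "'a \<Rightarrow> 'b::{banach, second_countable_topology}"
  assumes f: "f \<in> borel_measurable (restrict_space N S)" and S: "S \<subseteq> space N"
  obtains F where "F \<in> borel_measurable N" "\<And>x. x \<in> S \<Longrightarrow> F x = f x"
proof -
  have "f \<in> borel_measurable (vimage_algebra S (\<lambda>x. x) N)"
    using f by (simp add: measurable_cong_sets[OF restrict_space_eq_vimage_algebra[OF S] refl])
  from vimage_algebra_factorization[OF _ this] S show thesis using that by (metis Pi_I subsetD)
qed

text \<open>The product of a trace sigma-algebra with \<open>N'\<close> is contained in the trace of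
  the product on the rectangle, so the previous extension applies. It serves the policy as a joint
  function of context and history, and the score as a joint function of context and outcome.\<close>

lemma borel_measurable_restrict_pair_extend:
  fixes f :: "'a \<times> 'b \<Rightarrow> 'c::{banach, second_countable_topology}"
  assumes f: "f \<in> borel_measurable (restrict_space N S \<Otimes>\<^sub>M N')" and S: "S \<subseteq> space N"
  obtains F where "F \<in> borel_measurable (N \<Otimes>\<^sub>M N')" "\<And>x y. x \<in> S \<Longrightarrow> y \<in> space N' \<Longrightarrow> F (x, y) = f (x, y)"
proof -
  let ?R = "restrict_space (N \<Otimes>\<^sub>M N') (S \<times> space N')"
  have "(\<lambda>z. z) \<in> ?R \<rightarrow>\<^sub>M restrict_space N S \<Otimes>\<^sub>M N'"
  proof -
    have "fst \<in> ?R \<rightarrow>\<^sub>M restrict_space N S"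
      by (rule measurable_restrict_space2) (auto simp: space_restrict_space space_pair_measure intro!: measurable_restrict_space1)
    moreover have "snd \<in> ?R \<rightarrow>\<^sub>M N'" by (intro measurable_restrict_space1 measurable_snd)
    ultimately have "(\<lambda>z. (fst z, snd z)) \<in> ?R \<rightarrow>\<^sub>M restrict_space N S \<Otimes>\<^sub>M N'" by (rule measurable_Pair)
    then show ?thesis by simp
  qed
  from measurable_compose[OF this f] have "f \<in> borel_measurable ?R" by simp
  moreover have "S \<times> space N' \<subseteq> space (N \<Otimes>\<^sub>M N')" using S by (auto simp: space_pair_measure)
  ultimately show thesis using borel_measurable_restrict_space_extend that by (metis mem_Sigma_iff)
qed

section \<open>Convergence in probability\<close>

context prob_space begin

text \<open>The usual O_p(1). The bound is uniform from index 1 on rather than eventual, which is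
  what moment bounds deliver directly.\<close>

definition bounded_in_prob :: "(nat \<Rightarrow> 'a \<Rightarrow> real) \<Rightarrow> bool" where
  "bounded_in_prob Z \<longleftrightarrow>
     (\<forall>\<eta>>0. \<exists>K>0. \<forall>n\<ge>1. prob {\<omega>\<in>space M. \<bar>Z n \<omega>\<bar> > K} \<le> \<eta>)"

lemma tendsto_zero_in_probD:
  "tendsto_zero_in_prob M Z \<Longrightarrow> e > 0 \<Longrightarrow> (\<lambda>n. prob {\<omega>\<in>space M. norm (Z n \<omega>) > e}) \<longlonglongrightarrow> 0"
  by (simp add: tendsto_zero_in_prob_def)

text \<open>Domination is required only off events of vanishing probability. A local expansion,
  valid when the parameter is close to \<open>\<theta>s\<close> and a random multiplier is small,
  can thus serve for the whole sequence.\<close>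

lemma tendsto_zero_in_prob_dominated:
  fixes Z :: "nat \<Rightarrow> 'a \<Rightarrow> 'b::real_normed_vector" and W :: "nat \<Rightarrow> 'a \<Rightarrow> real"
  assumes W: "\<And>n. n \<ge> 1 \<Longrightarrow> random_variable borel (W n)" "tendsto_zero_in_prob M W"
    and B: "\<And>n. n \<ge> 1 \<Longrightarrow> B n \<in> events" "(\<lambda>n. prob (B n)) \<longlonglongrightarrow> 0"
    and le: "\<And>n. n \<ge> 1 \<Longrightarrow> AE \<omega> in M. \<omega> \<notin> B n \<longrightarrow> norm (Z n \<omega>) \<le> W n \<omega>"
  shows "tendsto_zero_in_prob M Z"
  unfolding tendsto_zero_in_prob_def
proof (intro allI impI)
  fix e :: real assume e: "e > 0"
  have "(\<lambda>n. prob {\<omega>\<in>space M. norm (W n \<omega>) > e} + prob (B n)) \<longlonglongrightarrow> 0 + 0"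
    using W(2) B(2) e by (intro tendsto_add) (auto simp: tendsto_zero_in_prob_def)
  hence lim: "(\<lambda>n. prob {\<omega>\<in>space M. norm (W n \<omega>) > e} + prob (B n)) \<longlonglongrightarrow> 0" by simp
  show "(\<lambda>n. prob {\<omega>\<in>space M. norm (Z n \<omega>) > e}) \<longlonglongrightarrow> 0"
  proof (rule tendsto_sandwich[OF _ _ tendsto_const lim])
    show "\<forall>\<^sub>F n in sequentially. prob {\<omega>\<in>space M. norm (Z n \<omega>) > e} \<le> prob {\<omega>\<in>space M. norm (W n \<omega>) > e} + prob (B n)"
    proof (rule eventually_sequentiallyI[of 1])
      fix n :: nat assume n: "1 \<le> n"
      note [measurable] = W(1)[OF n] B(1)[OF n]
      have "AE \<omega> in M. \<omega> \<in> {\<omega>\<in>space M. norm (Z n \<omega>) > e} \<longrightarrow> \<omega> \<in> {\<omega>\<in>space M. norm (W n \<omega>) > e} \<union> B n"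
        using le[OF n] by eventually_elim auto
      then have "prob {\<omega>\<in>space M. norm (Z n \<omega>) > e} \<le> prob ({\<omega>\<in>space M. norm (W n \<omega>) > e} \<union> B n)"
        by (rule finite_measure_mono_AE) measurable
      also have "\<dots> \<le> prob {\<omega>\<in>space M. norm (W n \<omega>) > e} + prob (B n)"
        by (intro measure_Un_le) auto
      finally show "prob {\<omega>\<in>space M. norm (Z n \<omega>) > e} \<le> \<dots>" .
    qed
  qed auto
qed

lemma tendsto_zero_in_prob_le:
  fixes Z :: "nat \<Rightarrow> 'a \<Rightarrow> 'b::real_normed_vector" and W :: "nat \<Rightarrow> 'a \<Rightarrow> real"
  assumes "\<And>n. n \<ge> 1 \<Longrightarrow> random_variable borel (W n)" "tendsto_zero_in_prob M W"
    and "\<And>n. n \<ge> 1 \<Longrightarrow> AE \<omega> in M. norm (Z n \<omega>) \<le> W n \<omega>"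
  shows "tendsto_zero_in_prob M Z"
  by (rule tendsto_zero_in_prob_dominated[where B = "\<lambda>_. {}", OF assms(1,2)]) (use assms(3) in simp_all)

lemma tendsto_zero_in_prob_add:
  fixes Z W :: "nat \<Rightarrow> 'a \<Rightarrow> real"
  assumes Z: "\<And>n. n \<ge> 1 \<Longrightarrow> random_variable borel (Z n)" "tendsto_zero_in_prob M Z"
    and W: "\<And>n. n \<ge> 1 \<Longrightarrow> random_variable borel (W n)" "tendsto_zero_in_prob M W"
  shows "tendsto_zero_in_prob M (\<lambda>n \<omega>. Z n \<omega> + W n \<omega>)"
  unfolding tendsto_zero_in_prob_def
proof (intro allI impI)
  fix e :: real assume e: "e > 0"
  have "(\<lambda>n. prob {\<omega>\<in>space M. norm (Z n \<omega>) > e/2} + prob {\<omega>\<in>space M. norm (W n \<omega>) > e/2}) \<longlonglongrightarrow> 0 + 0"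
    using tendsto_zero_in_probD[OF Z(2), of "e/2"] tendsto_zero_in_probD[OF W(2), of "e/2"] e by (intro tendsto_add) auto
  hence lim: "(\<lambda>n. prob {\<omega>\<in>space M. norm (Z n \<omega>) > e/2} + prob {\<omega>\<in>space M. norm (W n \<omega>) > e/2}) \<longlonglongrightarrow> 0" by simp
  show "(\<lambda>n. prob {\<omega>\<in>space M. norm (Z n \<omega> + W n \<omega>) > e}) \<longlonglongrightarrow> 0"
  proof (rule tendsto_sandwich[OF _ _ tendsto_const lim])
    show "\<forall>\<^sub>F n in sequentially. prob {\<omega>\<in>space M. norm (Z n \<omega> + W n \<omega>) > e} \<le> prob {\<omega>\<in>space M. norm (Z n \<omega>) > e/2} + prob {\<omega>\<in>space M. norm (W n \<omega>) > e/2}"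
    proof (rule eventually_sequentiallyI[of 1])
      fix n :: nat assume n: "1 \<le> n"
      note [measurable] = Z(1)[OF n] W(1)[OF n]
      have "prob {\<omega>\<in>space M. norm (Z n \<omega> + W n \<omega>) > e} \<le> prob ({\<omega>\<in>space M. norm (Z n \<omega>) > e/2} \<union> {\<omega>\<in>space M. norm (W n \<omega>) > e/2})"
        by (intro finite_measure_mono) auto
      also have "\<dots> \<le> prob {\<omega>\<in>space M. norm (Z n \<omega>) > e/2} + prob {\<omega>\<in>space M. norm (W n \<omega>) > e/2}"
        by (intro measure_Un_le) auto
      finally show "prob {\<omega>\<in>space M. norm (Z n \<omega> + W n \<omega>) > e} \<le> \<dots>" .
    qed
  qed auto
qed

lemma tendsto_zero_in_prob_sum:
  fixes Z :: "'i \<Rightarrow> nat \<Rightarrow> 'a \<Rightarrow> real"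
  assumes "finite I" and "\<And>i n. i \<in> I \<Longrightarrow> n \<ge> 1 \<Longrightarrow> random_variable borel (Z i n)"
    and "\<And>i. i \<in> I \<Longrightarrow> tendsto_zero_in_prob M (Z i)"
  shows "tendsto_zero_in_prob M (\<lambda>n \<omega>. \<Sum>i\<in>I. Z i n \<omega>)"
  using assms
proof (induction I)
  case empty then show ?case by (simp add: tendsto_zero_in_prob_def)
next
  case (insert j J)
  have "tendsto_zero_in_prob M (\<lambda>n \<omega>. \<Sum>i\<in>J. Z i n \<omega>)"
    by (rule insert.IH) (simp_all add: insert.prems)
  then have "tendsto_zero_in_prob M (\<lambda>n \<omega>. Z j n \<omega> + (\<Sum>i\<in>J. Z i n \<omega>))"
    by (intro tendsto_zero_in_prob_add borel_measurable_sum insert.prems) simp_all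
  then show ?case by (simp add: insert.hyps)
qed

text \<open>For a product to exceed \<open>e\<close>, either the bounded factor exceeds
  \<open>K\<close> or the vanishing one exceeds \<open>e/K\<close>. The level \<open>K\<close> is
  fixed before \<open>n\<close>, so a single tail of \<open>Z\<close> has to be small.\<close>

lemma tendsto_zero_in_prob_mult_bounded:
  fixes Z W :: "nat \<Rightarrow> 'a \<Rightarrow> real"
  assumes Z: "\<And>n. n \<ge> 1 \<Longrightarrow> random_variable borel (Z n)" "tendsto_zero_in_prob M Z"
    and W: "\<And>n. n \<ge> 1 \<Longrightarrow> random_variable borel (W n)" "bounded_in_prob W"
  shows "tendsto_zero_in_prob M (\<lambda>n \<omega>. Z n \<omega> * W n \<omega>)"
  unfolding tendsto_zero_in_prob_def
proof (intro allI impI LIMSEQ_I)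
  fix e r :: real assume e: "e > 0" and r: "r > 0"
  obtain K where K: "K > 0" "\<And>n. n \<ge> 1 \<Longrightarrow> prob {\<omega>\<in>space M. \<bar>W n \<omega>\<bar> > K} \<le> r/2"
    using W(2)[unfolded bounded_in_prob_def, rule_format, of "r/2"] half_gt_zero[OF r] by blast
  have "(\<lambda>n. prob {\<omega>\<in>space M. norm (Z n \<omega>) > e/K}) \<longlonglongrightarrow> 0"
    using e K by (intro tendsto_zero_in_probD[OF Z(2)]) simp
  from LIMSEQ_D[OF this, of "r/2"] r obtain N where N: "\<And>n. n \<ge> N \<Longrightarrow> prob {\<omega>\<in>space M. norm (Z n \<omega>) > e/K} < r/2" by auto
  have "norm (prob {\<omega>\<in>space M. norm (Z n \<omega> * W n \<omega>) > e} - 0) < r" if n: "n \<ge> max N 1" for n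
  proof -
    have n1: "n \<ge> 1" using n by simp
    note [measurable] = Z(1)[OF n1] W(1)[OF n1]
    have sub: "{\<omega>\<in>space M. norm (Z n \<omega> * W n \<omega>) > e} \<subseteq> {\<omega>\<in>space M. norm (Z n \<omega>) > e/K} \<union> {\<omega>\<in>space M. \<bar>W n \<omega>\<bar> > K}"
    proof clarsimp
      fix \<omega> assume "e < \<bar>Z n \<omega> * W n \<omega>\<bar>" "\<not> K < \<bar>W n \<omega>\<bar>"
      hence "e < \<bar>Z n \<omega>\<bar> * K" 
        using mult_left_mono[of "\<bar>W n \<omega>\<bar>" K "\<bar>Z n \<omega>\<bar>"] by (simp add: abs_mult)
      thus "e / K < \<bar>Z n \<omega>\<bar>" using K by (simp add: divide_less_eq)
    qed
    have "prob {\<omega>\<in>space M. norm (Z n \<omega> * W n \<omega>) > e} \<le> prob ({\<omega>\<in>space M. norm (Z n \<omega>) > e/K} \<union> {\<omega>\<in>space M. \<bar>W n \<omega>\<bar> > K})"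
      using sub by (intro finite_measure_mono) auto
    also have "\<dots> \<le> prob {\<omega>\<in>space M. norm (Z n \<omega>) > e/K} + prob {\<omega>\<in>space M. \<bar>W n \<omega>\<bar> > K}"
      by (intro measure_Un_le) auto
    also have "\<dots> < r" using N[of n] K(2)[of n] n by simp
    finally show ?thesis by simp
  qed
  thus "\<exists>no. \<forall>n\<ge>no. norm (prob {\<omega>\<in>space M. norm (Z n \<omega> * W n \<omega>) > e} - 0) < r" by blast
qed

lemma bounded_in_prob_expectation:
  assumes "\<And>n. n \<ge> 1 \<Longrightarrow> integrable M (Z n)" "\<And>n. n \<ge> 1 \<Longrightarrow> expectation (\<lambda>\<omega>. \<bar>Z n \<omega>\<bar>) \<le> C"
  shows "bounded_in_prob Z"
  unfolding bounded_in_prob_def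
proof (intro allI impI)
  fix \<eta> :: real assume \<eta>: "\<eta> > 0"
  have C: "0 \<le> C" by (rule order_trans[OF Bochner_Integration.integral_nonneg assms(2)[of 1]]) auto
  show "\<exists>K>0. \<forall>n\<ge>1. prob {\<omega>\<in>space M. \<bar>Z n \<omega>\<bar> > K} \<le> \<eta>"
  \<comment> \<open>Markov's threshold is \<open>C/\<eta>\<close>; the added 1 keeps it positive
    when \<open>C\<close> is 0.\<close>
  proof (intro exI[of _ "C/\<eta> + 1"] conjI allI impI)
    show "0 < C/\<eta> + 1" using C \<eta> by (simp add: add_nonneg_pos)
    fix n :: nat assume n: "1 \<le> n"
    note [measurable] = borel_measurable_integrable[OF assms(1)[OF n]]
    have "prob {\<omega>\<in>space M. \<bar>Z n \<omega>\<bar> > C/\<eta> + 1} \<le> prob {\<omega>\<in>space M. \<bar>Z n \<omega>\<bar> \<ge> C/\<eta> + 1}"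
      by (intro finite_measure_mono) auto
    also have "\<dots> \<le> expectation (\<lambda>\<omega>. \<bar>Z n \<omega>\<bar>) / (C/\<eta> + 1)"
      using assms(1)[OF n] \<open>0 < C/\<eta> + 1\<close> by (intro integral_Markov_inequality_measure[where A="{}"]) auto
    also have "\<dots> \<le> C / (C/\<eta> + 1)" using assms(2)[OF n] \<open>0 < C/\<eta> + 1\<close> by (intro divide_right_mono) auto
    also have "\<dots> \<le> \<eta>" using C \<eta> by (simp add: field_simps)
    finally show "prob {\<omega>\<in>space M. \<bar>Z n \<omega>\<bar> > C/\<eta> + 1} \<le> \<eta>" .
  qed
qed

lemma tendsto_zero_in_prob_expectation:
  fixes Z :: "nat \<Rightarrow> 'a \<Rightarrow> real"
  assumes "\<And>n. n \<ge> 1 \<Longrightarrow> integrable M (Z n)" "(\<lambda>n. expectation (\<lambda>\<omega>. \<bar>Z n \<omega>\<bar>)) \<longlonglongrightarrow> 0"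
  shows "tendsto_zero_in_prob M Z"
  unfolding tendsto_zero_in_prob_def
proof (intro allI impI)
  fix e :: real assume e: "e > 0"
  have lim: "(\<lambda>n. expectation (\<lambda>\<omega>. \<bar>Z n \<omega>\<bar>) / e) \<longlonglongrightarrow> 0" using tendsto_divide[OF assms(2) tendsto_const[of e]] e by simp
  show "(\<lambda>n. prob {\<omega>\<in>space M. norm (Z n \<omega>) > e}) \<longlonglongrightarrow> 0"
  proof (rule tendsto_sandwich[OF _ _ tendsto_const lim])
    show "\<forall>\<^sub>F n in sequentially. prob {\<omega>\<in>space M. norm (Z n \<omega>) > e} \<le> expectation (\<lambda>\<omega>. \<bar>Z n \<omega>\<bar>) / e"
    proof (rule eventually_sequentiallyI[of 1])
      fix n :: nat assume n: "1 \<le> n"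
      note [measurable] = borel_measurable_integrable[OF assms(1)[OF n]]
      have "prob {\<omega>\<in>space M. norm (Z n \<omega>) > e} \<le> prob {\<omega>\<in>space M. \<bar>Z n \<omega>\<bar> \<ge> e}"
        by (intro finite_measure_mono) auto
      also have "\<dots> \<le> expectation (\<lambda>\<omega>. \<bar>Z n \<omega>\<bar>) / e"
        using assms(1)[OF n] e by (intro integral_Markov_inequality_measure[where A="{}"]) auto
      finally show "prob {\<omega>\<in>space M. norm (Z n \<omega>) > e} \<le> expectation (\<lambda>\<omega>. \<bar>Z n \<omega>\<bar>) / e" .
    qed
  qed auto
qed

text \<open>Bounded convergence under convergence in probability:
  \<open>\<bar>Z n \<omega>\<bar>\<close> is at most \<open>r/2\<close> off a rare event and at most
  \<open>B\<close> on it. Applied to the propensities, it upgrades their assumed convergence to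
  convergence in mean.\<close>

lemma expectation_tendsto_zero_bounded:
  fixes Z :: "nat \<Rightarrow> 'a \<Rightarrow> real"
  assumes rv: "\<And>n. n \<ge> 1 \<Longrightarrow> random_variable borel (Z n)" and op: "tendsto_zero_in_prob M Z"
    and bd: "\<And>n \<omega>. n \<ge> 1 \<Longrightarrow> \<omega> \<in> space M \<Longrightarrow> \<bar>Z n \<omega>\<bar> \<le> B"
  shows "(\<lambda>n. expectation (\<lambda>\<omega>. \<bar>Z n \<omega>\<bar>)) \<longlonglongrightarrow> 0"
proof (rule LIMSEQ_I)
  fix r :: real assume r: "r > 0"
  obtain \<omega>0 where "\<omega>0 \<in> space M" using not_empty by blast
  hence B: "0 \<le> B" using bd[of 1 \<omega>0] by simp
  have "(\<lambda>n. prob {\<omega>\<in>space M. norm (Z n \<omega>) > r/2}) \<longlonglongrightarrow> 0"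
    using r by (intro tendsto_zero_in_probD[OF op]) simp
  from LIMSEQ_D[OF this, of "r/(2 * (B+1))"] r B 
  obtain N where N: "\<And>n. n \<ge> N \<Longrightarrow> prob {\<omega>\<in>space M. norm (Z n \<omega>) > r/2} < r/(2 * (B+1))" by auto
  have "norm (expectation (\<lambda>\<omega>. \<bar>Z n \<omega>\<bar>) - 0) < r" if n: "n \<ge> max N 1" for n
  proof -
    have n1: "n \<ge> 1" using n by simp
    note [measurable] = rv[OF n1]
    let ?A = "{\<omega>\<in>space M. norm (Z n \<omega>) > r/2}"
    have i: "integrable M (\<lambda>\<omega>. \<bar>Z n \<omega>\<bar>)" using bd[OF n1] by (intro integrable_const_bound[of _ B]) auto
    have iA: "integrable M (indicat_real ?A)" by (intro integrable_real_indicator) (auto simp: emeasure_eq_measure)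
    have "expectation (\<lambda>\<omega>. \<bar>Z n \<omega>\<bar>) \<le> expectation (\<lambda>\<omega>. r/2 + (B+1) * indicator ?A \<omega>)"
    proof (intro integral_mono i)
      show "integrable M (\<lambda>\<omega>. r/2 + (B+1) * indicat_real ?A \<omega>)"
        by (intro Bochner_Integration.integrable_add integrable_const integrable_mult_right iA)
      fix \<omega> assume "\<omega> \<in> space M" thus "\<bar>Z n \<omega>\<bar> \<le> r/2 + (B+1) * indicat_real ?A \<omega>"
        using bd[OF n1, of \<omega>] r B by (auto simp: indicator_def)
    qed
    also have "\<dots> = r/2 + (B+1) * prob ?A" using iA by (subst Bochner_Integration.integral_add) (auto simp: prob_space)
    also have "\<dots> < r/2 + (B+1) * (r / (2 * (B+1)))" using N[of n] n B by (intro add_strict_left_mono mult_strict_left_mono) auto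
    also have "\<dots> = r" using B by (simp add: field_simps)
    finally show ?thesis using Bochner_Integration.integral_nonneg[of M "\<lambda>\<omega>. \<bar>Z n \<omega>\<bar>"] by simp
  qed
  thus "\<exists>no. \<forall>n\<ge>no. norm (expectation (\<lambda>\<omega>. \<bar>Z n \<omega>\<bar>) - 0) < r" by blast
qed

end

section \<open>Weak convergence of random vectors\<close>

text \<open>The complex span of the characters \<open>cis (u \<bullet> x)\<close>. Convergence of
  characteristic functions passes to this span by linearity, and since it is an algebra it contains
  the periodic functions that will approximate a general test function.\<close>

inductive trig_poly :: "(real^'n \<Rightarrow> complex) \<Rightarrow> bool" where
  mono: "trig_poly (\<lambda>x. c * cis (u \<bullet> x))"
| add: "trig_poly f \<Longrightarrow> trig_poly h \<Longrightarrow> trig_poly (\<lambda>x. f x + h x)"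

lemma trig_poly_const: "trig_poly (\<lambda>x. c)"
  using trig_poly.mono[of c 0] by simp

lemma trig_poly_mult:
  assumes "trig_poly f" "trig_poly h" shows "trig_poly (\<lambda>x. f x * h x)"
  using assms(1)
proof induction
  case (mono c u)
  show ?case using assms(2)
  proof induction
    case (mono d v)
    have "(\<lambda>x. c * cis (u \<bullet> x) * (d * cis (v \<bullet> x))) = (\<lambda>x. (c * d) * cis ((u + v) \<bullet> x))"
      by (simp add: inner_add_left cis_mult[symmetric] ac_simps)
    then show ?case by (simp add: trig_poly.mono)
  qed (simp add: distrib_left trig_poly.add)
qed (simp add: distrib_right trig_poly.add)

lemma trig_poly_sum:
  "(\<And>i. i \<in> I \<Longrightarrow> trig_poly (f i)) \<Longrightarrow> trig_poly (\<lambda>x. \<Sum>i\<in>I. f i x)"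
proof (induction I rule: infinite_finite_induct)
  case (insert i I) then show ?case using trig_poly.add[of "f i" "\<lambda>x. \<Sum>i\<in>I. f i x"] by simp
qed (use trig_poly_const[of 0] in simp_all)

lemma trig_poly_bounded_continuous:
  "trig_poly f \<Longrightarrow> continuous_on UNIV f \<and> (\<exists>B. \<forall>x. cmod (f x) \<le> B)"
proof (induction rule: trig_poly.induct)
  case (mono c u)
  then show ?case by (auto intro!: continuous_intros exI[of _ "cmod c"] simp: norm_mult)
next
  case (add f h)
  then obtain B C where "\<forall>x. cmod (f x) \<le> B" "\<forall>x. cmod (h x) \<le> C" by blast
  then have "\<forall>x. cmod (f x + h x) \<le> B + C" by (meson add_mono norm_triangle_le order_trans norm_triangle_ineq)
  with add show ?case by (auto intro!: continuous_intros)
qed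

lemma trig_poly_Re_cos_sin:
  fixes u :: "real^'n" 
  shows "trig_poly (\<lambda>x. of_real (cos (u \<bullet> x)))" "trig_poly (\<lambda>x. of_real (sin (u \<bullet> x)))"
proof -
  have "trig_poly (\<lambda>x. 1/2 * cis (u \<bullet> x) + 1/2 * cis ((-u) \<bullet> x))" by (intro trig_poly.intros)
  moreover have "(\<lambda>x. 1/2 * cis (u \<bullet> x) + 1/2 * cis ((-u) \<bullet> x)) = (\<lambda>x. complex_of_real (cos (u \<bullet> x)))"
    by (rule ext) (simp add: complex_eq_iff)
  ultimately show "trig_poly (\<lambda>x. of_real (cos (u \<bullet> x)))" by simp
  have "trig_poly (\<lambda>x. (-\<i>/2) * cis (u \<bullet> x) + (\<i>/2) * cis ((-u) \<bullet> x))" by (intro trig_poly.intros)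
  moreover have "(\<lambda>x. (-\<i>/2) * cis (u \<bullet> x) + (\<i>/2) * cis ((-u) \<bullet> x)) = (\<lambda>x. complex_of_real (sin (u \<bullet> x)))"
    by (rule ext) (simp add: complex_eq_iff)
  ultimately show "trig_poly (\<lambda>x. of_real (sin (u \<bullet> x)))" by simp
qed

text \<open>Real and imaginary parts of \<open>cis (x $ i / L)\<close> are a cosine and a sine,
  hence trigonometric polynomials; a real linear functional of the complex coordinates is a
  combination of these, and sums and products stay in the class.\<close>

lemma trig_poly_polynomial:
  fixes L :: real and P :: "complex^'n \<Rightarrow> real"
  assumes "real_polynomial_function P"
  shows "trig_poly (\<lambda>x::real^'n. complex_of_real (P (\<chi> i. cis (x $ i / L))))"
  using assms
proof induction
  case (linear f)
  interpret bounded_linear f by fact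
  have eq: "f z = (\<Sum>i\<in>UNIV. Re (z $ i) * f (axis i 1) + Im (z $ i) * f (axis i \<i>))" for z :: "complex^'n"
  proof -
    have "z = (\<Sum>i\<in>UNIV. Re (z $ i) *\<^sub>R axis i 1 + Im (z $ i) *\<^sub>R axis i \<i>)"
      by (simp add: vec_eq_iff axis_def complex_eq_iff if_distrib[of Re] if_distrib[of Im] if_distrib[of "(*) _"] cong: if_cong)
    then have "f z = f (\<Sum>i\<in>UNIV. Re (z $ i) *\<^sub>R axis i 1 + Im (z $ i) *\<^sub>R axis i \<i>)" by (rule arg_cong)
    then show ?thesis by (simp add: sum add scaleR)
  qed
  have cs: "trig_poly (\<lambda>x::real^'n. complex_of_real (cos (x $ i / L)))" "trig_poly (\<lambda>x::real^'n. complex_of_real (sin (x $ i / L)))" for i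
  proof -
    have "axis i (1/L) \<bullet> x = x $ i / L" for x :: "real^'n" by (simp add: inner_axis' )
    then show "trig_poly (\<lambda>x::real^'n. complex_of_real (cos (x $ i / L)))" "trig_poly (\<lambda>x::real^'n. complex_of_real (sin (x $ i / L)))"
      using trig_poly_Re_cos_sin[of "axis i (1/L)"] by simp_all
  qed
  have "complex_of_real (f (\<chi> i. cis (x $ i / L))) = (\<Sum>i\<in>UNIV. complex_of_real (cos (x $ i / L)) * of_real (f (axis i 1))
      + complex_of_real (sin (x $ i / L)) * of_real (f (axis i \<i>)))" for x :: "real^'n"
    by (subst eq) (simp only: of_real_sum of_real_add of_real_mult vec_lambda_beta cis.sel)
  then show ?case
    by (simp only:) (intro trig_poly_sum trig_poly.add trig_poly_mult cs trig_poly_const)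
qed (simp_all add: trig_poly_const trig_poly.add trig_poly_mult)

text \<open>For \<open>\<parallel>x\<parallel>\<close> small compared with \<open>L\<close>, \<open>f x\<close> is recovered from the point
  \<open>(exp (\<i> x\<^sub>i / L))\<^sub>i\<close> of the torus; the factor \<open>max 0 (Re z\<^sub>i)\<close> removes the branch cut of \<open>Arg\<close>.\<close>

definition torus_lift :: "(real^'n \<Rightarrow> real) \<Rightarrow> real \<Rightarrow> complex^'n \<Rightarrow> real" where
  "torus_lift f L z = (\<Prod>i\<in>UNIV. max 0 (Re (z $ i))) * f (\<chi> i. L * Arg (z $ i))"

text \<open>The torus is the union of two closed sets. Where all real parts are nonnegative the
  coordinates avoid the cut of \<open>Arg\<close>, since a nonpositive real with nonnegative real
  part would be 0. Where some real part is nonpositive the damping factor makes the lift vanish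
  identically. Continuity on both closed pieces gives continuity on the union.\<close>

lemma continuous_on_torus_lift:
  fixes f :: "real^'n \<Rightarrow> real"
  assumes f: "continuous_on UNIV f"
  shows "continuous_on {z. \<forall>i. cmod (z $ i) = 1} (torus_lift f L)"
proof -
  let ?T = "{z::complex^'n. \<forall>i. cmod (z $ i) = 1}"
  let ?A = "{z\<in>?T. \<forall>i. 0 \<le> Re (z $ i)}" and ?B = "{z\<in>?T. \<exists>i. Re (z $ i) \<le> 0}"
  have cl: "closed ?T" by (intro closed_Collect_all closed_Collect_eq continuous_intros)
  have "?A = ?T \<inter> {z. \<forall>i. 0 \<le> Re (z $ i)}" by auto
  then have clA: "closed ?A" using cl by (auto intro!: closed_Int closed_Collect_all closed_Collect_le continuous_intros)
  have "?B = ?T \<inter> (\<Union>i. {z. Re (z $ i) \<le> 0})" by auto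
  moreover have "closed (\<Union>i. {z::complex^'n. Re (z $ i) \<le> 0})"
    by (intro closed_UN ballI closed_Collect_le continuous_intros) auto
  ultimately have clB: "closed ?B" using cl by (simp only: closed_Int)
  have "continuous_on ?A (torus_lift f L)"
  proof -
    have Arg: "continuous_on ?A (\<lambda>z. Arg (z $ i))" for i
    proof (rule continuous_on_compose2[of "- \<real>\<^sub>\<le>\<^sub>0" Arg ?A "\<lambda>z. z $ i"])
      show "continuous_on (- \<real>\<^sub>\<le>\<^sub>0) Arg" by (intro continuous_at_imp_continuous_on) (auto simp: continuous_at_Arg)
      show "(\<lambda>z. z $ i) ` ?A \<subseteq> - \<real>\<^sub>\<le>\<^sub>0"
      proof clarsimp
        fix z :: "complex^'n" assume *: "\<forall>i. cmod (z $ i) = 1" "\<forall>i. 0 \<le> Re (z $ i)" "z $ i \<in> \<real>\<^sub>\<le>\<^sub>0"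
        then have "Re (z $ i) \<le> 0" "Im (z $ i) = 0" by (auto simp: complex_nonpos_Reals_iff)
        with *(2) have "z $ i = 0" by (simp add: complex_eq_iff order_antisym)
        with *(1) show False by (metis norm_zero zero_neq_one)
      qed
    qed (intro continuous_intros)
    then have "continuous_on ?A (\<lambda>z. f (\<chi> i. L * Arg (z $ i)))"
      by (intro continuous_on_compose2[OF f] continuous_on_vec_lambda continuous_on_mult continuous_on_const Arg) auto
    then show ?thesis unfolding torus_lift_def by (intro continuous_intros)
  qed
  moreover have "continuous_on ?B (torus_lift f L)"
  proof -
    have "torus_lift f L z = 0" if zB: "z \<in> ?B" for z
    proof -
      obtain i where "Re (z $ i) \<le> 0" using zB by blast
      then have "max 0 (Re (z $ i)) = 0" by simp
      then have "(\<Prod>i\<in>UNIV. max 0 (Re (z $ i))) = 0" by (intro prod_zero) auto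
      then show ?thesis by (simp add: torus_lift_def)
    qed
    then show ?thesis using continuous_on_const[of ?B "0::real"] continuous_on_cong by (smt (verit))
  qed
  ultimately have "continuous_on (?A \<union> ?B) (torus_lift f L)" by (intro continuous_on_closed_Un clA clB)
  moreover have "?A \<union> ?B = ?T" by (force simp: not_le intro: less_imp_le)
  ultimately show ?thesis by simp
qed

lemma compact_torus: "compact {z::complex^'n. \<forall>i. cmod (z $ i) = 1}"
proof -
  have "closed {z::complex^'n. \<forall>i. cmod (z $ i) = 1}" by (intro closed_Collect_all closed_Collect_eq continuous_intros)
  moreover have "bounded {z::complex^'n. \<forall>i. cmod (z $ i) = 1}"
    unfolding bounded_iff
  proof (intro exI ballI)
    fix z :: "complex^'n" assume "z \<in> {z. \<forall>i. cmod (z $ i) = 1}"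
    then show "norm z \<le> (\<Sum>i\<in>(UNIV::'n set). 1)" using L2_set_le_sum[of UNIV "\<lambda>i. norm (z $ i)"] by (simp add: norm_vec_def)
  qed
  ultimately show ?thesis by (simp add: compact_eq_bounded_closed)
qed

lemma one_minus_prod_le_sum:
  fixes c :: "'i \<Rightarrow> real"
  assumes "finite I" "\<And>i. i \<in> I \<Longrightarrow> 0 \<le> c i \<and> c i \<le> 1"
  shows "1 - (\<Prod>i\<in>I. c i) \<le> (\<Sum>i\<in>I. 1 - c i)"
  using assms
proof (induction I)
  case (insert j J)
  have "c j * (1 - (\<Prod>i\<in>J. c i)) \<le> 1 * (1 - (\<Prod>i\<in>J. c i))" 
    using insert.prems by (intro mult_right_mono) (auto intro!: prod_le_1)
  then have "1 - c j * (\<Prod>i\<in>J. c i) \<le> (1 - c j) + (1 - (\<Prod>i\<in>J. c i))" by (simp add: algebra_simps)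
  with insert show ?case by simp
qed simp

text \<open>The error is kept quadratic in \<open>norm x\<close> so that it integrates against a
  second moment. Inside the cube of half-width \<open>pi / 2 * L\<close> the angles recover
  \<open>x\<close> exactly and only the damping product differs from 1, by at most the sum of the
  \<open>1 - cos (x $ i / L)\<close>. Outside, some coordinate is at least \<open>L\<close> in
  absolute value, so the trivial bound \<open>2 * B\<close> already has the claimed size.\<close>

lemma torus_lift_approx:
  fixes f :: "real^'n \<Rightarrow> real"
  assumes B: "\<And>x. \<bar>f x\<bar> \<le> B" and L: "L > 0"
  shows "\<bar>torus_lift f L (\<chi> i. cis (x $ i / L)) - f x\<bar> \<le> 2 * B * (norm x)\<^sup>2 / L\<^sup>2"
proof -
  have B0: "0 \<le> B" using B[of 0] by linarith
  let ?c = "\<lambda>i. max 0 (cos (x $ i / L))"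
  have c01: "0 \<le> ?c i" "?c i \<le> 1" for i by auto
  have p01: "0 \<le> (\<Prod>i\<in>UNIV. ?c i)" "(\<Prod>i\<in>UNIV. ?c i) \<le> 1" by (auto intro!: prod_nonneg prod_le_1)
  have n2: "(norm x)\<^sup>2 = (\<Sum>i\<in>UNIV. (x $ i)\<^sup>2)" 
    by (simp add: norm_vec_def L2_set_def sum_nonneg)
  show ?thesis
  proof (cases "\<forall>i. \<bar>x $ i\<bar> < pi / 2 * L")
    case True
    have small: "\<bar>x $ i / L\<bar> < pi / 2" for i using True[rule_format, of i] L by (simp add: abs_divide pos_divide_less_eq)
    have "Arg (cis (x $ i / L)) = x $ i / L" for i
    proof (rule Arg_cis)
      have "- pi < x $ i / L" "x $ i / L \<le> pi" using small[of i, unfolded abs_less_iff] pi_gt_zero by linarith+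
      then show "x $ i / L \<in> {-pi<..pi}" by simp
    qed
    then have "(\<chi> i. L * Arg (cis (x $ i / L))) = x" using L by (simp add: vec_eq_iff)
    then have "torus_lift f L (\<chi> i. cis (x $ i / L)) - f x = - ((1 - (\<Prod>i\<in>UNIV. ?c i)) * f x)"
      unfolding torus_lift_def by (simp add: algebra_simps)
    then have "\<bar>torus_lift f L (\<chi> i. cis (x $ i / L)) - f x\<bar> = (1 - (\<Prod>i\<in>UNIV. ?c i)) * \<bar>f x\<bar>"
      using p01 by (simp add: abs_mult)
    also have "\<dots> \<le> (\<Sum>i\<in>UNIV. 1 - ?c i) * B" 
      using p01 B[of x] one_minus_prod_le_sum[of UNIV ?c] c01 by (intro mult_mono) auto
    also have "(\<Sum>i\<in>UNIV. 1 - ?c i) \<le> (\<Sum>i\<in>UNIV. (x $ i)\<^sup>2 / L\<^sup>2)"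
    proof (intro sum_mono)
      fix i
      have "cos (x $ i / L) = 1 - 2 * (sin (x $ i / L / 2))\<^sup>2" using cos_double_sin[of "x $ i / L / 2"] by simp
      moreover have "(sin (x $ i / L / 2))\<^sup>2 \<le> (x $ i / L / 2)\<^sup>2" by (rule abs_le_square_iff[THEN iffD1, OF abs_sin_x_le_abs_x])
      moreover have "(x $ i / L / 2)\<^sup>2 = (x $ i / L)\<^sup>2 / 4" by (simp add: power_divide)
      ultimately have "1 - cos (x $ i / L) \<le> (x $ i / L)\<^sup>2" using zero_le_power2[of "x $ i / L"] by linarith
      then show "1 - ?c i \<le> (x $ i)\<^sup>2 / L\<^sup>2" by (simp add: power_divide)
    qed
    also have "(\<Sum>i\<in>UNIV. (x $ i)\<^sup>2 / L\<^sup>2) * B = B * (norm x)\<^sup>2 / L\<^sup>2" by (simp add: n2 sum_divide_distrib[symmetric])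
    also have "\<dots> \<le> 2 * B * (norm x)\<^sup>2 / L\<^sup>2" using B0 by (intro divide_right_mono mult_right_mono) auto
    finally show ?thesis using B0 by (simp add: mult_right_mono)
  next
    case False
    then obtain i where i: "pi / 2 * L \<le> \<bar>x $ i\<bar>" by (auto simp: not_less)
    have "1 * L \<le> pi / 2 * L" using pi_ge_two L by (intro mult_right_mono) auto
    then have "L \<le> norm x" using i component_le_norm_cart[of x i] by linarith
    then have r: "1 \<le> (norm x)\<^sup>2 / L\<^sup>2" using L by (simp add: power_mono)
    have "\<bar>torus_lift f L (\<chi> i. cis (x $ i / L))\<bar> \<le> 1 * B"
      unfolding torus_lift_def abs_mult using p01 B by (intro mult_mono) auto
    then have "\<bar>torus_lift f L (\<chi> i. cis (x $ i / L)) - f x\<bar> \<le> 2 * B * 1" using B[of x] by linarith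
    also have "\<dots> \<le> 2 * B * ((norm x)\<^sup>2 / L\<^sup>2)" using r B0 by (intro mult_left_mono) auto
    finally show ?thesis by simp
  qed
qed

text \<open>The second moment bound controls the error of \<open>torus_lift\<close> uniformly in \<open>n\<close>, so tightness is not needed.\<close>

lemma levy_continuity_L2:
  fixes Z :: "nat \<Rightarrow> 'w \<Rightarrow> real^'n"
  assumes M: "prob_space M" and N: "prob_space N" and sN[measurable_cong]: "sets N = sets borel"
    and Z: "\<And>n. n \<ge> 1 \<Longrightarrow> Z n \<in> borel_measurable M"
    and char: "\<And>u. (\<lambda>n. CLINT \<omega>|M. cis (u \<bullet> Z n \<omega>)) \<longlonglongrightarrow> (CLINT x|N. cis (u \<bullet> x))"
    and int2: "\<And>n. n \<ge> 1 \<Longrightarrow> integrable M (\<lambda>\<omega>. (norm (Z n \<omega>))\<^sup>2)"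
    and bnd2: "\<And>n. n \<ge> 1 \<Longrightarrow> (LINT \<omega>|M. (norm (Z n \<omega>))\<^sup>2) \<le> C"
    and N2: "integrable N (\<lambda>x. (norm x)\<^sup>2)"
  shows "tendsto_in_distribution M Z N"
  unfolding tendsto_in_distribution_def
proof (intro allI impI LIMSEQ_I)
  fix f :: "real^'n \<Rightarrow> real" and e :: real
  assume f: "continuous_on UNIV f" and "bounded (range f)" and e: "0 < e"
  then obtain B where B: "\<And>x. \<bar>f x\<bar> \<le> B" unfolding bounded_iff by auto
  have B0: "0 \<le> B" using B[of 0] by linarith
  interpret M: prob_space M by fact
  interpret N: prob_space N by fact
  \<comment> \<open>\<open>V\<close> dominates at once the second moments of every
    \<open>Z n\<close> with \<open>n \<ge> 1\<close> and of the limit; the 1 makes it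
    positive.\<close>
  define V where "V = C + (LINT x|N. (norm x)\<^sup>2) + 1"
  have "0 \<le> C" by (rule order_trans[OF Bochner_Integration.integral_nonneg bnd2[of 1]]) auto
  moreover have "0 \<le> (LINT x|N. (norm x)\<^sup>2)" by (rule Bochner_Integration.integral_nonneg) auto
  ultimately have V: "0 < V" unfolding V_def by linarith
  \<comment> \<open>Chosen so that the quadratic error \<open>2 * B / L\<^sup>2 * V\<close> is at
    most \<open>e / 4\<close>; \<open>B + 1\<close> keeps the scale positive when \<open>B\<close>
    is 0.\<close>
  define L where "L = sqrt (8 * (B + 1) * V / e)"
  have L: "L > 0" unfolding L_def using B0 V e by simp
  have L2: "L\<^sup>2 = 8 * (B + 1) * V / e" unfolding L_def using B0 V e by simp
  let ?E = "\<lambda>x::real^'n. \<chi> i. cis (x $ i / L)"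
  obtain P where P: "real_polynomial_function P" "\<And>z. \<forall>i. cmod (z $ i) = 1 \<Longrightarrow> \<bar>torus_lift f L z - P z\<bar> < e / 8"
    using Stone_Weierstrass_real_polynomial_function[OF compact_torus continuous_on_torus_lift[OF f], of "e/8" L] e by auto
  define p where "p x = P (?E x)" for x
  have tp: "trig_poly (\<lambda>x. complex_of_real (p x))" unfolding p_def by (rule trig_poly_polynomial[OF P(1)])
  have app: "\<bar>p x - f x\<bar> \<le> e / 8 + 2 * B / L\<^sup>2 * (norm x)\<^sup>2" for x
  proof -
    have "\<bar>torus_lift f L (?E x) - p x\<bar> < e / 8" unfolding p_def by (rule P(2)) simp
    moreover have "\<bar>torus_lift f L (?E x) - f x\<bar> \<le> 2 * B / L\<^sup>2 * (norm x)\<^sup>2"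
      using torus_lift_approx[of f B L x, OF B L] by simp
    ultimately show ?thesis by linarith
  qed
  have conv: "(\<lambda>n. CLINT \<omega>|M. q (Z n \<omega>)) \<longlonglongrightarrow> (CLINT x|N. q x)" if "trig_poly q" for q
    using that
  proof induction
    case (mono c u)
    show ?case using tendsto_mult[OF tendsto_const char[of u], of c] by simp
  next
    case (add q r)
    have i: "integrable N s" "n \<ge> 1 \<Longrightarrow> integrable M (\<lambda>\<omega>. s (Z n \<omega>))" if "trig_poly s" for s n
    proof -
      obtain K where K: "continuous_on UNIV s" "\<And>x. cmod (s x) \<le> K" using trig_poly_bounded_continuous[OF \<open>trig_poly s\<close>] by blast
      have [measurable]: "s \<in> borel_measurable borel" using K(1) by (rule borel_measurable_continuous_onI)
      show "integrable N s" using K(2) by (intro N.integrable_const_bound[of _ K]) auto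
      assume n: "n \<ge> 1" note [measurable] = Z[OF n]
      show "integrable M (\<lambda>\<omega>. s (Z n \<omega>))" using K(2) by (intro M.integrable_const_bound[of _ K]) auto
    qed
    have "(\<lambda>n. (CLINT \<omega>|M. q (Z n \<omega>)) + (CLINT \<omega>|M. r (Z n \<omega>))) \<longlonglongrightarrow> (CLINT x|N. q x) + (CLINT x|N. r x)"
      by (intro tendsto_add add.IH)
    moreover have "\<forall>\<^sub>F n in sequentially. (CLINT \<omega>|M. q (Z n \<omega>)) + (CLINT \<omega>|M. r (Z n \<omega>)) = (CLINT \<omega>|M. q (Z n \<omega>) + r (Z n \<omega>))"
      using i add.hyps by (intro eventually_sequentiallyI[of 1]) simp
    ultimately show ?case using i add.hyps by (simp add: tendsto_cong)
  qed
  from tendsto_Re[OF conv[OF tp]] have pconv: "(\<lambda>n. LINT \<omega>|M. p (Z n \<omega>)) \<longlonglongrightarrow> (LINT x|N. p x)" by simp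
  have pc: "continuous_on UNIV p" 
    using trig_poly_bounded_continuous[OF tp] continuous_on_Re[of UNIV "\<lambda>x. complex_of_real (p x)"] by simp
  obtain Kp where Kp: "\<And>x. \<bar>p x\<bar> \<le> Kp" using trig_poly_bounded_continuous[OF tp] by auto
  note [measurable] = borel_measurable_continuous_onI[OF f] borel_measurable_continuous_onI[OF pc]
  \<comment> \<open>Stated for an arbitrary space and vector, so that it serves both for
    \<open>Z n\<close> on \<open>M\<close> and for the identity on \<open>N\<close>. The two uses
    cost \<open>3 * e / 8\<close> each, and the expectations of \<open>p\<close> differ by less than
    \<open>e / 8\<close>.\<close>
  have diff: "\<bar>(LINT \<omega>|Q. p (W \<omega>)) - (LINT \<omega>|Q. f (W \<omega>))\<bar> \<le> e / 8 + 2 * B / L\<^sup>2 * V"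
    if Q: "prob_space Q" and W[measurable]: "W \<in> borel_measurable Q" and W2: "integrable Q (\<lambda>\<omega>. (norm (W \<omega>))\<^sup>2)"
     and WV: "(LINT \<omega>|Q. (norm (W \<omega>))\<^sup>2) \<le> V" for Q :: "'z measure" and W :: "'z \<Rightarrow> real^'n"
  proof -
    interpret Q: prob_space Q by fact
    have i: "integrable Q (\<lambda>\<omega>. p (W \<omega>))" "integrable Q (\<lambda>\<omega>. f (W \<omega>))"
      using Kp B by (auto intro: Q.integrable_const_bound[of _ Kp] Q.integrable_const_bound[of _ B])
    have "\<bar>(LINT \<omega>|Q. p (W \<omega>)) - (LINT \<omega>|Q. f (W \<omega>))\<bar> = \<bar>LINT \<omega>|Q. p (W \<omega>) - f (W \<omega>)\<bar>" using i by simp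
    also have "\<dots> \<le> (LINT \<omega>|Q. e / 8 + 2 * B / L\<^sup>2 * (norm (W \<omega>))\<^sup>2)"
      using i W2 app by (intro order_trans[OF integral_abs_bound] integral_mono) auto
    also have "\<dots> = e / 8 + 2 * B / L\<^sup>2 * (LINT \<omega>|Q. (norm (W \<omega>))\<^sup>2)"
      using W2 by (simp add: Q.prob_space)
    also have "\<dots> \<le> e / 8 + 2 * B / L\<^sup>2 * V" using WV B0 by (intro add_left_mono mult_left_mono) auto
    finally show ?thesis .
  qed
  have small: "2 * B / L\<^sup>2 * V \<le> e / 4"
  proof -
    have "2 * B / (8 * b * V / e) * V = e / 4 * (B / b)" if "b > 0" for b using V e that by (simp add: field_simps)
    from this[of "B + 1"] have "2 * B / L\<^sup>2 * V = e / 4 * (B / (B + 1))" unfolding L2 using B0 by simp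
    also have "\<dots> \<le> e / 4 * 1" using e B0 by (intro mult_left_mono) auto
    finally show ?thesis by simp
  qed
  from LIMSEQ_D[OF pconv, of "e/8"] e obtain n0 where n0: "\<And>n. n \<ge> n0 \<Longrightarrow> \<bar>(LINT \<omega>|M. p (Z n \<omega>)) - (LINT x|N. p x)\<bar> < e/8" by auto
  have "norm ((LINT \<omega>|M. f (Z n \<omega>)) - (LINT x|N. f x)) < e" if n: "n \<ge> max n0 1" for n
  proof -
    have n1: "n \<ge> 1" using n by simp
    have "\<bar>(LINT \<omega>|M. p (Z n \<omega>)) - (LINT \<omega>|M. f (Z n \<omega>))\<bar> \<le> e / 8 + 2 * B / L\<^sup>2 * V"
    proof (intro diff M Z[OF n1] int2[OF n1])
      show "(LINT \<omega>|M. (norm (Z n \<omega>))\<^sup>2) \<le> V"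
        unfolding V_def using bnd2[OF n1] \<open>0 \<le> (LINT x|N. (norm x)\<^sup>2)\<close> by linarith
    qed
    moreover have "\<bar>(LINT x|N. p x) - (LINT x|N. f x)\<bar> \<le> e / 8 + 2 * B / L\<^sup>2 * V"
      using \<open>0 \<le> C\<close> by (intro diff N N2) (auto simp: V_def)
    ultimately show ?thesis using n0[of n] n small e unfolding real_norm_def by linarith
  qed
  then show "\<exists>no. \<forall>n\<ge>no. norm ((LINT \<omega>|M. f (Z n \<omega>)) - (LINT x|N. f x)) < e" by blast
qed

text \<open>Continuity of \<open>f\<close> is uniform only on compact sets, so three cases are
  separated: \<open>W n\<close> far from \<open>Z n\<close>, which is rare; \<open>Z n\<close>
  outside a ball of radius \<open>r\<close>, which the second moment controls; and both close
  together in a compact ball, where uniform continuity applies.\<close>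

lemma (in prob_space) tendsto_in_distribution_slutsky:
  fixes Z W :: "nat \<Rightarrow> 'a \<Rightarrow> real^'n"
  assumes Z: "\<And>n. n \<ge> 1 \<Longrightarrow> random_variable borel (Z n)" and W: "\<And>n. n \<ge> 1 \<Longrightarrow> random_variable borel (W n)"
    and lim: "tendsto_in_distribution M Z N" and op: "tendsto_zero_in_prob M (\<lambda>n \<omega>. W n \<omega> - Z n \<omega>)"
    and int2: "\<And>n. n \<ge> 1 \<Longrightarrow> integrable M (\<lambda>\<omega>. (norm (Z n \<omega>))\<^sup>2)"
    and bnd2: "\<And>n. n \<ge> 1 \<Longrightarrow> expectation (\<lambda>\<omega>. (norm (Z n \<omega>))\<^sup>2) \<le> C"
  shows "tendsto_in_distribution M W N"
  unfolding tendsto_in_distribution_def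
proof (intro allI impI)
  fix f :: "real^'n \<Rightarrow> real"
  assume f: "continuous_on UNIV f" and bf: "bounded (range f)"
  then obtain B where B: "\<And>x. \<bar>f x\<bar> \<le> B" unfolding bounded_iff by auto
  have B0: "0 \<le> B" using B[of 0] by linarith
  note [measurable] = borel_measurable_continuous_onI[OF f]
  have C0: "0 \<le> C" by (rule order_trans[OF Bochner_Integration.integral_nonneg bnd2[of 1]]) auto
  have i: "integrable M (\<lambda>\<omega>. f (Z n \<omega>))" "integrable M (\<lambda>\<omega>. f (W n \<omega>))" if "n \<ge> 1" for n
    using B Z[OF that] W[OF that] by (auto intro!: integrable_const_bound[of _ B])
  have "(\<lambda>n. expectation (\<lambda>\<omega>. f (W n \<omega>)) - expectation (\<lambda>\<omega>. f (Z n \<omega>))) \<longlonglongrightarrow> 0"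
  proof (rule LIMSEQ_I)
    fix e :: real assume e: "0 < e"
    \<comment> \<open>Makes the Chebyshev term \<open>2 * B / r\<^sup>2 * (C + 1)\<close> at most
      \<open>e / 4\<close>.\<close>
    define r where "r = sqrt (8 * (B + 1) * (C + 1) / e)"
    have r: "r > 0" and r2: "r\<^sup>2 = 8 * (B + 1) * (C + 1) / e" unfolding r_def using B0 C0 e by simp_all
    \<comment> \<open>\<open>W n\<close> may leave the ball of radius \<open>r\<close>, but only by
      \<open>d'\<close>, which is at most 1.\<close>
    have "uniformly_continuous_on (cball 0 (r + 1)) f"
      using f by (intro compact_uniformly_continuous) (auto intro: continuous_on_subset)
    from this[unfolded uniformly_continuous_on_def, rule_format, of "e/4"] e
    obtain d where d: "d > 0" "\<And>x y. x \<in> cball 0 (r+1) \<Longrightarrow> y \<in> cball 0 (r+1) \<Longrightarrow> dist y x < d \<Longrightarrow> dist (f y) (f x) < e/4"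
      by auto
    define d' where "d' = min (d/2) 1"
    have d': "d' > 0" "d' < d" "d' \<le> 1" using d(1) by (auto simp: d'_def)
    have "(\<lambda>n. prob {\<omega>\<in>space M. norm (W n \<omega> - Z n \<omega>) > d'}) \<longlonglongrightarrow> 0"
      using op d'(1) by (simp add: tendsto_zero_in_prob_def)
    from LIMSEQ_D[OF this, of "e / (8 * (B+1))"] e B0
    obtain n0 where n0: "\<And>n. n \<ge> n0 \<Longrightarrow> prob {\<omega>\<in>space M. norm (W n \<omega> - Z n \<omega>) > d'} < e / (8 * (B+1))" by auto
    have "norm (expectation (\<lambda>\<omega>. f (W n \<omega>)) - expectation (\<lambda>\<omega>. f (Z n \<omega>)) - 0) < e" if n: "n \<ge> max n0 1" for n
    proof -
      have n1: "n \<ge> 1" using n by simp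
      note [measurable] = Z[OF n1] W[OF n1]
      let ?A = "{\<omega>\<in>space M. norm (W n \<omega> - Z n \<omega>) > d'}"
      have iA: "integrable M (indicat_real ?A)" by (intro integrable_real_indicator) (auto simp: emeasure_eq_measure)
      have pt: "\<bar>f (W n \<omega>) - f (Z n \<omega>)\<bar> \<le> e/4 + 2 * B * indicat_real ?A \<omega> + 2 * B / r\<^sup>2 * (norm (Z n \<omega>))\<^sup>2" if "\<omega> \<in> space M" for \<omega>
      proof -
        have nn: "0 \<le> 2 * B * indicat_real ?A \<omega>" "0 \<le> 2 * B / r\<^sup>2 * (norm (Z n \<omega>))\<^sup>2" using B0 by auto
        have b: "\<bar>f (W n \<omega>) - f (Z n \<omega>)\<bar> \<le> 2 * B" using B[of "W n \<omega>"] B[of "Z n \<omega>"] by linarith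
        consider "\<omega> \<in> ?A" | "norm (Z n \<omega>) > r" | "\<omega> \<notin> ?A" "norm (Z n \<omega>) \<le> r" by linarith
        then show ?thesis
        proof cases
          case 1 then have "2 * B * indicat_real ?A \<omega> = 2 * B" by simp
          then show ?thesis using b nn(2) e by linarith
        next
          case 2
          then have "1 \<le> (norm (Z n \<omega>))\<^sup>2 / r\<^sup>2" using r by (simp add: power_mono)
          then have "2 * B * 1 \<le> 2 * B * ((norm (Z n \<omega>))\<^sup>2 / r\<^sup>2)" using B0 by (intro mult_left_mono) auto
          moreover have "2 * B * ((norm (Z n \<omega>))\<^sup>2 / r\<^sup>2) = 2 * B / r\<^sup>2 * (norm (Z n \<omega>))\<^sup>2" by simp
          ultimately show ?thesis using b nn(1) e by linarith
        next
          case 3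
          then have "norm (W n \<omega> - Z n \<omega>) \<le> d'" using that by auto
          moreover have "norm (W n \<omega>) \<le> norm (Z n \<omega>) + norm (W n \<omega> - Z n \<omega>)" by (rule norm_triangle_sub)
          ultimately have "dist (f (W n \<omega>)) (f (Z n \<omega>)) < e/4" using 3 d' by (intro d(2)) (auto simp: dist_norm)
          then show ?thesis using nn by (simp add: dist_real_def)
        qed
      qed
      have "norm (expectation (\<lambda>\<omega>. f (W n \<omega>)) - expectation (\<lambda>\<omega>. f (Z n \<omega>)) - 0) = \<bar>expectation (\<lambda>\<omega>. f (W n \<omega>) - f (Z n \<omega>))\<bar>"
        using i[OF n1] by simp
      also have "\<dots> \<le> expectation (\<lambda>\<omega>. e/4 + 2 * B * indicat_real ?A \<omega> + 2 * B / r\<^sup>2 * (norm (Z n \<omega>))\<^sup>2)"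
        using i[OF n1] int2[OF n1] iA pt 
        by (intro order_trans[OF integral_abs_bound] integral_mono integrable_abs Bochner_Integration.integrable_add 
              Bochner_Integration.integrable_diff integrable_mult_right integrable_const) auto
      also have "\<dots> = e/4 + 2 * B * prob ?A + 2 * B / r\<^sup>2 * expectation (\<lambda>\<omega>. (norm (Z n \<omega>))\<^sup>2)"
        using int2[OF n1] iA by (subst Bochner_Integration.integral_add) (auto simp: prob_space)
      also have "\<dots> \<le> e/4 + 2 * (B+1) * (e / (8 * (B+1))) + 2 * B / r\<^sup>2 * (C + 1)"
        using n0[of n] n B0 bnd2[OF n1] by (intro add_mono mult_mono mult_left_mono) auto
      also have "2 * (B+1) * (e / (8 * (B+1))) = e / 4" using B0 by (simp add: field_simps)
      also have "2 * B / r\<^sup>2 * (C + 1) = e / 4 * (B / (B + 1))"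
      proof -
        have "2 * B / (8 * b * V / e) * V = e / 4 * (B / b)" if "b > 0" "V > 0" for b V using e that by (simp add: field_simps)
        from this[of "B + 1" "C + 1"] show ?thesis unfolding r2 using B0 C0 by simp
      qed
      also have "e / 4 * (B / (B + 1)) \<le> e / 4 * 1" using e B0 by (intro mult_left_mono) auto
      finally show ?thesis using e by simp
    qed
    then show "\<exists>no. \<forall>n\<ge>no. norm (expectation (\<lambda>\<omega>. f (W n \<omega>)) - expectation (\<lambda>\<omega>. f (Z n \<omega>)) - 0) < e" by blast
  qed
  moreover have "(\<lambda>n. expectation (\<lambda>\<omega>. f (Z n \<omega>))) \<longlonglongrightarrow> (\<integral>x. f x \<partial>N)"
    using lim f bf by (auto simp: tendsto_in_distribution_def)
  ultimately show "(\<lambda>n. expectation (\<lambda>\<omega>. f (W n \<omega>))) \<longlonglongrightarrow> (\<integral>x. f x \<partial>N)"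
    by (rule Lim_transform[rotated])
qed

section \<open>Multivariate normal distributions\<close>

text \<open>Symmetric elimination, one pivot at a time. The dimension is fixed by the type, so
  instead of shrinking the matrix the induction shrinks the set \<open>S\<close> outside which its
  rows vanish. A zero pivot forces its row to vanish; a positive pivot splits off a rank-one term
  and leaves the Schur complement.\<close>

lemma psd_sum_of_squares:
  fixes A :: "real^'n^'n"
  assumes "finite S" and "\<And>i j. A $ i $ j = A $ j $ i" and "\<And>x. 0 \<le> x \<bullet> (A *v x)"
    and "\<And>i j. i \<notin> S \<Longrightarrow> A $ i $ j = 0"
  shows "\<exists>v :: 'n \<Rightarrow> real^'n. \<forall>i j. A $ i $ j = (\<Sum>k\<in>S. v k $ i * v k $ j)"
  using assms
proof (induction S arbitrary: A)
  case empty then show ?case by auto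
next
  case (insert k S A)
  note sym = insert.prems(1) and psd = insert.prems(2) and supp = insert.prems(3)
  have quad: "x \<bullet> (A *v y) = (\<Sum>i\<in>UNIV. \<Sum>j\<in>UNIV. x $ i * A $ i $ j * y $ j)" for x y
    by (simp add: inner_vec_def matrix_vector_mult_def sum_distrib_left mult.assoc)
  have sym': "x \<bullet> (A *v y) = y \<bullet> (A *v x)" for x y
    unfolding quad by (subst sum.swap) (simp add: sym[of _ _] ac_simps)
  let ?c = "A $ k $ k" and ?e = "axis k 1 :: real^'n"
  have Ae: "(A *v ?e) $ i = A $ i $ k" for i by (simp add: matrix_vector_mult_basis column_def)
  have ec: "?e \<bullet> (A *v ?e) = ?c" by (simp add: inner_axis' Ae)
  have c0: "0 \<le> ?c" using psd[of ?e] ec by simp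
  have exp: "(x + t *\<^sub>R ?e) \<bullet> (A *v (x + t *\<^sub>R ?e)) = x \<bullet> (A *v x) + 2 * t * (A *v x) $ k + t\<^sup>2 * ?c" for x t
    using sym'[of x ?e] ec
    by (simp add: matrix_vector_right_distrib matrix_vector_mult_scaleR inner_add_left inner_add_right inner_axis' power2_eq_square algebra_simps)
  show ?case
  proof (cases "?c = 0")
    case True
    have z: "(A *v x) $ k = 0" for x
    proof (rule ccontr)
      assume n: "(A *v x) $ k \<noteq> 0"
      \<comment> \<open>With a zero pivot the form is affine in \<open>t\<close> along the pivot
        direction; this \<open>t\<close> gives it the value -1.\<close>
      define t where "t = - (x \<bullet> (A *v x) + 1) / (2 * (A *v x) $ k)"
      have "2 * t * (A *v x) $ k = - (x \<bullet> (A *v x) + 1)" using n by (simp add: t_def)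
      with psd[of "x + t *\<^sub>R ?e"] exp[of x t] True show False by simp
    qed
    have Ak: "A $ k $ j = 0" for j
      using z[of "axis j 1"] by (simp add: matrix_vector_mult_basis column_def)
    have "\<exists>v :: 'n \<Rightarrow> real^'n. \<forall>i j. A $ i $ j = (\<Sum>k\<in>S. v k $ i * v k $ j)"
    proof (rule insert.IH)
      show "A $ i $ j = 0" if "i \<notin> S" for i j using supp[of i] that Ak by (cases "i = k") auto
    qed (rule sym psd)+
    then obtain v :: "'n \<Rightarrow> real^'n" where v: "\<forall>i j. A $ i $ j = (\<Sum>k\<in>S. v k $ i * v k $ j)" ..
    have "(\<Sum>l\<in>S. (v(k := 0)) l $ i * (v(k := 0)) l $ j) = (\<Sum>l\<in>S. v l $ i * v l $ j)" for i j
      using insert.hyps by (intro sum.cong) auto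
    then show ?thesis using v insert.hyps by (intro exI[of _ "v(k := 0)"]) simp
  next
    case False
    with c0 have c: "?c > 0" by simp
    \<comment> \<open>The Schur complement: subtracting the rank-one term built from column
      \<open>k\<close> clears row and column \<open>k\<close>.\<close>
    define A' :: "real^'n^'n" where "A' = (\<chi> i j. A $ i $ j - A $ i $ k * A $ k $ j / ?c)"
    have A'v: "A' *v x = A *v x - ((A *v x) $ k / ?c) *\<^sub>R (\<chi> i. A $ i $ k)" for x
      by (simp add: vec_eq_iff A'_def matrix_vector_mult_def left_diff_distrib right_diff_distrib sum_subtractf sum_divide_distrib sum_distrib_left sum_distrib_right ac_simps)
    have "\<exists>v :: 'n \<Rightarrow> real^'n. \<forall>i j. A' $ i $ j = (\<Sum>k\<in>S. v k $ i * v k $ j)"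
    proof (rule insert.IH)
      show "A' $ i $ j = A' $ j $ i" for i j using sym[of i j] sym[of i k] sym[of k j] by (simp add: A'_def)
      show "0 \<le> x \<bullet> (A' *v x)" for x
      proof -
        have "x \<bullet> (\<chi> i. A $ i $ k) = (A *v x) $ k"
          by (simp add: inner_vec_def matrix_vector_mult_def sym[of k] mult.commute)
        then have "x \<bullet> (A' *v x) = x \<bullet> (A *v x) - ((A *v x) $ k)\<^sup>2 / ?c"
          unfolding A'v by (simp add: inner_diff_right power2_eq_square)
        \<comment> \<open>The form of the Schur complement is the minimum of the original form over
          shifts of \<open>x\<close> along \<open>?e\<close>, attained at this shift, hence
          nonnegative.\<close>
        also have "\<dots> = (x + (- (A *v x) $ k / ?c) *\<^sub>R ?e) \<bullet> (A *v (x + (- (A *v x) $ k / ?c) *\<^sub>R ?e))"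
          unfolding exp using c by (simp add: power2_eq_square field_simps)
        finally show ?thesis by (simp only: psd)
      qed
      show "A' $ i $ j = 0" if "i \<notin> S" for i j
        using supp[of i] that c by (cases "i = k") (auto simp: A'_def)
    qed
    then obtain v :: "'n \<Rightarrow> real^'n" where v: "\<forall>i j. A' $ i $ j = (\<Sum>k\<in>S. v k $ i * v k $ j)" ..
    define w :: "real^'n" where "w = (\<chi> i. A $ i $ k / sqrt ?c)"
    have ww: "w $ i * w $ j = A $ i $ k * A $ j $ k / ?c" for i j
      using c by (simp add: w_def)
    have "(\<Sum>l\<in>S. (v(k := w)) l $ i * (v(k := w)) l $ j) = (\<Sum>l\<in>S. v l $ i * v l $ j)" for i j
      using insert.hyps by (intro sum.cong) auto
    moreover have "A $ i $ j = A' $ i $ j + w $ i * w $ j" for i j unfolding ww using sym[of k j] by (simp add: A'_def)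
    ultimately show ?thesis using v insert.hyps by (intro exI[of _ "v(k := w)"]) (simp add: add.commute)
  qed
qed

lemma psd_factorization:
  fixes A :: "real^'n^'n"
  assumes "transpose A = A" and "\<And>x. 0 \<le> x \<bullet> (A *v x)"
  obtains B :: "real^'n^'n" where "B ** transpose B = A"
proof -
  have "A $ i $ j = A $ j $ i" for i j
    using arg_cong[OF assms(1), of "\<lambda>A. A $ j $ i"] by (simp add: transpose_def)
  with psd_sum_of_squares[of UNIV A] assms(2) obtain v :: "'n \<Rightarrow> real^'n" 
    where v: "\<And>i j. A $ i $ j = (\<Sum>k\<in>UNIV. v k $ i * v k $ j)" by auto
  have "(\<chi> i k. v k $ i) ** transpose (\<chi> i k. v k $ i) = A"
    by (simp add: vec_eq_iff matrix_matrix_mult_def transpose_def v)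
  then show thesis using that by blast
qed

text \<open>Independence of the coordinates factors the characteristic function at \<open>u\<close>
  into standard normal ones at the coordinates of \<open>transpose B *v u\<close>, a vector of
  squared length \<open>u \<bullet> (\<Sigma> *v u)\<close>. Only \<open>B ** transpose B\<close>
  enters, so the choice hidden in \<open>multivariate_normal\<close> is immaterial; positive
  semidefiniteness ensures that there is something to choose.\<close>

lemma multivariate_normal_properties:
  fixes \<Sigma> :: "real^'n^'n"
  assumes "transpose \<Sigma> = \<Sigma>" and "\<And>x. 0 \<le> x \<bullet> (\<Sigma> *v x)"
  shows "prob_space (multivariate_normal 0 \<Sigma>)"
    and "sets (multivariate_normal 0 \<Sigma>) = sets borel"
    and "(CLINT x|multivariate_normal 0 \<Sigma>. cis (u \<bullet> x)) = exp (- (u \<bullet> (\<Sigma> *v u)) / 2)"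
    and "integrable (multivariate_normal 0 \<Sigma>) (\<lambda>x. (norm x)\<^sup>2)"
proof -
  define B where "B = (SOME B :: real^'n^'n. B ** transpose B = \<Sigma>)"
  obtain B0 :: "real^'n^'n" where "B0 ** transpose B0 = \<Sigma>" using psd_factorization[OF assms] by blast
  then have B: "B ** transpose B = \<Sigma>" unfolding B_def by (rule someI)
  let ?P = "PiM (UNIV :: 'n set) (\<lambda>_. density lborel std_normal_density)"
  let ?h = "\<lambda>z :: 'n \<Rightarrow> real. B *v (\<chi> i. z i)"
  have N: "multivariate_normal 0 \<Sigma> = distr ?P borel ?h"
    unfolding multivariate_normal_def Let_def B_def by simp
  interpret S: prob_space "density lborel std_normal_density" by (rule prob_space_normal_density) simp
  interpret product_prob_space "\<lambda>_ :: 'n. density lborel std_normal_density" UNIV by unfold_locales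
  have comp[measurable]: "(\<lambda>z. z i) \<in> borel_measurable ?P" for i :: 'n
  proof -
    have "(\<lambda>z. z i) \<in> ?P \<rightarrow>\<^sub>M density lborel std_normal_density" by (rule measurable_component_singleton) simp
    then show ?thesis by simp
  qed
  have hm[measurable]: "?h \<in> borel_measurable ?P"
  proof -
    have "?h = (\<lambda>z. \<Sum>i\<in>UNIV. z i *\<^sub>R column i B)" by (simp add: matrix_mult_sum scalar_mult_eq_scaleR)
    moreover have "(\<lambda>z. \<Sum>i\<in>UNIV. z i *\<^sub>R column i B) \<in> borel_measurable ?P"
      by (intro borel_measurable_sum borel_measurable_scaleR comp borel_measurable_const)
    ultimately show ?thesis by (simp only:)
  qed
  show "prob_space (multivariate_normal 0 \<Sigma>)" unfolding N by (rule prob_space_distr[OF hm])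
  show "sets (multivariate_normal 0 \<Sigma>) = sets borel" unfolding N by simp
  have [measurable]: "cis \<in> borel_measurable borel" by (intro borel_measurable_continuous_onI continuous_intros)
  define w where "w = transpose B *v u"
  have uh: "u \<bullet> ?h z = (\<Sum>i\<in>UNIV. w $ i * z i)" for z
  proof -
    have "u \<bullet> ?h z = w \<bullet> (\<chi> i. z i)" unfolding w_def transpose_matrix_vector by (simp only: dot_lmul_matrix)
    then show ?thesis by (simp add: inner_vec_def)
  qed
  have cis_sum: "cis (\<Sum>i\<in>I. f i) = (\<Prod>i\<in>I. cis (f i))" if "finite I" for I :: "'n set" and f
    using that by induction (simp_all add: cis_mult[symmetric])
  have ww: "w \<bullet> w = u \<bullet> (\<Sigma> *v u)"
  proof -
    have "w \<bullet> w = u \<bullet> (B *v w)" unfolding w_def transpose_matrix_vector by (simp only: dot_lmul_matrix)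
    moreover have "B *v w = (B ** transpose B) *v u" unfolding w_def by (simp only: matrix_vector_mul_assoc)
    ultimately show ?thesis by (simp only: B)
  qed
  have sum: "(\<Sum>i\<in>UNIV. - (w $ i)\<^sup>2 / 2) = - (u \<bullet> (\<Sigma> *v u)) / 2"
    unfolding ww[symmetric] by (simp add: inner_vec_def power2_eq_square sum_negf sum_divide_distrib)
  have "(CLINT x|multivariate_normal 0 \<Sigma>. cis (u \<bullet> x)) = (CLINT z|?P. cis (u \<bullet> ?h z))"
    unfolding N by (rule integral_distr[OF hm]) measurable
  also have "\<dots> = (CLINT z|?P. (\<Prod>i\<in>UNIV. cis (w $ i * z i)))"
    by (simp only: uh cis_sum[OF finite])
  also have "\<dots> = (\<Prod>i\<in>UNIV. (CLINT x|density lborel std_normal_density. cis (w $ i * x)))"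
    by (rule product_integral_prod) (auto intro!: S.integrable_const_bound[of _ 1])
  also have "\<dots> = (\<Prod>i\<in>UNIV. of_real (exp (- (w $ i)\<^sup>2 / 2)))"
    using fun_cong[OF char_std_normal_distribution, unfolded char_def] by (intro prod.cong) (simp_all only: cis_conv_exp)
  also have "\<dots> = of_real (exp (\<Sum>i\<in>UNIV. - (w $ i)\<^sup>2 / 2))" by (simp add: exp_sum)
  finally show "(CLINT x|multivariate_normal 0 \<Sigma>. cis (u \<bullet> x)) = exp (- (u \<bullet> (\<Sigma> *v u)) / 2)"
    unfolding sum .
  have sq: "integrable ?P (\<lambda>z. (z i)\<^sup>2)" for i
  proof -
    have "integrable (density lborel std_normal_density) (\<lambda>x. x^2)"
      using integrable_std_normal_moment[of 2] by (subst integrable_density) simp_all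
    moreover have "distr ?P (density lborel std_normal_density) (\<lambda>z. z i) = density lborel std_normal_density"
      by (rule PiM_component) simp
    ultimately have "integrable (distr ?P (density lborel std_normal_density) (\<lambda>z. z i)) (\<lambda>x. x^2)" by (simp only:)
    then show ?thesis by (rule integrable_distr[rotated]) (rule measurable_component_singleton, simp)
  qed
  have "integrable ?P (\<lambda>z. (norm (?h z))\<^sup>2)"
  proof (rule Bochner_Integration.integrable_bound[of _ "\<lambda>z. (onorm ((*v) B))\<^sup>2 * (\<Sum>i\<in>UNIV. (z i)\<^sup>2)"])
    show "integrable ?P (\<lambda>z. (onorm ((*v) B))\<^sup>2 * (\<Sum>i\<in>UNIV. (z i)\<^sup>2))" using sq by simp
    have "(norm (?h z))\<^sup>2 \<le> (onorm ((*v) B))\<^sup>2 * (\<Sum>i\<in>UNIV. (z i)\<^sup>2)" for z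
    proof -
      have "norm (?h z) \<le> onorm ((*v) B) * norm (\<chi> i. z i)" by (rule onorm) (rule matrix_vector_mul_bounded_linear)
      then have "(norm (?h z))\<^sup>2 \<le> (onorm ((*v) B) * norm (\<chi> i. z i))\<^sup>2" by (intro power_mono) auto
      also have "\<dots> = (onorm ((*v) B))\<^sup>2 * (\<Sum>i\<in>UNIV. (z i)\<^sup>2)"
        by (simp add: power_mult_distrib norm_vec_def L2_set_def sum_nonneg)
      finally show ?thesis .
    qed
    then show "AE z in ?P. norm ((norm (?h z))\<^sup>2) \<le> norm ((onorm ((*v) B))\<^sup>2 * (\<Sum>i\<in>UNIV. (z i)\<^sup>2))"
      by (intro AE_I2) (simp only: real_norm_def abs_power2, rule order_trans[OF _ abs_ge_self])
    show "(\<lambda>z. (norm (?h z))\<^sup>2) \<in> borel_measurable ?P" by (rule measurable_compose[OF hm]) simp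
  qed
  then show "integrable (multivariate_normal 0 \<Sigma>) (\<lambda>x. (norm x)\<^sup>2)"
    unfolding N by (subst integrable_distr_eq) simp_all
qed

section \<open>Characteristic functions of martingale sums\<close>

text \<open>The variance errors of the single steps are known to vanish, but without a rate; their
  average over the first \<open>T\<close> steps still vanishes, and only the average matters
  below.\<close>

lemma cesaro_mean_tendsto_zero:
  fixes \<delta> :: "nat \<Rightarrow> real"
  assumes nn: "\<And>t. 0 \<le> \<delta> t" and lim: "\<delta> \<longlonglongrightarrow> 0"
  shows "(\<lambda>T. (\<Sum>t=1..T. \<delta> t) / real T) \<longlonglongrightarrow> 0"
proof (rule LIMSEQ_I)
  fix e :: real assume e: "0 < e"
  then obtain N where N: "\<And>t. t \<ge> N \<Longrightarrow> norm (\<delta> t - 0) < e / 2"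
    using LIMSEQ_D[OF lim, of "e/2"] by auto
  define K where "K = (\<Sum>t=1..N. \<delta> t)"
  have K: "0 \<le> K" unfolding K_def by (intro sum_nonneg nn)
  obtain N2 :: nat where N2: "2 * K / e < real N2" using reals_Archimedean2 by blast
  have "norm ((\<Sum>t=1..T. \<delta> t) / real T - 0) < e" if T: "T \<ge> Suc (max N N2)" for T
  proof -
    have "(\<Sum>t=1..T. \<delta> t) = K + (\<Sum>t=N+1..T. \<delta> t)"
      unfolding K_def using T sum.ub_add_nat[of 1 N \<delta> "T - N"] by simp
    also have "(\<Sum>t=N+1..T. \<delta> t) \<le> (\<Sum>t=N+1..T. e/2)"
      by (intro sum_mono) (use N nn in \<open>force simp: less_imp_le\<close>)
    also have "\<dots> \<le> real T * (e/2)" using e by (simp add: mult_right_mono)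
    also have "K < real T * (e/2)"
    proof -
      have "2 * K / e < real T" using N2 T by linarith
      then show ?thesis using e by (simp add: field_simps)
    qed
    finally have "(\<Sum>t=1..T. \<delta> t) < e * real T" by simp
    moreover have "0 \<le> (\<Sum>t=1..T. \<delta> t)" by (intro sum_nonneg nn)
    ultimately show ?thesis using T e by (simp add: pos_divide_less_eq)
  qed
  then show "\<exists>no. \<forall>n\<ge>no. norm ((\<Sum>t=1..n. \<delta> t) / real n - 0) < e" by blast
qed

lemma exp_minus_quadratic_bound:
  assumes "(0::real) \<le> s" shows "\<bar>exp (- s) - 1 + s\<bar> \<le> s\<^sup>2"
proof (cases "s \<le> 1")
  case True
  have "1 - s \<le> exp (-s)" using exp_ge_add_one_self[of "-s"] by simp
  moreover have "1 + s \<le> exp s" by simp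
  hence "exp (-s) \<le> 1 / (1 + s)" using assms by (simp add: exp_minus field_simps)
  moreover have "1 / (1 + s) \<le> 1 - s + s\<^sup>2"
  proof -
    have "(1 - s + s\<^sup>2) * (1 + s) = 1 + s^3" by (simp add: algebra_simps power2_eq_square power3_eq_cube)
    hence "1 \<le> (1 - s + s\<^sup>2) * (1 + s)" using assms by simp
    thus ?thesis using assms by (simp add: divide_le_eq)
  qed
  ultimately show ?thesis by linarith
next
  case False
  have "exp (-s) \<le> 1" "0 < exp (-s)" using assms by auto
  moreover have "s \<le> s\<^sup>2" using False by (simp add: power2_eq_square)
  ultimately show ?thesis using False by linarith
qed

lemma cis_cubic_bound:
  "cmod (cis x - (1 + \<i> * x - of_real (x\<^sup>2 / 2))) \<le> \<bar>x\<bar> ^ 3"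
proof -
  have "(\<Sum>k\<le>2. (\<i> * x)^k / fact k) = 1 + \<i> * x - of_real (x\<^sup>2 / 2)"
    by (simp add: numeral_2_eq_2 power2_eq_square) (metis i_squared mult.assoc mult.left_commute mult_minus_left mult_1)
  with iexp_approx1[of x 2] have "cmod (cis x - (1 + \<i> * x - of_real (x\<^sup>2 / 2))) \<le> \<bar>x\<bar> ^ 3 / fact 3"
    by (simp add: cis_conv_exp)
  also have "\<dots> \<le> \<bar>x\<bar> ^ 3 / 1" by (intro divide_left_mono) auto
  finally show ?thesis by simp
qed

context prob_space begin

lemma integrable_powers_le_cube:
  fixes f :: "'a \<Rightarrow> real"
  assumes [measurable]: "random_variable borel f" and 3: "integrable M (\<lambda>\<omega>. \<bar>f \<omega>\<bar> ^ 3)"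
  shows "integrable M f" "integrable M (\<lambda>\<omega>. (f \<omega>)\<^sup>2)"
proof -
  have b: "\<bar>y\<bar> \<le> 1 + \<bar>y\<bar>^3" "y\<^sup>2 \<le> 1 + \<bar>y\<bar>^3" for y :: real
  proof -
    show "\<bar>y\<bar> \<le> 1 + \<bar>y\<bar>^3" 
      by (cases "\<bar>y\<bar> \<le> 1") (auto intro: order_trans[OF self_le_power[of "\<bar>y\<bar>" 3]] simp: add_increasing2)
    show "y\<^sup>2 \<le> 1 + \<bar>y\<bar>^3"
    proof (cases "\<bar>y\<bar> \<le> 1")
      case True then show ?thesis by (simp add: abs_square_le_1 add_increasing2)
    next
      case False 
      then have "\<bar>y\<bar>^2 \<le> \<bar>y\<bar>^3" by (intro power_increasing) auto
      then show ?thesis by simp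
    qed
  qed
  show "integrable M f" by (rule Bochner_Integration.integrable_bound[of _ "\<lambda>\<omega>. 1 + \<bar>f \<omega>\<bar>^3"]) (use 3 b in \<open>auto intro!: AE_I2\<close>)
  show "integrable M (\<lambda>\<omega>. (f \<omega>)\<^sup>2)" by (rule Bochner_Integration.integrable_bound[of _ "\<lambda>\<omega>. 1 + \<bar>f \<omega>\<bar>^3"]) (use 3 b in \<open>auto intro!: AE_I2\<close>)
qed

text \<open>The increments are martingale differences whose conditional second moments approach
  \<open>\<sigma>2\<close>; both facts enter only through expectations against \<open>cis\<close> of the past partial
  sums. The proof telescopes \<open>E (cis (v * S\<^sub>t)) * exp (t * \<sigma>2 / (2 * T))\<close> with \<open>v = 1 / sqrt T\<close>.\<close>

lemma martingale_char_tendsto: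
  fixes \<xi> :: "nat \<Rightarrow> 'a \<Rightarrow> real"
  assumes rv: "\<And>t. t \<ge> 1 \<Longrightarrow> random_variable borel (\<xi> t)"
    and int3: "\<And>t. t \<ge> 1 \<Longrightarrow> integrable M (\<lambda>\<omega>. \<bar>\<xi> t \<omega>\<bar> ^ 3)"
    and bnd3: "\<And>t. t \<ge> 1 \<Longrightarrow> expectation (\<lambda>\<omega>. \<bar>\<xi> t \<omega>\<bar> ^ 3) \<le> C"
    and zero: "\<And>t v. t \<ge> 1 \<Longrightarrow> (CLINT \<omega>|M. cis (v * (\<Sum>s=1..t-1. \<xi> s \<omega>)) * \<xi> t \<omega>) = 0"
    and var: "\<And>t v. t \<ge> 1 \<Longrightarrow> cmod (CLINT \<omega>|M. cis (v * (\<Sum>s=1..t-1. \<xi> s \<omega>)) * complex_of_real ((\<xi> t \<omega>)\<^sup>2 - \<sigma>2)) \<le> \<delta> t"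
    and \<delta>: "\<And>t. 0 \<le> \<delta> t" "\<delta> \<longlonglongrightarrow> 0" and \<sigma>2: "0 \<le> \<sigma>2"
  shows "(\<lambda>T. CLINT \<omega>|M. cis ((\<Sum>t=1..T. \<xi> t \<omega>) / sqrt T)) \<longlonglongrightarrow> exp (- (\<sigma>2 / 2))"
proof -
  have C: "0 \<le> C" 
    by (rule order_trans[OF Bochner_Integration.integral_nonneg bnd3[of 1]]) auto
  define S where "S t \<omega> = (\<Sum>s=1..t. \<xi> s \<omega>)" for t \<omega>
  have S_rv[measurable]: "random_variable borel (S t)" for t
    unfolding S_def by (intro borel_measurable_sum rv) auto
  note cis_meas[measurable] = borel_measurable_continuous_onI[OF continuous_on_cis[OF continuous_on_id]]
  \<comment> \<open>Up to the factor \<open>exp (\<sigma>2 / 2)\<close>, the sum over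
    \<open>T\<close> steps of three errors: the variance mismatch, the third-order remainder of
    \<open>cis\<close>, and the remainder of the compensating exponential.\<close>
  define r where "r T = (\<Sum>t=1..T. \<delta> t) / real T + C / sqrt T + \<sigma>2\<^sup>2 / real T" for T :: nat
  \<comment> \<open>If the increments were independent centred normals of variance
    \<open>\<sigma>2\<close>, the compensating exponential would make \<open>a T t\<close> constant
    in \<open>t\<close>, equal to its initial value 1.\<close>
  define a where "a T t = (CLINT \<omega>|M. cis (S t \<omega> / sqrt T)) * of_real (exp (real t * \<sigma>2 / (2 * T)))" for T t :: nat
  have step: "cmod (a T t - a T (t - 1)) \<le> exp (\<sigma>2 / 2) * (\<delta> t / real T + C / (real T * sqrt T) + \<sigma>2\<^sup>2 / (real T)\<^sup>2)"
    if t: "t \<in> {1..T}" for T t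
  proof -
    have T: "real T > 0" using t by auto
    define v where "v = 1 / sqrt T"
    define s where "s = \<sigma>2 / (2 * T)"
    have v2: "v\<^sup>2 = 1 / T" using T by (simp add: v_def power_divide)
    have v3: "\<bar>v\<bar>^3 = 1 / (T * sqrt T)" using T by (simp add: v_def power3_eq_cube field_simps)
    have v0: "0 \<le> v" unfolding v_def by simp
    have s0: "0 \<le> s" using \<sigma>2 by (simp add: s_def)
    have t1: "t \<ge> 1" using t by auto
    note [measurable] = rv[OF t1]
    note int12 = integrable_powers_le_cube[OF rv[OF t1] int3[OF t1]]
    define e where "e = cis \<circ> (\<lambda>x. v * x)"
    have e1: "cmod (e x) = 1" for x by (simp add: e_def)
    have em[measurable]: "e \<in> borel_measurable borel" unfolding e_def by measurable
    have St: "S t \<omega> = S (t - 1) \<omega> + \<xi> t \<omega>" for \<omega>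
      unfolding S_def using t1 by (cases t) auto
    define rem where "rem \<omega> = e (S (t-1) \<omega>) * ((cis (v * \<xi> t \<omega>) - (1 + \<i> * (v * \<xi> t \<omega>) - of_real ((v * \<xi> t \<omega>)\<^sup>2 / 2)))
         - of_real (exp (-s) - 1 + s))" for \<omega>
    \<comment> \<open>\<open>cis\<close> is expanded to second order and \<open>exp (- s)\<close> to
      first. As \<open>s\<close> equals \<open>v\<^sup>2 * \<sigma>2 / 2\<close>, the term
      \<open>s\<close> completes the quadratic part to the centred square that \<open>var\<close>
      controls; the linear term has mean 0 by \<open>zero\<close>.\<close>
    have split: "e (S t \<omega>) - of_real (exp (- s)) * e (S (t-1) \<omega>) = 
        \<i> * v * (e (S (t-1) \<omega>) * \<xi> t \<omega>) - of_real (v\<^sup>2 / 2) * (e (S (t-1) \<omega>) * complex_of_real ((\<xi> t \<omega>)\<^sup>2 - \<sigma>2)) + rem \<omega>" for \<omega>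
    proof -
      have "e (S t \<omega>) = e (S (t-1) \<omega>) * cis (v * \<xi> t \<omega>)"
        unfolding e_def by (simp add: St cis_mult distrib_left)
      moreover have "complex_of_real s = of_real (v\<^sup>2 / 2) * of_real \<sigma>2" by (simp add: v2 s_def)
      ultimately show ?thesis unfolding rem_def
        by (simp add: algebra_simps power_mult_distrib)
    qed
    have rem_bd: "cmod (rem \<omega>) \<le> \<bar>v\<bar>^3 * \<bar>\<xi> t \<omega>\<bar>^3 + s\<^sup>2" for \<omega>
    proof -
      have "cmod (rem \<omega>) \<le> cmod (cis (v * \<xi> t \<omega>) - (1 + \<i> * (v * \<xi> t \<omega>) - of_real ((v * \<xi> t \<omega>)\<^sup>2 / 2))) + cmod (of_real (exp (-s) - 1 + s))"
        unfolding rem_def norm_mult e1 mult_1 by (rule norm_triangle_ineq4)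
      also have "\<dots> \<le> \<bar>v * \<xi> t \<omega>\<bar> ^ 3 + s\<^sup>2"
        using exp_minus_quadratic_bound[OF s0] cis_cubic_bound[of "v * \<xi> t \<omega>"]
        by (intro add_mono) (simp_all only: norm_of_real of_real_mult)
      finally show ?thesis by (simp add: abs_mult power_mult_distrib)
    qed
    have i1: "integrable M (\<lambda>\<omega>. e (S (t-1) \<omega>) * \<xi> t \<omega>)"
      by (rule Bochner_Integration.integrable_bound[OF int12(1)]) (auto simp: norm_mult e1)
    have i2: "integrable M (\<lambda>\<omega>. e (S (t-1) \<omega>) * complex_of_real ((\<xi> t \<omega>)\<^sup>2 - \<sigma>2))"
      by (rule Bochner_Integration.integrable_bound[of _ "\<lambda>\<omega>. (\<xi> t \<omega>)\<^sup>2 - \<sigma>2"]) 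
         (use int12 in \<open>auto simp: norm_mult e1 simp flip: of_real_power of_real_diff\<close>)
    have [measurable]: "random_variable borel rem" unfolding rem_def by measurable
    have i3: "integrable M rem"
      by (rule Bochner_Integration.integrable_bound[of _ "\<lambda>\<omega>. \<bar>v\<bar>^3 * \<bar>\<xi> t \<omega>\<bar>^3 + s\<^sup>2"]) 
         (use rem_bd int3[OF t1] in \<open>auto intro!: AE_I2 order_trans[OF _ abs_ge_self]\<close>)
    have ie: "integrable M (\<lambda>\<omega>. e (S u \<omega>))" for u
      by (rule integrable_const_bound[of _ 1]) (auto simp: e1)
    have "(CLINT \<omega>|M. e (S t \<omega>)) - of_real (exp (-s)) * (CLINT \<omega>|M. e (S (t-1) \<omega>)) =
       (CLINT \<omega>|M. e (S t \<omega>) - of_real (exp (- s)) * e (S (t-1) \<omega>))"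
      using ie by simp
    also have "\<dots> = \<i> * v * (CLINT \<omega>|M. e (S (t-1) \<omega>) * \<xi> t \<omega>) - of_real (v\<^sup>2 / 2) * (CLINT \<omega>|M. e (S (t-1) \<omega>) * complex_of_real ((\<xi> t \<omega>)\<^sup>2 - \<sigma>2)) + (CLINT \<omega>|M. rem \<omega>)"
      unfolding split using i1 i2 i3 by (simp del: of_real_diff of_real_mult of_real_divide)
    also have "cmod \<dots> \<le> v\<^sup>2 / 2 * \<delta> t + (\<bar>v\<bar>^3 * C + s\<^sup>2)"
    proof -
      have "cmod (CLINT \<omega>|M. rem \<omega>) \<le> (LINT \<omega>|M. \<bar>v\<bar>^3 * \<bar>\<xi> t \<omega>\<bar>^3 + s\<^sup>2)"
        using i3 int3[OF t1] rem_bd by (intro order_trans[OF integral_norm_bound] integral_mono) auto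
      also have "\<dots> \<le> \<bar>v\<bar>^3 * C + s\<^sup>2"
        using int3[OF t1] bnd3[OF t1] v0 by (simp add: prob_space mult_left_mono)
      finally have r: "cmod (CLINT \<omega>|M. rem \<omega>) \<le> \<bar>v\<bar>^3 * C + s\<^sup>2" .
      have "(CLINT \<omega>|M. e (S (t-1) \<omega>) * \<xi> t \<omega>) = 0"
        using zero[OF t1, of v] by (simp add: e_def S_def)
      moreover have "cmod (of_real (v\<^sup>2 / 2) * (CLINT \<omega>|M. e (S (t-1) \<omega>) * complex_of_real ((\<xi> t \<omega>)\<^sup>2 - \<sigma>2))) \<le> v\<^sup>2 / 2 * \<delta> t"
        unfolding norm_mult norm_of_real using var[OF t1, of v] by (intro mult_mono) (auto simp: e_def S_def)
      ultimately have "cmod (\<i> * v * (CLINT \<omega>|M. e (S (t-1) \<omega>) * \<xi> t \<omega>) - of_real (v\<^sup>2 / 2) * (CLINT \<omega>|M. e (S (t-1) \<omega>) * complex_of_real ((\<xi> t \<omega>)\<^sup>2 - \<sigma>2))) \<le> v\<^sup>2 / 2 * \<delta> t"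
        by (simp only: mult_zero_right diff_0 norm_minus_cancel)
      then show ?thesis using r by (intro norm_triangle_le add_mono)
    qed
    finally have main: "cmod ((CLINT \<omega>|M. e (S t \<omega>)) - of_real (exp (-s)) * (CLINT \<omega>|M. e (S (t-1) \<omega>))) \<le> v\<^sup>2 / 2 * \<delta> t + (\<bar>v\<bar>^3 * C + s\<^sup>2)" .
    have "a T t - a T (t-1) = of_real (exp (real t * s)) * ((CLINT \<omega>|M. e (S t \<omega>)) - of_real (exp (-s)) * (CLINT \<omega>|M. e (S (t-1) \<omega>)))"
    proof -
      have "exp (real t * s) * exp (-s) = exp (real (t - 1) * s)"
        using t1 by (simp add: of_nat_diff left_diff_distrib flip: exp_add)
      hence "complex_of_real (exp (real t * s)) * of_real (exp (-s)) = of_real (exp (real (t - 1) * s))" 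
        by (metis of_real_mult)
      thus ?thesis unfolding a_def e_def by (simp add: s_def v_def right_diff_distrib mult.assoc[symmetric] del: of_real_exp)
    qed
    also have "cmod \<dots> \<le> exp (\<sigma>2 / 2) * (v\<^sup>2 / 2 * \<delta> t + (\<bar>v\<bar>^3 * C + s\<^sup>2))"
    proof -
      \<comment> \<open>Since \<open>t\<close> is at most \<open>T\<close>, the compensating factor
        is bounded by \<open>exp (\<sigma>2 / 2)\<close> uniformly over the steps.\<close>
      have "real t * s \<le> \<sigma>2 / 2" using t T \<sigma>2 by (simp add: s_def divide_le_eq mult_left_mono mult.commute[of _ \<sigma>2])
      thus ?thesis unfolding norm_mult using main by (intro mult_mono) auto
    qed
    also have "\<dots> \<le> exp (\<sigma>2 / 2) * (\<delta> t / real T + C / (real T * sqrt T) + \<sigma>2\<^sup>2 / (real T)\<^sup>2)"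
    proof -
      have "v\<^sup>2 / 2 * \<delta> t \<le> \<delta> t / T" using T \<delta>(1)[of t] by (auto simp: v2 intro!: divide_left_mono)
      moreover have "s\<^sup>2 \<le> \<sigma>2\<^sup>2 / (real T)\<^sup>2" using T by (simp add: s_def power_divide power_mult_distrib field_simps)
      moreover have "\<bar>v\<bar>^3 * C = C / (T * sqrt T)" unfolding v3 by simp
      ultimately show ?thesis by (intro mult_left_mono) (linarith, simp)
    qed
    finally show ?thesis .
  qed
  have tot: "cmod (a T T - 1) \<le> exp (\<sigma>2 / 2) * r T" if "T \<ge> 1" for T
  proof -
    have "a T 0 = 1" by (simp add: a_def S_def prob_space)
    have "a T n = (\<Sum>t=1..n. a T t - a T (t - 1)) + 1" for n
      by (induction n) (simp_all add: \<open>a T 0 = 1\<close>)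
    from this[of T] have eq: "a T T - 1 = (\<Sum>t=1..T. a T t - a T (t - 1))" by (simp only: diff_eq_eq)
    have "cmod (a T T - 1) \<le> (\<Sum>t=1..T. cmod (a T t - a T (t - 1)))" unfolding eq by (rule norm_sum)
    also have "\<dots> \<le> (\<Sum>t=1..T. exp (\<sigma>2 / 2) * (\<delta> t / real T + C / (real T * sqrt T) + \<sigma>2\<^sup>2 / (real T)\<^sup>2))"
      by (intro sum_mono step)
    also have "\<dots> = exp (\<sigma>2 / 2) * ((\<Sum>t=1..T. \<delta> t) / real T + T * (C / (real T * sqrt T)) + T * (\<sigma>2\<^sup>2 / (real T)\<^sup>2))"
      by (simp add: sum.distrib sum_divide_distrib flip: sum_distrib_left)
    also have "\<dots> = exp (\<sigma>2 / 2) * r T" unfolding r_def using that by (simp add: power2_eq_square)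
    finally show ?thesis .
  qed
  have "r \<longlonglongrightarrow> 0 + 0 + 0"
    unfolding r_def
    by (intro tendsto_add cesaro_mean_tendsto_zero \<delta> real_tendsto_divide_at_top[OF tendsto_const]
        filterlim_compose[OF sqrt_at_top] filterlim_real_sequentially)
  hence "(\<lambda>T. exp (\<sigma>2 / 2) * r T) \<longlonglongrightarrow> exp (\<sigma>2/2) * 0" by (intro tendsto_mult tendsto_const) simp
  hence "(\<lambda>T. exp (\<sigma>2 / 2) * r T) \<longlonglongrightarrow> 0" by simp
  hence "(\<lambda>T. a T T - 1) \<longlonglongrightarrow> 0"
    by (rule Lim_null_comparison[rotated]) (auto intro!: eventually_sequentiallyI[of 1] tot)
  hence "(\<lambda>T. a T T) \<longlonglongrightarrow> 1" by (simp add: LIM_zero_iff)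
  hence "(\<lambda>T. a T T * of_real (exp (- (\<sigma>2 / 2)))) \<longlonglongrightarrow> 1 * of_real (exp (- (\<sigma>2 / 2)))"
    by (intro tendsto_mult tendsto_const)
  moreover have "eventually (\<lambda>T. a T T * of_real (exp (- (\<sigma>2 / 2))) = (CLINT \<omega>|M. cis ((\<Sum>t=1..T. \<xi> t \<omega>) / sqrt T))) sequentially"
  proof (rule eventually_sequentiallyI[of 1])
    fix T :: nat assume "1 \<le> T"
    hence "exp (real T * \<sigma>2 / (2 * T)) * exp (- (\<sigma>2 / 2)) = 1" by (simp flip: exp_add)
    hence "complex_of_real (exp (real T * \<sigma>2 / (2 * T))) * of_real (exp (- (\<sigma>2 / 2))) = 1" by (metis of_real_1 of_real_mult)
    thus "a T T * of_real (exp (- (\<sigma>2 / 2))) = (CLINT \<omega>|M. cis ((\<Sum>t=1..T. \<xi> t \<omega>) / sqrt T))"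
      by (simp add: a_def S_def mult.assoc del: of_real_exp)
  qed
  ultimately show ?thesis by (simp add: tendsto_cong)
qed

end

section \<open>Inverse probability weighting\<close>

declare One_nat_def [simp del]

lemma borel_measurable_vec_component [measurable (raw)]:
  fixes f :: "'x \<Rightarrow> real^'n"
  assumes "f \<in> borel_measurable N" shows "(\<lambda>x. f x $ i) \<in> borel_measurable N"
  by (rule measurable_compose[OF assms]) (intro borel_measurable_continuous_onI continuous_intros)

section \<open>Measurability, transfer to the generic copy, and independence in the bandit
  model\<close>

context contextual_bandit begin

abbreviation "hist n \<equiv> history \<pi> X Y A n"
abbreviation "aprob t \<omega> b \<equiv> action_prob \<pi> X Y A t \<omega> $ b"
abbreviation "step_space \<equiv> borel \<Otimes>\<^sub>M borel \<Otimes>\<^sub>M count_space UNIV \<Otimes>\<^sub>M borel :: ('p, 'k) step measure"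

lemma tuple_rv: "t \<ge> 1 \<Longrightarrow> (\<lambda>\<omega>. (X t \<omega>, Y t \<omega>)) \<in> M \<rightarrow>\<^sub>M borel \<Otimes>\<^sub>M borel"
  using tuples_indep by (simp add: indep_vars_def)

lemma context_rv: "t \<ge> 1 \<Longrightarrow> random_variable borel (X t)"
  using measurable_compose[OF tuple_rv measurable_fst] by simp

lemma outcomes_rv: "t \<ge> 1 \<Longrightarrow> random_variable borel (Y t)"
  using measurable_compose[OF tuple_rv measurable_snd] by simp

lemma generic_tuple_rv: "(\<lambda>\<omega>. (X0 \<omega>, Y0 \<omega>)) \<in> M \<rightarrow>\<^sub>M borel \<Otimes>\<^sub>M borel"
  by (rule measurable_Pair[OF generic_context_rv generic_outcomes_rv])

lemma context_restrict_rv: "t \<ge> 1 \<Longrightarrow> X t \<in> M \<rightarrow>\<^sub>M restrict_space borel XX"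
  by (rule measurable_restrict_space2) (auto simp: context_rv context_mem)

text \<open>The coordinate is picked by a random index; over a finite action set this is a finite
  sum of indicators times coordinates.\<close>

lemma observed_outcome_rv:
  assumes t: "t \<ge> 1" shows "random_variable borel (\<lambda>\<omega>. Y t \<omega> $ A t \<omega>)"
proof -
  note [measurable] = action_rv[OF t] outcomes_rv[OF t]
  have comp: "random_variable borel (\<lambda>\<omega>. Y t \<omega> $ b)" for b
    by (rule measurable_compose[OF outcomes_rv[OF t]]) (intro borel_measurable_continuous_onI continuous_intros)
  have "(\<lambda>\<omega>. Y t \<omega> $ A t \<omega>) = (\<lambda>\<omega>. \<Sum>b\<in>UNIV. of_bool (A t \<omega> = b) * Y t \<omega> $ b)"
    by (rule ext) simp
  moreover have "random_variable borel (\<lambda>\<omega>. \<Sum>b\<in>UNIV. of_bool (A t \<omega> = b) * Y t \<omega> $ b)"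
    by (intro borel_measurable_sum borel_measurable_times comp) measurable
  ultimately show ?thesis by (simp only:)
qed

text \<open>The policy is measurable only on \<open>XX\<close>, but contexts lie in
  \<open>XX\<close> at every point of \<open>space M\<close> and may be viewed as maps into the
  restricted space, where the composition is measurable.\<close>

lemma history_rv: "hist n \<in> M \<rightarrow>\<^sub>M hist_space n"
proof (induction n)
  case 0
  have "hist 0 = (\<lambda>\<omega> i. undefined)" by (simp add: fun_eq_iff)
  then show ?case unfolding hist_space_def by (simp only:) (rule measurable_PiM_single', auto)
next
  case (Suc n)
  have t: "Suc n \<ge> 1" by simp
  have "(\<lambda>\<omega>. \<pi> (Suc n) (X (Suc n) \<omega>) (hist n \<omega>)) \<in> borel_measurable M"
    using measurable_compose[OF measurable_Pair[OF context_restrict_rv[OF t]] policy_measurable[OF t]] Suc by simp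
  then have "(\<lambda>\<omega>. (X (Suc n) \<omega>, \<pi> (Suc n) (X (Suc n) \<omega>) (hist n \<omega>), A (Suc n) \<omega>, Y (Suc n) \<omega> $ A (Suc n) \<omega>)) \<in> M \<rightarrow>\<^sub>M step_space"
    by (intro measurable_Pair context_rv[OF t] action_rv[OF t] observed_outcome_rv[OF t])
  from measurable_fun_upd[OF _ Suc[unfolded hist_space_def] this, of "{1..Suc n}"]
  have "(\<lambda>\<omega>. (hist n \<omega>)(Suc n := (X (Suc n) \<omega>, \<pi> (Suc n) (X (Suc n) \<omega>) (hist n \<omega>), A (Suc n) \<omega>, Y (Suc n) \<omega> $ A (Suc n) \<omega>)))
      \<in> M \<rightarrow>\<^sub>M hist_space (Suc n)"
    by (simp add: hist_space_def atLeastAtMostSuc_conv del: fun_upd_apply)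
  moreover have "hist (Suc n) = (\<lambda>\<omega>. (hist n \<omega>)(Suc n := (X (Suc n) \<omega>, \<pi> (Suc n) (X (Suc n) \<omega>) (hist n \<omega>), A (Suc n) \<omega>, Y (Suc n) \<omega> $ A (Suc n) \<omega>)))"
    by (rule ext) simp
  ultimately show ?case by (simp only:)
qed

lemma history_in_space: "\<omega> \<in> space M \<Longrightarrow> hist n \<omega> \<in> space (hist_space n)"
  by (rule measurable_space[OF history_rv])

lemma action_prob_rv:
  assumes t: "t \<ge> 1" shows "action_prob \<pi> X Y A t \<in> borel_measurable M"
proof -
  have "(\<lambda>\<omega>. \<pi> t (X t \<omega>) (hist (t - 1) \<omega>)) \<in> borel_measurable M"
    using measurable_compose[OF measurable_Pair[OF context_restrict_rv[OF t] history_rv] policy_measurable[OF t]] by simp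
  then show ?thesis by (simp add: action_prob_def[abs_def])
qed

lemma action_prob_simplex:
  "t \<ge> 1 \<Longrightarrow> \<omega> \<in> space M \<Longrightarrow> action_prob \<pi> X Y A t \<omega> \<in> prob_simplex"
  unfolding action_prob_def by (intro policy_simplex context_mem history_in_space)

lemma prob_simplex_bounds:
  fixes q :: "real^'l" assumes "q \<in> prob_simplex" shows "0 \<le> q $ b" "q $ b \<le> 1"
proof -
  show "0 \<le> q $ b" using assms by (simp add: prob_simplex_def)
  have "q $ b \<le> (\<Sum>c\<in>UNIV. q $ c)" using assms by (intro member_le_sum) (auto simp: prob_simplex_def)
  then show "q $ b \<le> 1" using assms by (simp add: prob_simplex_def)
qed

lemma aprob_bounds: "t \<ge> 1 \<Longrightarrow> \<omega> \<in> space M \<Longrightarrow> 0 \<le> aprob t \<omega> b" "t \<ge> 1 \<Longrightarrow> \<omega> \<in> space M \<Longrightarrow> aprob t \<omega> b \<le> 1"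
  using prob_simplex_bounds[OF action_prob_simplex] by auto

text \<open>Entries are never overwritten, so the record of step \<open>t\<close> can be read off
  any later history.\<close>

lemma history_component:
  "1 \<le> t \<Longrightarrow> t \<le> n \<Longrightarrow> hist n \<omega> t = (X t \<omega>, action_prob \<pi> X Y A t \<omega>, A t \<omega>, Y t \<omega> $ A t \<omega>)"
proof (induction n)
  case (Suc n)
  then show ?case by (cases "t = Suc n") (auto simp: action_prob_def)
qed simp

text \<open>Since the context space need not be Borel, the policy is only Borel on it; a Borel extension
  makes the action probabilities a function of context and history.\<close>

lemma action_prob_factor:
  assumes t: "t \<ge> 1"
  obtains P where "P \<in> borel_measurable (hist_space (t - 1) \<Otimes>\<^sub>M borel)"
    "\<And>\<omega>. \<omega> \<in> space M \<Longrightarrow> P (hist (t - 1) \<omega>, X t \<omega>) = action_prob \<pi> X Y A t \<omega>"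
proof -
  obtain F where F: "F \<in> borel_measurable (borel \<Otimes>\<^sub>M hist_space (t - 1))"
    "\<And>x h. x \<in> XX \<Longrightarrow> h \<in> space (hist_space (t - 1)) \<Longrightarrow> F (x, h) = (\<lambda>(x, h). \<pi> t x h) (x, h)"
    using borel_measurable_restrict_pair_extend[OF policy_measurable[OF t]] by auto
  show thesis
  proof (rule that[of "\<lambda>z. F (snd z, fst z)"])
    show "(\<lambda>z. F (snd z, fst z)) \<in> borel_measurable (hist_space (t - 1) \<Otimes>\<^sub>M borel)"
      by (rule measurable_compose[OF measurable_Pair[OF measurable_snd measurable_fst] F(1)])
    show "F (snd (hist (t - 1) \<omega>, X t \<omega>), fst (hist (t - 1) \<omega>, X t \<omega>)) = action_prob \<pi> X Y A t \<omega>" if "\<omega> \<in> space M" for \<omega>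
      using F(2)[OF context_mem[OF t that] history_in_space[OF that]] by (simp add: action_prob_def)
  qed
qed

lemma tuple_transfer:
  fixes f :: "(real^'p) \<times> (real^'k) \<Rightarrow> 'c::{banach, second_countable_topology}"
  assumes f: "f \<in> borel_measurable (borel \<Otimes>\<^sub>M borel)" and t: "t \<ge> 1"
  shows integrable_tuple_iff: "integrable M (\<lambda>\<omega>. f (X t \<omega>, Y t \<omega>)) \<longleftrightarrow> integrable M (\<lambda>\<omega>. f (X0 \<omega>, Y0 \<omega>))"
    and expectation_tuple: "(\<integral>\<omega>. f (X t \<omega>, Y t \<omega>) \<partial>M) = (\<integral>\<omega>. f (X0 \<omega>, Y0 \<omega>) \<partial>M)"
proof -
  have "integrable M (\<lambda>\<omega>. f (X t \<omega>, Y t \<omega>)) \<longleftrightarrow> integrable (distr M (borel \<Otimes>\<^sub>M borel) (\<lambda>\<omega>. (X t \<omega>, Y t \<omega>))) f"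
    by (rule integrable_distr_eq[OF tuple_rv[OF t] f, symmetric])
  also have "\<dots> \<longleftrightarrow> integrable M (\<lambda>\<omega>. f (X0 \<omega>, Y0 \<omega>))"
    unfolding tuples_identically_distributed[OF t] by (rule integrable_distr_eq[OF generic_tuple_rv f])
  finally show "integrable M (\<lambda>\<omega>. f (X t \<omega>, Y t \<omega>)) \<longleftrightarrow> integrable M (\<lambda>\<omega>. f (X0 \<omega>, Y0 \<omega>))" .
  have "(\<integral>\<omega>. f (X t \<omega>, Y t \<omega>) \<partial>M) = integral\<^sup>L (distr M (borel \<Otimes>\<^sub>M borel) (\<lambda>\<omega>. (X t \<omega>, Y t \<omega>))) f"
    by (rule integral_distr[OF tuple_rv[OF t] f, symmetric])
  also have "\<dots> = (\<integral>\<omega>. f (X0 \<omega>, Y0 \<omega>) \<partial>M)"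
    unfolding tuples_identically_distributed[OF t] by (rule integral_distr[OF generic_tuple_rv f])
  finally show "(\<integral>\<omega>. f (X t \<omega>, Y t \<omega>) \<partial>M) = (\<integral>\<omega>. f (X0 \<omega>, Y0 \<omega>) \<partial>M)" .
qed

lemma prob_tuple:
  assumes f: "f \<in> borel_measurable (borel \<Otimes>\<^sub>M borel)" and S: "S \<in> sets borel" and t: "t \<ge> 1"
  shows "prob {\<omega>\<in>space M. f (X t \<omega>, Y t \<omega>) \<in> S} = prob {\<omega>\<in>space M. f (X0 \<omega>, Y0 \<omega>) \<in> S}"
proof -
  have B: "f -` S \<inter> space (borel \<Otimes>\<^sub>M borel) \<in> sets (borel \<Otimes>\<^sub>M borel)" by (rule measurable_sets[OF f S])
  have "prob {\<omega>\<in>space M. f (X t \<omega>, Y t \<omega>) \<in> S} = measure (distr M (borel \<Otimes>\<^sub>M borel) (\<lambda>\<omega>. (X t \<omega>, Y t \<omega>))) (f -` S \<inter> space (borel \<Otimes>\<^sub>M borel))"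
    using tuple_rv[OF t] B by (subst measure_distr) (auto intro!: arg_cong[of _ _ prob] simp: space_pair_measure)
  also have "\<dots> = prob {\<omega>\<in>space M. f (X0 \<omega>, Y0 \<omega>) \<in> S}"
    unfolding tuples_identically_distributed[OF t] using generic_tuple_rv B 
    by (subst measure_distr) (auto intro!: arg_cong[of _ _ prob] simp: space_pair_measure)
  finally show ?thesis .
qed

text \<open>The current tuple is independent of the past, hence so are measurable functions of the
  two. The value type is a normed field because \<open>h\<close> will be both a real partial sum and
  a complex exponential of one.\<close>

lemma expectation_history_tuple:
  fixes h :: "('p, 'k) hist \<Rightarrow> 'c::{real_normed_field, banach, second_countable_topology}"
  assumes h: "h \<in> borel_measurable (hist_space (t - 1))" and f: "f \<in> borel_measurable (borel \<Otimes>\<^sub>M borel)"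
    and t: "t \<ge> 1"
    and hi: "integrable M (\<lambda>\<omega>. h (hist (t - 1) \<omega>))" and fi: "integrable M (\<lambda>\<omega>. f (X0 \<omega>, Y0 \<omega>))"
  shows "(\<integral>\<omega>. h (hist (t - 1) \<omega>) * f (X t \<omega>, Y t \<omega>) \<partial>M) =
      (\<integral>\<omega>. h (hist (t - 1) \<omega>) \<partial>M) * (\<integral>\<omega>. f (X0 \<omega>, Y0 \<omega>) \<partial>M)"
proof -
  let ?G = "\<lambda>Z::_ \<Rightarrow> 'c. sigma_sets (space M) {Z -` S \<inter> space M | S. S \<in> sets borel}"
  have sub: "?G (\<lambda>\<omega>. g (Z \<omega>)) \<subseteq> sets (vimage_algebra (space M) Z N)"
    if g: "g \<in> borel_measurable N" and Z: "Z \<in> M \<rightarrow>\<^sub>M N" for Z :: "'w \<Rightarrow> 'z" and N and g :: "'z \<Rightarrow> 'c"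
  proof -
    have "(\<lambda>\<omega>. g (Z \<omega>)) \<in> borel_measurable (vimage_algebra (space M) Z N)"
      by (rule measurable_compose[OF measurable_vimage_algebra1 g]) (use measurable_space[OF Z] in auto)
    from measurable_sets[OF this] have "{(\<lambda>\<omega>. g (Z \<omega>)) -` S \<inter> space M | S. S \<in> sets borel} \<subseteq> sets (vimage_algebra (space M) Z N)"
      by auto
    from sets.sigma_sets_subset[OF this] show ?thesis by simp
  qed
  have ind: "indep_var borel (\<lambda>\<omega>. f (X t \<omega>, Y t \<omega>)) borel (\<lambda>\<omega>. h (hist (t - 1) \<omega>))"
    unfolding indep_var_eq
  proof (intro conjI)
    show "random_variable borel (\<lambda>\<omega>. f (X t \<omega>, Y t \<omega>))" by (rule measurable_compose[OF tuple_rv[OF t] f])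
    show "random_variable borel (\<lambda>\<omega>. h (hist (t - 1) \<omega>))" by (rule measurable_compose[OF history_rv h])
    show "indep_set (?G (\<lambda>\<omega>. f (X t \<omega>, Y t \<omega>))) (?G (\<lambda>\<omega>. h (hist (t - 1) \<omega>)))"
      unfolding indep_set_def
      by (rule indep_sets_mono_sets[OF tuple_indep_history[OF t, unfolded indep_set_def]])
         (use sub[OF f tuple_rv[OF t]] sub[OF h history_rv] in \<open>auto split: bool.split\<close>)
  qed
  have fi': "integrable M (\<lambda>\<omega>. f (X t \<omega>, Y t \<omega>))" using integrable_tuple_iff[OF f t] fi by simp
  show "(\<integral>\<omega>. h (hist (t - 1) \<omega>) * f (X t \<omega>, Y t \<omega>) \<partial>M) = (\<integral>\<omega>. h (hist (t - 1) \<omega>) \<partial>M) * (\<integral>\<omega>. f (X0 \<omega>, Y0 \<omega>) \<partial>M)"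
    using indep_var_lebesgue_integral[OF ind fi' hi] expectation_tuple[OF f t] by (simp add: mult.commute)
qed

end

section \<open>Removing the inverse probability weight in expectation\<close>

locale ipw_bandit = contextual_bandit M XX X Y A \<pi> X0 Y0
  for M :: "'w measure" and XX :: "(real^'p::finite) set" and X :: "nat \<Rightarrow> 'w \<Rightarrow> real^'p"
    and Y :: "nat \<Rightarrow> 'w \<Rightarrow> real^'k::finite" and A :: "nat \<Rightarrow> 'w \<Rightarrow> 'k" and \<pi> :: "('p, 'k) policies"
    and X0 :: "'w \<Rightarrow> real^'p" and Y0 :: "'w \<Rightarrow> real^'k" +
  fixes a :: 'k and \<pi>min :: real
  assumes unconfounded: "t \<ge> 1 \<Longrightarrow>
      cond_indep_var M (sigma_hist_context M \<pi> X Y A t) (count_space UNIV) (A t) borel (Y t)"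
    and \<pi>min_pos: "0 < \<pi>min"
    and aprob_ge: "t \<ge> 1 \<Longrightarrow> AE \<omega> in M. \<pi>min \<le> aprob t \<omega> a"
begin

text \<open>The denominator has the fixed index \<open>a\<close> where the weighted score has the
  action taken. They agree where the indicator is 1, and the fixed index makes the denominator a
  function of history and context.\<close>

definition ipw :: "nat \<Rightarrow> 'w \<Rightarrow> real" where
  "ipw t \<omega> = of_bool (A t \<omega> = a) / aprob t \<omega> a"

lemma ipw_rv: assumes t: "t \<ge> 1" shows "random_variable borel (ipw t)"
proof -
  note [measurable] = action_rv[OF t] action_prob_rv[OF t]
  show ?thesis unfolding ipw_def[abs_def] by measurable
qed

lemma ipw_nonneg: "t \<ge> 1 \<Longrightarrow> \<omega> \<in> space M \<Longrightarrow> 0 \<le> ipw t \<omega>"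
  unfolding ipw_def using aprob_bounds by simp

lemma ipw_le: assumes "t \<ge> 1" shows "AE \<omega> in M. ipw t \<omega> \<le> 1 / \<pi>min"
  using aprob_ge[OF assms]
proof eventually_elim
  case (elim \<omega>)
  then show ?case unfolding ipw_def using \<pi>min_pos by (intro frac_le) auto
qed

abbreviation "hcy_space t \<equiv> (hist_space (t - 1) \<Otimes>\<^sub>M borel) \<Otimes>\<^sub>M borel :: ((('p, 'k) hist \<times> (real^'p)) \<times> (real^'k)) measure"
abbreviation "hcy t \<omega> \<equiv> ((hist (t - 1) \<omega>, X t \<omega>), Y t \<omega>)"

lemma hcy_rv: "t \<ge> 1 \<Longrightarrow> hcy t \<in> M \<rightarrow>\<^sub>M hcy_space t"
  by (intro measurable_Pair history_rv context_rv outcomes_rv)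

text \<open>On a rectangle this is conditional independence with the policy as conditional
  probability of \<open>a\<close>, and rectangles form an intersection-stable generator. Equality of
  laws then covers every measurable function of history, context and potential outcomes.\<close>

lemma ipw_distr_eq:
  assumes t: "t \<ge> 1"
  shows "distr (density M (\<lambda>\<omega>. ennreal (of_bool (A t \<omega> = a)))) (hcy_space t) (hcy t) =
         distr (density M (\<lambda>\<omega>. ennreal (aprob t \<omega> a))) (hcy_space t) (hcy t)" (is "?L = ?R")
proof -
  let ?G = "sigma_hist_context M \<pi> X Y A t" and ?HC = "\<lambda>\<omega>. (hist (t - 1) \<omega>, X t \<omega>)"
  let ?N = "hist_space (t - 1) \<Otimes>\<^sub>M borel :: (('p, 'k) hist \<times> (real^'p)) measure"
  note [measurable] = action_rv[OF t] action_prob_rv[OF t] outcomes_rv[OF t] context_rv[OF t] history_rv hcy_rv[OF t]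
  have HC[measurable]: "?HC \<in> M \<rightarrow>\<^sub>M ?N" by measurable
  have HCs: "?HC \<in> space M \<rightarrow> space ?N" using measurable_space[OF HC] by blast
  have subG: "subalgebra M ?G"
    unfolding subalgebra_def sigma_hist_context_def using HC by (auto simp: sets_vimage_algebra2[OF HCs] measurable_sets)
  interpret G: finite_measure_subalgebra M ?G
    by unfold_locales (rule subG)
  \<comment> \<open>Conditioning asks for a propensity that is measurable for the sigma-algebra
    generated by history and context; the Borel extension of the policy provides it.\<close>
  have pG: "(\<lambda>\<omega>. aprob t \<omega> a) \<in> borel_measurable ?G"
  proof -
    obtain P where P: "P \<in> borel_measurable ?N" "\<And>\<omega>. \<omega> \<in> space M \<Longrightarrow> P (?HC \<omega>) = action_prob \<pi> X Y A t \<omega>"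
      using action_prob_factor[OF t] by blast
    have "(\<lambda>\<omega>. P (?HC \<omega>) $ a) \<in> borel_measurable ?G"
      unfolding sigma_hist_context_def
      by (rule measurable_compose[OF measurable_vimage_algebra1[OF HCs]]) (use P(1) in measurable)
    then show ?thesis by (rule measurable_cong[THEN iffD1, rotated]) (simp add: P(2) sigma_hist_context_def)
  qed
  \<comment> \<open>For \<open>D\<close> in the conditioning sigma-algebra: condition, factor the
    joint conditional probability, and undo the conditioning of the outcome indicator with
    \<open>indicator D\<close> times the propensity as a known factor.\<close>
  have key: "(\<integral>\<omega>. indicator D \<omega> * (of_bool (A t \<omega> = a) * indicator C (Y t \<omega>)) \<partial>M) =
        (\<integral>\<omega>. (indicator D \<omega> * aprob t \<omega> a) * indicator C (Y t \<omega>) \<partial>M)" 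
    if D: "D \<in> sets ?G" and C: "C \<in> sets borel" for D C
  proof -
    have DM[measurable]: "D \<in> events" using D subG by (auto simp: subalgebra_def)
    note [measurable] = C
    let ?AC = "\<lambda>\<omega>. indicator {a} (A t \<omega>) * indicator C (Y t \<omega>) :: real"
    have iAC: "integrable M (\<lambda>\<omega>. indicator D \<omega> * ?AC \<omega>)"
      by (intro integrable_const_bound[of _ 1]) (auto simp: indicator_def)
    have ibd: "integrable M (\<lambda>\<omega>. (indicator D \<omega> * aprob t \<omega> a) * indicator C (Y t \<omega>))"
      using aprob_bounds[OF t, of _ a] by (intro integrable_const_bound[of _ 1]) (auto simp: indicator_def)
    have cond: "AE \<omega> in M. real_cond_exp M ?G ?AC \<omega> = aprob t \<omega> a * real_cond_exp M ?G (\<lambda>\<omega>. indicator C (Y t \<omega>)) \<omega>"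
      using unconfounded[OF t, unfolded cond_indep_var_def, rule_format, of "{a}" C] C action_drawn_from_policy[OF t, of a]
      by (auto elim!: eventually_elim2)
    have "(\<integral>\<omega>. indicator D \<omega> * ?AC \<omega> \<partial>M) = (\<integral>\<omega>. indicator D \<omega> * real_cond_exp M ?G ?AC \<omega> \<partial>M)"
      by (rule G.real_cond_exp_intg(2)[symmetric, OF iAC]) (use D in auto)
    also have "\<dots> = (\<integral>\<omega>. (indicator D \<omega> * aprob t \<omega> a) * real_cond_exp M ?G (\<lambda>\<omega>. indicator C (Y t \<omega>)) \<omega> \<partial>M)"
      using cond by (intro integral_cong_AE) (auto elim!: eventually_mono intro!: borel_measurable_times borel_measurable_cond_exp2)
    also have "\<dots> = (\<integral>\<omega>. (indicator D \<omega> * aprob t \<omega> a) * indicator C (Y t \<omega>) \<partial>M)"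
      by (rule G.real_cond_exp_intg(2)[OF ibd]) (use D pG in auto)
    finally show ?thesis by (simp add: indicator_def of_bool_def)
  qed
  have em: "emeasure (distr (density M (\<lambda>\<omega>. ennreal (w \<omega>))) (hcy_space t) (hcy t)) (B \<times> C) = 
      ennreal (\<integral>\<omega>. indicator (?HC -` B \<inter> space M) \<omega> * (w \<omega> * indicator C (Y t \<omega>)) \<partial>M)"
    if B: "B \<in> sets ?N" and C: "C \<in> sets borel" and w[measurable]: "w \<in> borel_measurable M" and w01: "\<And>\<omega>. \<omega> \<in> space M \<Longrightarrow> 0 \<le> w \<omega> \<and> w \<omega> \<le> 1"
    for B C and w :: "'w \<Rightarrow> real"
  proof -
    have S: "hcy t -` (B \<times> C) \<inter> space M \<in> events" using B C by (intro measurable_sets[OF hcy_rv[OF t]]) auto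
    note [measurable] = C measurable_sets[OF HC B]
    have BC: "B \<times> C \<in> sets (hcy_space t)" using B C by auto
    have "emeasure (distr (density M (\<lambda>\<omega>. ennreal (w \<omega>))) (hcy_space t) (hcy t)) (B \<times> C) = emeasure (density M (\<lambda>\<omega>. ennreal (w \<omega>))) (hcy t -` (B \<times> C) \<inter> space M)"
      using hcy_rv[OF t] BC by (subst emeasure_distr) auto
    also have "\<dots> = (\<integral>\<^sup>+\<omega>. ennreal (w \<omega>) * indicator (hcy t -` (B \<times> C) \<inter> space M) \<omega> \<partial>M)"
      using S by (subst emeasure_density) auto
    also have "\<dots> = (\<integral>\<^sup>+\<omega>. ennreal (indicator (?HC -` B \<inter> space M) \<omega> * (w \<omega> * indicator C (Y t \<omega>))) \<partial>M)"
      by (intro nn_integral_cong) (auto simp: indicator_def)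
    also have "\<dots> = ennreal (\<integral>\<omega>. indicator (?HC -` B \<inter> space M) \<omega> * (w \<omega> * indicator C (Y t \<omega>)) \<partial>M)"
    proof (rule nn_integral_eq_integral)
      have m: "(\<lambda>\<omega>. indicat_real (?HC -` B \<inter> space M) \<omega> * (w \<omega> * indicator C (Y t \<omega>))) \<in> borel_measurable M"
        by measurable
      show "integrable M (\<lambda>\<omega>. indicator (?HC -` B \<inter> space M) \<omega> * (w \<omega> * indicator C (Y t \<omega>)))"
        using w01 by (intro integrable_const_bound[of _ 1] m) (auto simp: indicator_def)
      show "AE \<omega> in M. 0 \<le> indicator (?HC -` B \<inter> space M) \<omega> * (w \<omega> * indicator C (Y t \<omega>))"
        using w01 by (auto simp: indicator_def)
    qed
    finally show ?thesis .
  qed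
  show ?thesis
  proof (rule measure_eqI_generator_eq[OF Int_stable_pair_measure_generator[of ?N borel]])
    show "{B \<times> C |B C. B \<in> sets ?N \<and> C \<in> sets (borel :: (real^'k) measure)} \<subseteq> Pow (space (hcy_space t))"
      using sets.sets_into_space[of _ ?N] by (fastforce simp: space_pair_measure)
    show "sets ?L = sigma_sets (space (hcy_space t)) {B \<times> C |B C. B \<in> sets ?N \<and> C \<in> sets (borel :: (real^'k) measure)}"
      "sets ?R = sigma_sets (space (hcy_space t)) {B \<times> C |B C. B \<in> sets ?N \<and> C \<in> sets (borel :: (real^'k) measure)}"
      by (simp_all add: sets_pair_measure[of ?N borel] space_pair_measure[of ?N borel])
    fix S assume "S \<in> {B \<times> C |B C. B \<in> sets ?N \<and> C \<in> sets (borel :: (real^'k) measure)}"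
    then obtain B C where S: "S = B \<times> C" "B \<in> sets ?N" "C \<in> sets (borel :: (real^'k) measure)" by blast
    have D: "?HC -` B \<inter> space M \<in> sets ?G" unfolding sigma_hist_context_def using S(2) by (rule in_vimage_algebra)
    show "emeasure ?L S = emeasure ?R S"
      unfolding S(1) using em[OF S(2,3), of "\<lambda>\<omega>. of_bool (A t \<omega> = a)"] em[OF S(2,3), of "\<lambda>\<omega>. aprob t \<omega> a"] key[OF D S(3)] aprob_bounds[OF t, of _ a]
      by (simp add: mult.assoc)
  next
    show "range (\<lambda>_::nat. space (hcy_space t)) \<subseteq> {B \<times> C |B C. B \<in> sets ?N \<and> C \<in> sets (borel :: (real^'k) measure)}"
    proof -
      have "space (hcy_space t) = space ?N \<times> space borel" by (simp only: space_pair_measure)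
      then show ?thesis by (auto intro!: exI[of _ "space ?N"] exI[of _ "space borel"])
    qed
    show "(\<Union>i::nat. space (hcy_space t)) = space (hcy_space t)" by simp
    show "emeasure ?L (space (hcy_space t)) \<noteq> \<infinity>" for i :: nat
    proof -
      have "space (hcy_space t) = space ?N \<times> space borel" by (simp only: space_pair_measure)
      then show ?thesis using em[of "space ?N" "space borel" "\<lambda>\<omega>. of_bool (A t \<omega> = a)"] by simp
    qed
  qed
qed

text \<open>Both sides integrate \<open>F\<close> against one and the same image measure, so they
  agree even when \<open>F\<close> is not integrable.\<close>

lemma ipw_expectation_aux:
  fixes F :: "_ \<Rightarrow> 'c::{banach, second_countable_topology}"
  assumes t: "t \<ge> 1" and F: "F \<in> borel_measurable (hcy_space t)"
  shows "(\<integral>\<omega>. of_bool (A t \<omega> = a) *\<^sub>R F (hcy t \<omega>) \<partial>M) = (\<integral>\<omega>. aprob t \<omega> a *\<^sub>R F (hcy t \<omega>) \<partial>M)"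
proof -
  note [measurable] = action_rv[OF t] action_prob_rv[OF t] hcy_rv[OF t] F
  have eq: "(\<integral>\<omega>. w \<omega> *\<^sub>R F (hcy t \<omega>) \<partial>M) = integral\<^sup>L (distr (density M (\<lambda>\<omega>. ennreal (w \<omega>))) (hcy_space t) (hcy t)) F"
    if w[measurable]: "w \<in> borel_measurable M" and nn: "\<And>\<omega>. \<omega> \<in> space M \<Longrightarrow> 0 \<le> w \<omega>" for w :: "'w \<Rightarrow> real"
  proof -
    have "integral\<^sup>L (distr (density M (\<lambda>\<omega>. ennreal (w \<omega>))) (hcy_space t) (hcy t)) F = (\<integral>\<omega>. F (hcy t \<omega>) \<partial>density M (\<lambda>\<omega>. ennreal (w \<omega>)))"
      using hcy_rv[OF t] by (intro integral_distr F) (simp add: measurable_density_eq1)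
    also have "\<dots> = (\<integral>\<omega>. w \<omega> *\<^sub>R F (hcy t \<omega>) \<partial>M)"
      using nn by (intro integral_density) auto
    finally show ?thesis by simp
  qed
  show ?thesis
    using eq[of "\<lambda>\<omega>. of_bool (A t \<omega> = a)"] eq[of "\<lambda>\<omega>. aprob t \<omega> a"] aprob_bounds[OF t, of _ a] ipw_distr_eq[OF t] by simp
qed

text \<open>The propensity is a function \<open>P\<close> of history and context, so dividing by it
  keeps the integrand in the class covered by the change of weights; the propensity gained then
  cancels one factor of its inverse almost surely. The square of an indicator is the indicator, so
  in the second identity one inverse propensity survives: this is the source of
  \<open>1 / \<pi>bar\<close> in the limiting covariance.\<close>

lemma ipw_expectation:
  fixes F :: "_ \<Rightarrow> 'c::{banach, second_countable_topology}"
  assumes t: "t \<ge> 1" and F: "F \<in> borel_measurable (hcy_space t)"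
  shows expectation_ipw: "(\<integral>\<omega>. ipw t \<omega> *\<^sub>R F (hcy t \<omega>) \<partial>M) = (\<integral>\<omega>. F (hcy t \<omega>) \<partial>M)"
    and expectation_ipw_square: "(\<integral>\<omega>. (ipw t \<omega>)\<^sup>2 *\<^sub>R F (hcy t \<omega>) \<partial>M) = (\<integral>\<omega>. (1 / aprob t \<omega> a) *\<^sub>R F (hcy t \<omega>) \<partial>M)"
proof -
  obtain P where P: "P \<in> borel_measurable (hist_space (t - 1) \<Otimes>\<^sub>M borel)" "\<And>\<omega>. \<omega> \<in> space M \<Longrightarrow> P (hist (t - 1) \<omega>, X t \<omega>) = action_prob \<pi> X Y A t \<omega>"
    using action_prob_factor[OF t] by blast
  note [measurable] = action_rv[OF t] action_prob_rv[OF t] hcy_rv[OF t] F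
  have FH[measurable]: "(\<lambda>\<omega>. F (hcy t \<omega>)) \<in> borel_measurable M" by (rule measurable_compose[OF hcy_rv[OF t] F])
  have PF[measurable]: "(\<lambda>z. P (fst z)) \<in> borel_measurable (hcy_space t)" by (rule measurable_compose[OF measurable_fst P(1)])
  have pos: "AE \<omega> in M. aprob t \<omega> a > 0" using aprob_ge[OF t] by eventually_elim (use \<pi>min_pos in auto)
  have "(\<integral>\<omega>. ipw t \<omega> *\<^sub>R F (hcy t \<omega>) \<partial>M) = (\<integral>\<omega>. of_bool (A t \<omega> = a) *\<^sub>R ((1 / P (fst (hcy t \<omega>)) $ a) *\<^sub>R F (hcy t \<omega>)) \<partial>M)"
    by (intro Bochner_Integration.integral_cong) (auto simp: P(2) ipw_def)
  also have "\<dots> = (\<integral>\<omega>. aprob t \<omega> a *\<^sub>R ((1 / P (fst (hcy t \<omega>)) $ a) *\<^sub>R F (hcy t \<omega>)) \<partial>M)"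
    by (rule ipw_expectation_aux[OF t, of "\<lambda>z. (1 / P (fst z) $ a) *\<^sub>R F z"]) measurable
  also have "\<dots> = (\<integral>\<omega>. aprob t \<omega> a *\<^sub>R ((1 / aprob t \<omega> a) *\<^sub>R F (hcy t \<omega>)) \<partial>M)"
    by (intro Bochner_Integration.integral_cong) (auto simp: P(2))
  also have "\<dots> = (\<integral>\<omega>. F (hcy t \<omega>) \<partial>M)"
    by (intro integral_cong_AE) (use pos in \<open>auto elim!: eventually_mono\<close>)
  finally show "(\<integral>\<omega>. ipw t \<omega> *\<^sub>R F (hcy t \<omega>) \<partial>M) = (\<integral>\<omega>. F (hcy t \<omega>) \<partial>M)" .
  have "(\<integral>\<omega>. (ipw t \<omega>)\<^sup>2 *\<^sub>R F (hcy t \<omega>) \<partial>M) = (\<integral>\<omega>. of_bool (A t \<omega> = a) *\<^sub>R ((1 / P (fst (hcy t \<omega>)) $ a)\<^sup>2 *\<^sub>R F (hcy t \<omega>)) \<partial>M)"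
    by (intro Bochner_Integration.integral_cong) (auto simp: P(2) ipw_def)
  also have "\<dots> = (\<integral>\<omega>. aprob t \<omega> a *\<^sub>R ((1 / P (fst (hcy t \<omega>)) $ a)\<^sup>2 *\<^sub>R F (hcy t \<omega>)) \<partial>M)"
    by (rule ipw_expectation_aux[OF t, of "\<lambda>z. (1 / P (fst z) $ a)\<^sup>2 *\<^sub>R F z"]) measurable
  also have "\<dots> = (\<integral>\<omega>. aprob t \<omega> a *\<^sub>R ((1 / aprob t \<omega> a)\<^sup>2 *\<^sub>R F (hcy t \<omega>)) \<partial>M)"
    by (intro Bochner_Integration.integral_cong) (auto simp: P(2))
  also have "\<dots> = (\<integral>\<omega>. (1 / aprob t \<omega> a) *\<^sub>R F (hcy t \<omega>) \<partial>M)"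
    by (intro integral_cong_AE) (use pos in \<open>auto elim!: eventually_mono simp: power2_eq_square\<close>)
  finally show "(\<integral>\<omega>. (ipw t \<omega>)\<^sup>2 *\<^sub>R F (hcy t \<omega>) \<partial>M) = (\<integral>\<omega>. (1 / aprob t \<omega> a) *\<^sub>R F (hcy t \<omega>) \<partial>M)" .
qed

end

lemma integrable_mult_L2:
  fixes f h :: "'x \<Rightarrow> real"
  assumes [measurable]: "f \<in> borel_measurable N" "h \<in> borel_measurable N"
    and f: "integrable N (\<lambda>x. (f x)\<^sup>2)" and h: "integrable N (\<lambda>x. (h x)\<^sup>2)"
  shows "integrable N (\<lambda>x. f x * h x)"
proof (rule Bochner_Integration.integrable_bound[of _ "\<lambda>x. (f x)\<^sup>2 + (h x)\<^sup>2"])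
  show "integrable N (\<lambda>x. (f x)\<^sup>2 + (h x)\<^sup>2)" using f h by simp
  have "\<bar>u * v\<bar> \<le> u\<^sup>2 + v\<^sup>2" for u v :: real
  proof -
    have "0 \<le> (\<bar>u\<bar> - \<bar>v\<bar>)\<^sup>2" by simp
    then have "2 * (\<bar>u\<bar> * \<bar>v\<bar>) \<le> u\<^sup>2 + v\<^sup>2" by (simp add: power2_eq_square algebra_simps)
    then show ?thesis unfolding abs_mult using zero_le_mult_iff[of "\<bar>u\<bar>" "\<bar>v\<bar>"] by linarith
  qed
  then show "AE x in N. norm (f x * h x) \<le> norm ((f x)\<^sup>2 + (h x)\<^sup>2)"
    by (intro AE_I2) (simp only: real_norm_def, rule order_trans[OF _ abs_ge_self])
  show "(\<lambda>x. f x * h x) \<in> borel_measurable N" by measurable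
qed

lemma (in finite_measure) integrable_of_square:
  fixes f :: "'a \<Rightarrow> real"
  assumes "f \<in> borel_measurable M" "integrable M (\<lambda>x. (f x)\<^sup>2)" shows "integrable M f"
  using integrable_mult_L2[of f M "\<lambda>_. 1"] assms by simp

section \<open>Moments and averages of weighted terms\<close>

context ipw_bandit begin

abbreviation "score_at f t \<omega> \<equiv> f (X t \<omega>, Y t \<omega> $ a)"

lemma measurable_outcome_component:
  fixes f :: "(real^'p) \<times> real \<Rightarrow> real"
  assumes "f \<in> borel_measurable (borel \<Otimes>\<^sub>M borel)"
  shows "(\<lambda>z. f (fst z, snd z $ a)) \<in> borel_measurable (borel \<Otimes>\<^sub>M (borel :: (real^'k) measure))"
  by (rule measurable_compose[OF _ assms]) measurable

lemma score_at_rv: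
  assumes f: "f \<in> borel_measurable (borel \<Otimes>\<^sub>M borel)" and t: "t \<ge> 1"
  shows "random_variable borel (\<lambda>\<omega>. score_at f t \<omega> :: real)"
  using measurable_compose[OF tuple_rv[OF t] measurable_outcome_component[OF f]] by simp

lemma score_at_transfer:
  fixes f :: "(real^'p) \<times> real \<Rightarrow> real"
  assumes f: "f \<in> borel_measurable (borel \<Otimes>\<^sub>M borel)" and t: "t \<ge> 1"
  shows "integrable M (\<lambda>\<omega>. score_at f t \<omega>) \<longleftrightarrow> integrable M (\<lambda>\<omega>. f (X0 \<omega>, Y0 \<omega> $ a))"
    and "expectation (\<lambda>\<omega>. score_at f t \<omega>) = expectation (\<lambda>\<omega>. f (X0 \<omega>, Y0 \<omega> $ a))"
  using integrable_tuple_iff[OF measurable_outcome_component[OF f] t] expectation_tuple[OF measurable_outcome_component[OF f] t]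
  by simp_all

text \<open>The history records propensities, action and observed outcome, and the observed outcome
  equals \<open>Y s \<omega> $ a\<close> whenever the indicator is nonzero. So a past weighted term
  is a function of the history, although the potential outcome in it need not be.\<close>

lemma ipw_term_factor:
  fixes f :: "(real^'p) \<times> real \<Rightarrow> real"
  assumes f: "f \<in> borel_measurable (borel \<Otimes>\<^sub>M borel)" and s: "1 \<le> s" "s \<le> n"
  obtains F where "F \<in> borel_measurable (hist_space n)"
    "\<And>\<omega>. F (hist n \<omega>) = ipw s \<omega> * score_at f s \<omega>"
proof
  define G where "G = (\<lambda>z :: ('p, 'k) step. of_bool (fst (snd (snd z)) = a) / fst (snd z) $ a * f (fst z, snd (snd (snd z))))"
  have G: "G \<in> borel_measurable step_space"
  proof -
    have [measurable]: "(\<lambda>z. f (fst z, snd (snd (snd z)))) \<in> borel_measurable step_space"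
      by (rule measurable_compose[OF _ f]) measurable
    show ?thesis unfolding G_def by measurable
  qed
  have comp: "(\<lambda>h. h s) \<in> hist_space n \<rightarrow>\<^sub>M step_space"
    unfolding hist_space_def using s by (intro measurable_component_singleton) auto
  show "(\<lambda>h. G (h s)) \<in> borel_measurable (hist_space n)" by (rule measurable_compose[OF comp G])
  show "G (hist n \<omega> s) = ipw s \<omega> * score_at f s \<omega>" for \<omega>
    unfolding history_component[OF s] G_def ipw_def by auto
qed

lemma ipw_sum_factor:
  fixes f :: "(real^'p) \<times> real \<Rightarrow> real"
  assumes f: "f \<in> borel_measurable (borel \<Otimes>\<^sub>M borel)"
  obtains F where "F \<in> borel_measurable (hist_space n)"
    "\<And>\<omega>. F (hist n \<omega>) = (\<Sum>t=1..n. ipw t \<omega> * score_at f t \<omega> - c)"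
proof -
  have "\<forall>t\<in>{1..n}. \<exists>F. F \<in> borel_measurable (hist_space n) \<and> (\<forall>\<omega>. F (hist n \<omega>) = ipw t \<omega> * score_at f t \<omega>)"
  proof
    fix t assume "t \<in> {1..n}"
    then have t: "1 \<le> t" "t \<le> n" by auto
    show "\<exists>F. F \<in> borel_measurable (hist_space n) \<and> (\<forall>\<omega>. F (hist n \<omega>) = ipw t \<omega> * score_at f t \<omega>)"
    proof -
      obtain F where "F \<in> borel_measurable (hist_space n)" "\<And>\<omega>. F (hist n \<omega>) = ipw t \<omega> * score_at f t \<omega>"
        by (rule ipw_term_factor[OF f t], rule that)
      then show ?thesis by (intro exI conjI allI)
    qed
  qed
  then obtain F where F': "\<forall>t\<in>{1..n}. F t \<in> borel_measurable (hist_space n) \<and> (\<forall>\<omega>. F t (hist n \<omega>) = ipw t \<omega> * score_at f t \<omega>)"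
    by (rule bchoice[THEN exE])
  have F: "F t \<in> borel_measurable (hist_space n)" "F t (hist n \<omega>) = ipw t \<omega> * score_at f t \<omega>" if "t \<in> {1..n}" for t \<omega>
    using F'[rule_format, OF that] by simp_all
  show thesis
  proof (rule that[of "\<lambda>h. \<Sum>t=1..n. F t h - c"])
    show "(\<lambda>h. \<Sum>t=1..n. F t h - c) \<in> borel_measurable (hist_space n)"
      by (intro borel_measurable_sum borel_measurable_diff F(1) borel_measurable_const)
    show "(\<Sum>t=1..n. F t (hist n \<omega>) - c) = (\<Sum>t=1..n. ipw t \<omega> * score_at f t \<omega> - c)" for \<omega>
      by (intro sum.cong refl) (simp only: F(2))
  qed
qed

lemma ipw_term_rv:
  fixes f :: "(real^'p) \<times> real \<Rightarrow> real"
  assumes f: "f \<in> borel_measurable (borel \<Otimes>\<^sub>M borel)" and t: "t \<ge> 1"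
  shows "random_variable borel (\<lambda>\<omega>. ipw t \<omega> * score_at f t \<omega>)"
  by (intro borel_measurable_times ipw_rv score_at_rv f t)

lemma ipw_moment:
  fixes f :: "(real^'p) \<times> real \<Rightarrow> real"
  assumes f: "f \<in> borel_measurable (borel \<Otimes>\<^sub>M borel)" and t: "t \<ge> 1"
    and i: "integrable M (\<lambda>\<omega>. \<bar>f (X0 \<omega>, Y0 \<omega> $ a)\<bar> ^ k)"
  shows "integrable M (\<lambda>\<omega>. \<bar>ipw t \<omega> * score_at f t \<omega>\<bar> ^ k)"
    and "expectation (\<lambda>\<omega>. \<bar>ipw t \<omega> * score_at f t \<omega>\<bar> ^ k) \<le> (1 / \<pi>min) ^ k * expectation (\<lambda>\<omega>. \<bar>f (X0 \<omega>, Y0 \<omega> $ a)\<bar> ^ k)"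
proof -
  note [measurable] = ipw_term_rv[OF f t]
  have m: "(\<lambda>z. \<bar>f z\<bar> ^ k) \<in> borel_measurable (borel \<Otimes>\<^sub>M borel)" using f by measurable
  have i': "integrable M (\<lambda>\<omega>. (1 / \<pi>min) ^ k * \<bar>score_at f t \<omega>\<bar> ^ k)"
    using score_at_transfer(1)[OF m t] i by (intro integrable_mult_right) (simp only:)
  have bd: "AE \<omega> in M. \<bar>ipw t \<omega> * score_at f t \<omega>\<bar> ^ k \<le> (1 / \<pi>min) ^ k * \<bar>score_at f t \<omega>\<bar> ^ k"
    using ipw_le[OF t] AE_space
  proof eventually_elim
    case (elim \<omega>)
    then have "ipw t \<omega> ^ k \<le> (1 / \<pi>min) ^ k" using ipw_nonneg[OF t] by (intro power_mono) auto
    then show ?case using ipw_nonneg[OF t elim(2)]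
      unfolding abs_mult power_mult_distrib by (intro mult_right_mono) auto
  qed
  show i2: "integrable M (\<lambda>\<omega>. \<bar>ipw t \<omega> * score_at f t \<omega>\<bar> ^ k)"
  proof (rule Bochner_Integration.integrable_bound[OF i'])
    show "random_variable borel (\<lambda>\<omega>. \<bar>ipw t \<omega> * score_at f t \<omega>\<bar> ^ k)" by measurable
    show "AE \<omega> in M. norm (\<bar>ipw t \<omega> * score_at f t \<omega>\<bar> ^ k) \<le> norm ((1 / \<pi>min) ^ k * \<bar>score_at f t \<omega>\<bar> ^ k)"
      using bd by eventually_elim (use \<pi>min_pos in \<open>simp add: abs_mult power_abs\<close>)
  qed
  have "expectation (\<lambda>\<omega>. \<bar>ipw t \<omega> * score_at f t \<omega>\<bar> ^ k) \<le> expectation (\<lambda>\<omega>. (1 / \<pi>min) ^ k * \<bar>score_at f t \<omega>\<bar> ^ k)"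
    by (rule integral_mono_AE[OF i2 i' bd])
  also have "\<dots> = (1 / \<pi>min) ^ k * expectation (\<lambda>\<omega>. \<bar>f (X0 \<omega>, Y0 \<omega> $ a)\<bar> ^ k)"
    using score_at_transfer(2)[OF m t] by (simp only: integral_mult_right_zero)
  finally show "expectation (\<lambda>\<omega>. \<bar>ipw t \<omega> * score_at f t \<omega>\<bar> ^ k) \<le> (1 / \<pi>min) ^ k * expectation (\<lambda>\<omega>. \<bar>f (X0 \<omega>, Y0 \<omega> $ a)\<bar> ^ k)" .
qed

text \<open>The martingale property in tested form: the weight drops out in expectation, and the
  fresh tuple is independent of the history, so the increment contributes exactly its mean. Testing
  against functions \<open>h\<close> of the past stands in for conditional expectations.\<close>

lemma expectation_history_ipw:
  fixes f :: "(real^'p) \<times> real \<Rightarrow> real" and h :: "('p, 'k) hist \<Rightarrow> 'c::{real_normed_field, banach, second_countable_topology}"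
  assumes f: "f \<in> borel_measurable (borel \<Otimes>\<^sub>M borel)" and t: "t \<ge> 1"
    and h: "h \<in> borel_measurable (hist_space (t - 1))" and hi: "integrable M (\<lambda>\<omega>. h (hist (t - 1) \<omega>))"
    and fi: "integrable M (\<lambda>\<omega>. f (X0 \<omega>, Y0 \<omega> $ a))"
  shows "(\<integral>\<omega>. h (hist (t - 1) \<omega>) * of_real (ipw t \<omega> * score_at f t \<omega>) \<partial>M) =
      (\<integral>\<omega>. h (hist (t - 1) \<omega>) \<partial>M) * of_real (expectation (\<lambda>\<omega>. f (X0 \<omega>, Y0 \<omega> $ a)))"
proof -
  let ?F = "\<lambda>z. h (fst (fst z)) * of_real (f (snd (fst z), snd z $ a)) :: 'c"
  have F: "?F \<in> borel_measurable (hcy_space t)"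
    by (intro borel_measurable_times measurable_compose[OF _ borel_measurable_of_real] measurable_compose[OF _ h] measurable_compose[OF _ f]) measurable
  have fo: "(\<lambda>z. of_real (f (fst z, snd z $ a)) :: 'c) \<in> borel_measurable (borel \<Otimes>\<^sub>M (borel :: (real^'k) measure))"
    by (rule measurable_compose[OF measurable_outcome_component[OF f] borel_measurable_of_real])
  have "(\<integral>\<omega>. h (hist (t - 1) \<omega>) * of_real (ipw t \<omega> * score_at f t \<omega>) \<partial>M) = (\<integral>\<omega>. ipw t \<omega> *\<^sub>R ?F (hcy t \<omega>) \<partial>M)"
    by (intro Bochner_Integration.integral_cong) (auto simp: scaleR_conv_of_real)
  also have "\<dots> = (\<integral>\<omega>. h (hist (t - 1) \<omega>) * of_real (score_at f t \<omega>) \<partial>M)"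
    unfolding expectation_ipw[OF t F] by (simp only: fst_conv snd_conv)
  also have "\<dots> = (\<integral>\<omega>. h (hist (t - 1) \<omega>) \<partial>M) * (\<integral>\<omega>. of_real (f (X0 \<omega>, Y0 \<omega> $ a)) \<partial>M)"
    by (rule expectation_history_tuple[OF h fo t hi, unfolded fst_conv snd_conv, OF integrable_bounded_linear[OF bounded_linear_of_real fi]])
  also have "(\<integral>\<omega>. of_real (f (X0 \<omega>, Y0 \<omega> $ a)) \<partial>M) = (of_real (expectation (\<lambda>\<omega>. f (X0 \<omega>, Y0 \<omega> $ a))) :: 'c)"
    by (rule integral_bounded_linear[OF bounded_linear_of_real fi])
  finally show ?thesis .
qed

lemma expectation_ipw_term:
  fixes f :: "(real^'p) \<times> real \<Rightarrow> real"
  assumes f: "f \<in> borel_measurable (borel \<Otimes>\<^sub>M borel)" and t: "t \<ge> 1" and fi: "integrable M (\<lambda>\<omega>. f (X0 \<omega>, Y0 \<omega> $ a))"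
  shows "expectation (\<lambda>\<omega>. ipw t \<omega> * score_at f t \<omega>) = expectation (\<lambda>\<omega>. f (X0 \<omega>, Y0 \<omega> $ a))"
  using expectation_history_ipw[OF f t borel_measurable_const[of "1::real"] _ fi] by (simp add: prob_space)

text \<open>Centred increments are orthogonal to the centred sum of the past, so second moments add
  up and grow at most linearly in \<open>n\<close>. The bound \<open>1 / \<pi>min\<close> on the
  weights accounts for the constant.\<close>

lemma ipw_sum_second_moment:
  fixes f :: "(real^'p) \<times> real \<Rightarrow> real"
  assumes f: "f \<in> borel_measurable (borel \<Otimes>\<^sub>M borel)"
    and f2: "integrable M (\<lambda>\<omega>. (f (X0 \<omega>, Y0 \<omega> $ a))\<^sup>2)"
  defines "\<mu> \<equiv> expectation (\<lambda>\<omega>. f (X0 \<omega>, Y0 \<omega> $ a))"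
  shows "integrable M (\<lambda>\<omega>. (\<Sum>t=1..n. ipw t \<omega> * score_at f t \<omega> - \<mu>)\<^sup>2) \<and>
    expectation (\<lambda>\<omega>. (\<Sum>t=1..n. ipw t \<omega> * score_at f t \<omega> - \<mu>)\<^sup>2) \<le> real n * ((1 / \<pi>min)\<^sup>2 * expectation (\<lambda>\<omega>. (f (X0 \<omega>, Y0 \<omega> $ a))\<^sup>2))"
proof (induction n)
  case 0 then show ?case by simp
next
  case (Suc n)
  define t where "t = Suc n"
  have t: "t \<ge> 1" "t - 1 = n" by (auto simp: t_def)
  have f0m: "random_variable borel (\<lambda>\<omega>. f (X0 \<omega>, Y0 \<omega> $ a))"
    using measurable_compose[OF generic_tuple_rv measurable_outcome_component[OF f]] by simp
  have f1: "integrable M (\<lambda>\<omega>. f (X0 \<omega>, Y0 \<omega> $ a))" by (rule integrable_of_square[OF f0m f2])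
  let ?q = "\<lambda>\<omega>. ipw t \<omega> * score_at f t \<omega>" and ?C = "(1 / \<pi>min)\<^sup>2 * expectation (\<lambda>\<omega>. (f (X0 \<omega>, Y0 \<omega> $ a))\<^sup>2)"
  obtain F where F: "F \<in> borel_measurable (hist_space n)" "\<And>\<omega>. F (hist n \<omega>) = (\<Sum>t=1..n. ipw t \<omega> * score_at f t \<omega> - \<mu>)"
    using ipw_sum_factor[OF f] by blast
  define S where "S \<omega> = F (hist n \<omega>)" for \<omega>
  have Sm[measurable]: "random_variable borel S" unfolding S_def by (rule measurable_compose[OF history_rv F(1)])
  note [measurable] = ipw_term_rv[OF f t(1)]
  have S2: "integrable M (\<lambda>\<omega>. (S \<omega>)\<^sup>2)" "expectation (\<lambda>\<omega>. (S \<omega>)\<^sup>2) \<le> real n * ?C"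
    using Suc unfolding S_def F(2) by auto
  have S1: "integrable M S" by (rule integrable_of_square[OF Sm S2(1)])
  have q2: "integrable M (\<lambda>\<omega>. (?q \<omega>)\<^sup>2)" "expectation (\<lambda>\<omega>. (?q \<omega>)\<^sup>2) \<le> ?C"
    using ipw_moment[OF f t(1), of 2] f2 by (simp_all del: power_mult_distrib power_one_over)
  have q1: "integrable M ?q" by (rule integrable_of_square[OF _ q2(1)]) measurable
  have Sq: "integrable M (\<lambda>\<omega>. S \<omega> * ?q \<omega>)" by (rule integrable_mult_L2[OF _ _ S2(1) q2(1)]) measurable
  have Eq: "expectation ?q = \<mu>" unfolding \<mu>_def by (rule expectation_ipw_term[OF f t(1) f1])
  have ESq: "expectation (\<lambda>\<omega>. S \<omega> * ?q \<omega>) = expectation S * \<mu>"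
    using expectation_history_ipw[OF f t(1), of F] F(1) S1 f1 unfolding t(2) \<mu>_def S_def[symmetric] by simp
  have eq: "(S \<omega> + (?q \<omega> - \<mu>))\<^sup>2 = (S \<omega>)\<^sup>2 + 2 * (S \<omega> * ?q \<omega>) - 2 * \<mu> * S \<omega> + (?q \<omega>)\<^sup>2 - 2 * \<mu> * ?q \<omega> + \<mu>\<^sup>2" for \<omega>
    by (simp add: power2_eq_square algebra_simps)
  have sum: "(\<Sum>t=1..Suc n. ipw t \<omega> * score_at f t \<omega> - \<mu>) = S \<omega> + (?q \<omega> - \<mu>)" for \<omega>
    unfolding S_def F(2) t_def by simp
  have "integrable M (\<lambda>\<omega>. (S \<omega> + (?q \<omega> - \<mu>))\<^sup>2)"
    unfolding eq by (intro Bochner_Integration.integrable_add Bochner_Integration.integrable_diff integrable_mult_right S1 S2 q1 q2 Sq integrable_const)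
  moreover have "expectation (\<lambda>\<omega>. (S \<omega> + (?q \<omega> - \<mu>))\<^sup>2) = expectation (\<lambda>\<omega>. (S \<omega>)\<^sup>2) + 2 * (expectation S * \<mu>) - 2 * \<mu> * expectation S + expectation (\<lambda>\<omega>. (?q \<omega>)\<^sup>2) - 2 * \<mu> * \<mu> + \<mu>\<^sup>2"
    unfolding eq ESq[symmetric] using S1 S2(1) q1 q2(1) Sq Eq
    by (simp add: prob_space del: power_mult_distrib)
  \<comment> \<open>The two terms with \<open>expectation S\<close> cancel, and the remaining terms
    in \<open>\<mu>\<close> add up to \<open>- \<mu>\<^sup>2\<close>, which is dropped.\<close>
  moreover have "\<dots> \<le> real (Suc n) * ?C"
  proof -
    have "real (Suc n) * ?C = real n * ?C + ?C" by (simp only: of_nat_Suc distrib_right mult_1 add.commute)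
    moreover have "2 * (expectation S * \<mu>) = 2 * \<mu> * expectation S" "2 * \<mu> * \<mu> = 2 * \<mu>\<^sup>2" by (simp_all add: power2_eq_square)
    ultimately show ?thesis using S2(2) q2(2) zero_le_power2[of \<mu>] by linarith
  qed
  ultimately show ?case unfolding sum by simp
qed

text \<open>By orthogonality the mean square error of the average is of order \<open>1 / T\<close>;
  convergence in probability follows for the square and then for the average itself.\<close>

lemma ipw_mean_tendsto:
  fixes f :: "(real^'p) \<times> real \<Rightarrow> real"
  assumes f: "f \<in> borel_measurable (borel \<Otimes>\<^sub>M borel)"
    and f2: "integrable M (\<lambda>\<omega>. (f (X0 \<omega>, Y0 \<omega> $ a))\<^sup>2)"
  shows "tendsto_zero_in_prob M (\<lambda>T \<omega>. (\<Sum>t=1..T. ipw t \<omega> * score_at f t \<omega>) / real T - expectation (\<lambda>\<omega>. f (X0 \<omega>, Y0 \<omega> $ a)))"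
proof -
  define \<mu> where "\<mu> = expectation (\<lambda>\<omega>. f (X0 \<omega>, Y0 \<omega> $ a))"
  let ?S = "\<lambda>T \<omega>. \<Sum>t=1..T. ipw t \<omega> * score_at f t \<omega> - \<mu>" and ?C = "(1 / \<pi>min)\<^sup>2 * expectation (\<lambda>\<omega>. (f (X0 \<omega>, Y0 \<omega> $ a))\<^sup>2)"
  note mom = ipw_sum_second_moment[OF f f2, folded \<mu>_def]
  have "tendsto_zero_in_prob M (\<lambda>T \<omega>. (?S T \<omega>)\<^sup>2 / (real T)\<^sup>2)"
  proof (rule tendsto_zero_in_prob_expectation)
    show "integrable M (\<lambda>\<omega>. (?S T \<omega>)\<^sup>2 / (real T)\<^sup>2)" for T using mom[of T] by simp
    have "(\<lambda>T. ?C / real T) \<longlonglongrightarrow> 0" by (rule real_tendsto_divide_at_top[OF tendsto_const filterlim_real_sequentially])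
    then show "(\<lambda>T. expectation (\<lambda>\<omega>. \<bar>(?S T \<omega>)\<^sup>2 / (real T)\<^sup>2\<bar>)) \<longlonglongrightarrow> 0"
    proof (rule tendsto_sandwich[OF _ _ tendsto_const, rotated 2])
      show "\<forall>\<^sub>F T in sequentially. expectation (\<lambda>\<omega>. \<bar>(?S T \<omega>)\<^sup>2 / (real T)\<^sup>2\<bar>) \<le> ?C / real T"
      proof (rule eventually_sequentiallyI[of 1])
        fix T :: nat assume T: "1 \<le> T"
        have "expectation (\<lambda>\<omega>. \<bar>(?S T \<omega>)\<^sup>2 / (real T)\<^sup>2\<bar>) = expectation (\<lambda>\<omega>. (?S T \<omega>)\<^sup>2) / (real T)\<^sup>2" by simp
        also have "\<dots> \<le> (real T * ?C) / (real T)\<^sup>2" using mom[of T] by (intro divide_right_mono) auto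
        also have "\<dots> = ?C / real T" using T by (simp add: power2_eq_square)
        finally show "expectation (\<lambda>\<omega>. \<bar>(?S T \<omega>)\<^sup>2 / (real T)\<^sup>2\<bar>) \<le> ?C / real T" .
      qed
    qed (intro always_eventually allI Bochner_Integration.integral_nonneg, simp)
  qed
  then have sq: "\<And>e. e > 0 \<Longrightarrow> (\<lambda>T. prob {\<omega> \<in> space M. norm ((?S T \<omega>)\<^sup>2 / (real T)\<^sup>2) > e}) \<longlonglongrightarrow> 0"
    by (simp add: tendsto_zero_in_prob_def)
  show ?thesis unfolding tendsto_zero_in_prob_def \<mu>_def[symmetric]
  proof (intro allI impI)
    fix e :: real assume e: "e > 0"
    have "norm ((?S T \<omega>)\<^sup>2 / (real T)\<^sup>2) > e\<^sup>2 \<longleftrightarrow> norm ((\<Sum>t=1..T. ipw t \<omega> * score_at f t \<omega>) / real T - \<mu>) > e" if "T \<ge> 1" for T \<omega>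
    proof -
      have "?S T \<omega> / real T = (\<Sum>t=1..T. ipw t \<omega> * score_at f t \<omega>) / real T - \<mu>"
        using that by (simp add: sum_subtractf diff_divide_distrib)
      then have "norm ((?S T \<omega>)\<^sup>2 / (real T)\<^sup>2) = \<bar>(\<Sum>t=1..T. ipw t \<omega> * score_at f t \<omega>) / real T - \<mu>\<bar>\<^sup>2"
        by (simp add: power_divide[symmetric])
      then show ?thesis
        using e power_mono_iff[of "\<bar>(\<Sum>t=1..T. ipw t \<omega> * score_at f t \<omega>) / real T - \<mu>\<bar>" e 2] by (simp add: not_le[symmetric])
    qed
    then have "\<forall>\<^sub>F T in sequentially. prob {\<omega> \<in> space M. norm ((?S T \<omega>)\<^sup>2 / (real T)\<^sup>2) > e\<^sup>2} =
       prob {\<omega> \<in> space M. norm ((\<Sum>t=1..T. ipw t \<omega> * score_at f t \<omega>) / real T - \<mu>) > e}"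
      by (intro eventually_sequentiallyI[of 1]) simp
    from tendsto_cong[OF this] sq[of "e\<^sup>2"] e
    show "(\<lambda>T. prob {\<omega> \<in> space M. norm ((\<Sum>t=1..T. ipw t \<omega> * score_at f t \<omega>) / real T - \<mu>) > e}) \<longlonglongrightarrow> 0" by simp
  qed
qed

end

lemma inverse_diff_bound:
  fixes p q m :: real
  assumes "0 < m" "m \<le> p" "m \<le> q"
  shows "\<bar>1 / p - 1 / q\<bar> \<le> \<bar>p - q\<bar> / m\<^sup>2 \<and> \<bar>1 / q\<bar> \<le> 1 / m \<and> \<bar>1 / p\<bar> \<le> 1 / m"
proof -
  have p: "0 < p" "0 < q" using assms by auto
  then have "1 / p - 1 / q = (q - p) / (p * q)" by (simp add: field_simps)
  then have "\<bar>1 / p - 1 / q\<bar> = \<bar>p - q\<bar> / (p * q)" using p by (simp add: abs_minus_commute)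
  also have "\<dots> \<le> \<bar>p - q\<bar> / m\<^sup>2"
    unfolding power2_eq_square using assms p by (intro divide_left_mono mult_mono mult_pos_pos) auto
  finally show ?thesis using assms p by (simp add: frac_le)
qed

text \<open>Young's inequality with weight \<open>\<eta>\<close>, followed by
  \<open>d\<^sup>2 \<le> d\<close>. It separates a factor whose mean tends to 0 from the unbounded
  \<open>s\<^sup>2\<close>, at the price of a small multiple of the fourth power.\<close>

lemma weighted_young:
  fixes D s d m \<eta> :: real
  assumes "0 < \<eta>" "0 < m" "0 \<le> D" "D \<le> d / m\<^sup>2" "0 \<le> d" "d \<le> 1"
  shows "D * s\<^sup>2 \<le> \<eta> * s ^ 4 + d * (1 / (\<eta> * m ^ 4))"
proof -
  have "0 \<le> (\<eta> * s\<^sup>2 - D)\<^sup>2" by simp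
  then have "2 * (\<eta> * (D * s\<^sup>2)) \<le> \<eta> * (\<eta> * s ^ 4) + D\<^sup>2"
    by (simp add: power2_eq_square power4_eq_xxxx algebra_simps)
  moreover have "0 \<le> \<eta> * (D * s\<^sup>2)" using assms by simp
  moreover have "D\<^sup>2 \<le> d / m ^ 4"
  proof -
    have "D\<^sup>2 \<le> (d / m\<^sup>2)\<^sup>2" using assms by (intro power_mono) auto
    also have "\<dots> = d\<^sup>2 / m ^ 4" by (simp add: power_divide)
    also have "\<dots> \<le> d / m ^ 4" unfolding power2_eq_square using assms by (intro divide_right_mono mult_left_le) auto
    finally show ?thesis .
  qed
  ultimately have "\<eta> * (D * s\<^sup>2) \<le> \<eta> * (\<eta> * s ^ 4) + d / m ^ 4" by linarith
  also have "\<dots> = \<eta> * (\<eta> * s ^ 4 + d * (1 / (\<eta> * m ^ 4)))" using assms by (simp add: field_simps)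
  finally show ?thesis using assms by (simp only: mult_le_cancel_left_pos)
qed

section \<open>Characteristic functions of weighted sums\<close>

context ipw_bandit begin
text \<open>Against a test factor from the past, the squared weight leaves
  \<open>1 / aprob t \<omega> a\<close>, which is then replaced by
  \<open>1 / q (X t \<omega>)\<close>. After the replacement the integrand is a function of the
  fresh tuple alone, and independence produces \<open>\<sigma>2\<close>. The price of the
  replacement is \<open>?\<delta> t\<close>, which tends to 0 by convergence of the policy.\<close>

lemma ipw_char_tendsto:
  fixes f :: "(real^'p) \<times> real \<Rightarrow> real" and q :: "real^'p \<Rightarrow> real"
  assumes f: "f \<in> borel_measurable (borel \<Otimes>\<^sub>M borel)"
    and f4: "integrable M (\<lambda>\<omega>. (f (X0 \<omega>, Y0 \<omega> $ a)) ^ 4)"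
    and mean: "expectation (\<lambda>\<omega>. f (X0 \<omega>, Y0 \<omega> $ a)) = 0"
    and q: "q \<in> borel_measurable borel" "\<And>x. x \<in> XX \<Longrightarrow> 0 \<le> q x" "\<And>x. x \<in> XX \<Longrightarrow> q x \<le> 1"
    and q_ge: "\<And>t. t \<ge> 1 \<Longrightarrow> AE \<omega> in M. \<pi>min \<le> q (X t \<omega>)" "AE \<omega> in M. \<pi>min \<le> q (X0 \<omega>)"
    and conv: "tendsto_zero_in_prob M (\<lambda>t \<omega>. aprob t \<omega> a - q (X t \<omega>))"
  defines "\<sigma>2 \<equiv> expectation (\<lambda>\<omega>. 1 / q (X0 \<omega>) * (f (X0 \<omega>, Y0 \<omega> $ a))\<^sup>2)"
  shows "(\<lambda>T. CLINT \<omega>|M. cis ((\<Sum>t=1..T. ipw t \<omega> * score_at f t \<omega>) / sqrt T)) \<longlonglongrightarrow> exp (- (\<sigma>2 / 2))"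
proof -
  note [measurable] = q(1)
  have cism[measurable]: "cis \<in> borel_measurable borel" by (intro borel_measurable_continuous_onI continuous_intros)
  have f0m[measurable]: "random_variable borel (\<lambda>\<omega>. f (X0 \<omega>, Y0 \<omega> $ a))"
    using measurable_compose[OF generic_tuple_rv measurable_outcome_component[OF f]] by simp
  note [measurable] = generic_context_rv
  let ?f0 = "\<lambda>\<omega>. f (X0 \<omega>, Y0 \<omega> $ a)"
  have f2: "integrable M (\<lambda>\<omega>. (?f0 \<omega>)\<^sup>2)"
  proof (rule integrable_of_square)
    show "random_variable borel (\<lambda>\<omega>. (?f0 \<omega>)\<^sup>2)" using f0m by measurable
    show "integrable M (\<lambda>\<omega>. ((?f0 \<omega>)\<^sup>2)\<^sup>2)" using f4 by simp
  qed
  have f3: "integrable M (\<lambda>\<omega>. \<bar>?f0 \<omega>\<bar> ^ 3)"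
  proof -
    have "integrable M (\<lambda>\<omega>. \<bar>?f0 \<omega>\<bar> * (?f0 \<omega>)\<^sup>2)"
    proof (rule integrable_mult_L2)
      show "integrable M (\<lambda>\<omega>. \<bar>?f0 \<omega>\<bar>\<^sup>2)" using f2 by simp
      show "integrable M (\<lambda>\<omega>. ((?f0 \<omega>)\<^sup>2)\<^sup>2)" using f4 by simp
      show "random_variable borel (\<lambda>\<omega>. \<bar>?f0 \<omega>\<bar>)" "random_variable borel (\<lambda>\<omega>. (?f0 \<omega>)\<^sup>2)"
        using f0m by measurable
    qed
    moreover have "\<bar>y\<bar> * y\<^sup>2 = \<bar>y\<bar> ^ 3" for y :: real by (simp add: power3_eq_cube power2_eq_square mult.assoc)
    ultimately show ?thesis by (simp only:)
  qed
  have f1: "integrable M ?f0" by (rule integrable_of_square[OF f0m f2])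
  let ?\<delta> = "\<lambda>t. expectation (\<lambda>\<omega>. \<bar>1 / aprob t \<omega> a - 1 / q (X t \<omega>)\<bar> * (score_at f t \<omega>)\<^sup>2)"
  have inv: "AE \<omega> in M. \<bar>1 / aprob t \<omega> a - 1 / q (X t \<omega>)\<bar> \<le> \<bar>aprob t \<omega> a - q (X t \<omega>)\<bar> / \<pi>min\<^sup>2 \<and> \<bar>1 / q (X t \<omega>)\<bar> \<le> 1 / \<pi>min \<and> \<bar>1 / aprob t \<omega> a\<bar> \<le> 1 / \<pi>min"
    if t: "t \<ge> 1" for t
    using aprob_ge[OF t] q_ge(1)[OF t]
  proof eventually_elim
    case (elim \<omega>)
    then show ?case by (rule inverse_diff_bound[OF \<pi>min_pos])
  qed
  have fq2m: "(\<lambda>z. (f z)\<^sup>2) \<in> borel_measurable (borel \<Otimes>\<^sub>M borel)" "(\<lambda>z. (f z) ^ 4) \<in> borel_measurable (borel \<Otimes>\<^sub>M borel)"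
    using f by measurable
  have s24: "integrable M (\<lambda>\<omega>. (score_at f t \<omega>)\<^sup>2)" "integrable M (\<lambda>\<omega>. (score_at f t \<omega>) ^ 4)"
    "expectation (\<lambda>\<omega>. (score_at f t \<omega>) ^ 4) = expectation (\<lambda>\<omega>. (?f0 \<omega>) ^ 4)" if t: "t \<ge> 1" for t
    using score_at_transfer[OF fq2m(1) t] score_at_transfer[OF fq2m(2) t] f2 f4 by simp_all
  have dif_int: "integrable M (\<lambda>\<omega>. \<bar>1 / aprob t \<omega> a - 1 / q (X t \<omega>)\<bar> * (score_at f t \<omega>)\<^sup>2)" if t: "t \<ge> 1" for t
  proof -
    note [measurable] = action_prob_rv[OF t] context_rv[OF t] score_at_rv[OF f t]
    show ?thesis
    proof (rule Bochner_Integration.integrable_bound[of _ "\<lambda>\<omega>. 2 / \<pi>min * (score_at f t \<omega>)\<^sup>2"])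
      show "integrable M (\<lambda>\<omega>. 2 / \<pi>min * (score_at f t \<omega>)\<^sup>2)" using s24(1)[OF t] by simp
      show "AE \<omega> in M. norm (\<bar>1 / aprob t \<omega> a - 1 / q (X t \<omega>)\<bar> * (score_at f t \<omega>)\<^sup>2) \<le> norm (2 / \<pi>min * (score_at f t \<omega>)\<^sup>2)"
        using inv[OF t]
      proof eventually_elim
        case (elim \<omega>)
        then have "\<bar>1 / aprob t \<omega> a - 1 / q (X t \<omega>)\<bar> \<le> 2 / \<pi>min" by linarith
        then have "\<bar>1 / aprob t \<omega> a - 1 / q (X t \<omega>)\<bar> \<le> \<bar>2 / \<pi>min\<bar>" by linarith
        then show ?case unfolding abs_mult real_norm_def abs_abs by (intro mult_right_mono) auto
      qed
      show "random_variable borel (\<lambda>\<omega>. \<bar>1 / aprob t \<omega> a - 1 / q (X t \<omega>)\<bar> * (score_at f t \<omega>)\<^sup>2)" by measurable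
    qed
  qed
  have \<delta>_nonneg: "0 \<le> ?\<delta> t" for t by (intro Bochner_Integration.integral_nonneg) auto
  have \<delta>_lim: "?\<delta> \<longlonglongrightarrow> 0"
  proof (rule LIMSEQ_I)
    fix r :: real assume r: "0 < r"
    define K where "K = expectation (\<lambda>\<omega>. (?f0 \<omega>) ^ 4) + 1"
    have K: "K > 0" unfolding K_def by (intro add_nonneg_pos Bochner_Integration.integral_nonneg) auto
    \<comment> \<open>Splits the target \<open>r\<close> in half: \<open>\<eta> * K\<close> is
      \<open>r / 2\<close>, and the other half comes from the mean distance of the propensities,
      which is below \<open>\<eta> * \<pi>min^4 * r / 2\<close> for large \<open>t\<close>.\<close>
    define \<eta> where "\<eta> = r / (2 * K)"
    have \<eta>: "\<eta> > 0" using r K by (simp add: \<eta>_def)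
    have dm: "random_variable borel (\<lambda>\<omega>. aprob t \<omega> a - q (X t \<omega>))" if t: "t \<ge> 1" for t
      by (intro borel_measurable_diff borel_measurable_vec_component action_prob_rv[OF t] measurable_compose[OF context_rv[OF t] q(1)])
    have d1: "\<bar>aprob t \<omega> a - q (X t \<omega>)\<bar> \<le> 1" if t: "t \<ge> 1" "\<omega> \<in> space M" for t \<omega>
      using aprob_bounds[OF t, of a] q(2,3)[OF context_mem[OF t]] by linarith
    have "(\<lambda>t. expectation (\<lambda>\<omega>. \<bar>aprob t \<omega> a - q (X t \<omega>)\<bar>)) \<longlonglongrightarrow> 0"
      by (rule expectation_tendsto_zero_bounded[OF dm conv d1])
    moreover have "0 < \<eta> * \<pi>min^4 * r / 2" using \<eta> r \<pi>min_pos by simp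
    ultimately obtain n0 where n0': "\<forall>t\<ge>n0. norm (expectation (\<lambda>\<omega>. \<bar>aprob t \<omega> a - q (X t \<omega>)\<bar>) - 0) < \<eta> * \<pi>min^4 * r / 2"
      using LIMSEQ_D by blast
    have n0: "expectation (\<lambda>\<omega>. \<bar>aprob t \<omega> a - q (X t \<omega>)\<bar>) < \<eta> * \<pi>min^4 * r / 2" if "t \<ge> n0" for t
      using n0'[rule_format, OF that] unfolding real_norm_def diff_0_right by linarith
    have "norm (?\<delta> t - 0) < r" if t: "t \<ge> max n0 1" for t
    proof -
      have t1: "t \<ge> 1" using t by simp
      have di: "integrable M (\<lambda>\<omega>. \<bar>aprob t \<omega> a - q (X t \<omega>)\<bar>)"
        using dm[OF t1] d1[OF t1] by (intro integrable_const_bound[of _ 1]) auto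
        have gi: "integrable M (\<lambda>\<omega>. \<eta> * (score_at f t \<omega>) ^ 4 + \<bar>aprob t \<omega> a - q (X t \<omega>)\<bar> * (1 / (\<eta> * \<pi>min^4)))"
          by (intro Bochner_Integration.integrable_add integrable_mult_right integrable_mult_left s24(2)[OF t1] di)
        have bd: "AE \<omega> in M. \<bar>1 / aprob t \<omega> a - 1 / q (X t \<omega>)\<bar> * (score_at f t \<omega>)\<^sup>2 \<le> \<eta> * (score_at f t \<omega>) ^ 4 + \<bar>aprob t \<omega> a - q (X t \<omega>)\<bar> * (1 / (\<eta> * \<pi>min^4))"
          using inv[OF t1] AE_space
        proof eventually_elim
          case (elim \<omega>)
          show ?case
            by (rule weighted_young[OF \<eta> \<pi>min_pos _ conjunct1[OF elim(1)] _ d1[OF t1 elim(2)]]) (rule abs_ge_zero)+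
        qed
      have "?\<delta> t \<le> expectation (\<lambda>\<omega>. \<eta> * (score_at f t \<omega>) ^ 4 + \<bar>aprob t \<omega> a - q (X t \<omega>)\<bar> * (1 / (\<eta> * \<pi>min^4)))"
        by (rule integral_mono_AE[OF dif_int[OF t1] gi bd])
      also have "\<dots> = \<eta> * expectation (\<lambda>\<omega>. (?f0 \<omega>) ^ 4) + expectation (\<lambda>\<omega>. \<bar>aprob t \<omega> a - q (X t \<omega>)\<bar>) * (1 / (\<eta> * \<pi>min^4))"
        using s24[OF t1] di by (subst Bochner_Integration.integral_add) auto
      also have "\<dots> < \<eta> * K + \<eta> * \<pi>min^4 * r / 2 * (1 / (\<eta> * \<pi>min^4))"
        using n0[of t] t \<eta> \<pi>min_pos by (intro add_strict_mono mult_strict_left_mono mult_strict_right_mono) (auto simp: K_def)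
      also have "\<dots> = r"
      proof -
        have "\<eta> * K = r / 2" using K by (simp add: \<eta>_def)
        moreover have "\<eta> * \<pi>min^4 * r / 2 * (1 / (\<eta> * \<pi>min^4)) = r / 2" using \<eta> \<pi>min_pos by simp
        ultimately show ?thesis by simp
      qed
      finally show ?thesis using \<delta>_nonneg[of t] by simp
    qed
    then show "\<exists>no. \<forall>t\<ge>no. norm (?\<delta> t - 0) < r" by (intro exI[of _ "max n0 1"] allI impI)
  qed
  have \<sigma>2i: "integrable M (\<lambda>\<omega>. 1 / q (X0 \<omega>) * (?f0 \<omega>)\<^sup>2)"
  proof (rule Bochner_Integration.integrable_bound[of _ "\<lambda>\<omega>. 1 / \<pi>min * (?f0 \<omega>)\<^sup>2"])
    show "integrable M (\<lambda>\<omega>. 1 / \<pi>min * (?f0 \<omega>)\<^sup>2)" using f2 by simp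
    show "AE \<omega> in M. norm (1 / q (X0 \<omega>) * (?f0 \<omega>)\<^sup>2) \<le> norm (1 / \<pi>min * (?f0 \<omega>)\<^sup>2)"
      using q_ge(2)
    proof eventually_elim
      case (elim \<omega>)
      then have "\<bar>1 / q (X0 \<omega>)\<bar> \<le> \<bar>1 / \<pi>min\<bar>" using \<pi>min_pos by (simp add: frac_le)
      then show ?case unfolding real_norm_def abs_mult by (intro mult_right_mono) auto
    qed
    show "random_variable borel (\<lambda>\<omega>. 1 / q (X0 \<omega>) * (?f0 \<omega>)\<^sup>2)" by measurable
  qed
  have \<sigma>2_nonneg: "0 \<le> \<sigma>2" unfolding \<sigma>2_def
    using q(2) generic_context_mem by (intro Bochner_Integration.integral_nonneg mult_nonneg_nonneg) auto
  show ?thesis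
  proof (rule martingale_char_tendsto[where \<delta> = ?\<delta> and C = "(1 / \<pi>min) ^ 3 * expectation (\<lambda>\<omega>. \<bar>?f0 \<omega>\<bar> ^ 3)"])
    fix t :: nat and v :: real assume t: "1 \<le> t"
    show "random_variable borel (\<lambda>\<omega>. ipw t \<omega> * score_at f t \<omega>)" by (rule ipw_term_rv[OF f t])
    show "integrable M (\<lambda>\<omega>. \<bar>ipw t \<omega> * score_at f t \<omega>\<bar> ^ 3)" by (rule ipw_moment[OF f t f3])
    show "expectation (\<lambda>\<omega>. \<bar>ipw t \<omega> * score_at f t \<omega>\<bar> ^ 3) \<le> (1 / \<pi>min) ^ 3 * expectation (\<lambda>\<omega>. \<bar>?f0 \<omega>\<bar> ^ 3)" by (rule ipw_moment[OF f t f3])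
    obtain F where F: "F \<in> borel_measurable (hist_space (t - 1))" "\<And>\<omega>. F (hist (t - 1) \<omega>) = (\<Sum>s=1..t-1. ipw s \<omega> * score_at f s \<omega>)"
      using ipw_sum_factor[OF f, of "t - 1" 0] by auto
    \<comment> \<open>\<open>F\<close> writes the past partial sum as a function of the history
      (centring constant 0), so the identities for history test functions apply to this unimodular
      \<open>h\<close>.\<close>
    define h where "h z = cis (v * F z)" for z
    have hm: "h \<in> borel_measurable (hist_space (t - 1))" unfolding h_def using F(1) by measurable
    have hh: "h (hist (t - 1) \<omega>) = cis (v * (\<Sum>s=1..t-1. ipw s \<omega> * score_at f s \<omega>))" for \<omega>
      by (simp add: h_def F(2))
    have h1: "cmod (h z) = 1" for z by (simp add: h_def)
    have hm'[measurable]: "(\<lambda>\<omega>. h (hist (t - 1) \<omega>)) \<in> borel_measurable M" by (rule measurable_compose[OF history_rv hm])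
    have hi: "integrable M (\<lambda>\<omega>. h (hist (t - 1) \<omega>))" by (rule integrable_const_bound[of _ 1]) (auto simp: h1)
    show "(CLINT \<omega>|M. cis (v * (\<Sum>s=1..t-1. ipw s \<omega> * score_at f s \<omega>)) * complex_of_real (ipw t \<omega> * score_at f t \<omega>)) = 0"
      using expectation_history_ipw[OF f t hm hi f1] mean unfolding hh by simp
    note [measurable] = action_prob_rv[OF t] context_rv[OF t] score_at_rv[OF f t] ipw_term_rv[OF f t]
    let ?H = "\<lambda>\<omega>. h (hist (t - 1) \<omega>)" and ?s = "\<lambda>\<omega>. (score_at f t \<omega>)\<^sup>2"
    have b: "integrable M (\<lambda>\<omega>. ?H \<omega> * complex_of_real (w \<omega>))" if "integrable M w" for w
      using that by (rule Bochner_Integration.integrable_bound) (use that in \<open>auto simp: norm_mult h1\<close>)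
    have iq: "integrable M (\<lambda>\<omega>. (ipw t \<omega> * score_at f t \<omega>)\<^sup>2)"
      using ipw_moment(1)[OF f t, of 2] f2 by (simp del: power_mult_distrib)
    have ip: "integrable M (\<lambda>\<omega>. 1 / aprob t \<omega> a * ?s \<omega>)" "integrable M (\<lambda>\<omega>. 1 / q (X t \<omega>) * ?s \<omega>)"
    proof -
      have bound: "integrable M (\<lambda>\<omega>. w \<omega> * ?s \<omega>)"
        if "AE \<omega> in M. \<bar>w \<omega>\<bar> \<le> 1 / \<pi>min" and [measurable]: "random_variable borel w" for w
      proof (rule Bochner_Integration.integrable_bound)
        show "integrable M (\<lambda>\<omega>. 1 / \<pi>min * ?s \<omega>)" using s24(1)[OF t] by (rule integrable_mult_right)
        show "AE \<omega> in M. norm (w \<omega> * ?s \<omega>) \<le> norm (1 / \<pi>min * ?s \<omega>)"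
          using that(1)
        proof eventually_elim
          case (elim \<omega>)
          then have "\<bar>w \<omega>\<bar> \<le> \<bar>1 / \<pi>min\<bar>" by linarith
          then show ?case unfolding real_norm_def abs_mult by (intro mult_right_mono) auto
        qed
      qed measurable
      show "integrable M (\<lambda>\<omega>. 1 / aprob t \<omega> a * ?s \<omega>)"
        by (rule bound) (use inv[OF t] in \<open>eventually_elim, simp only:\<close>, measurable)
      show "integrable M (\<lambda>\<omega>. 1 / q (X t \<omega>) * ?s \<omega>)"
        by (rule bound) (use inv[OF t] in \<open>eventually_elim, simp only:\<close>, measurable)
    qed
    have sq: "(CLINT \<omega>|M. ?H \<omega> * of_real ((ipw t \<omega> * score_at f t \<omega>)\<^sup>2)) = (CLINT \<omega>|M. ?H \<omega> * of_real (1 / aprob t \<omega> a * ?s \<omega>))"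
    proof -
      let ?F = "\<lambda>z. h (fst (fst z)) * complex_of_real ((f (snd (fst z), snd z $ a))\<^sup>2)"
      have F: "?F \<in> borel_measurable (hcy_space t)"
        by (intro borel_measurable_times measurable_compose[OF _ borel_measurable_of_real] borel_measurable_power measurable_compose[OF _ hm] measurable_compose[OF _ f]) measurable
      have "(CLINT \<omega>|M. ?H \<omega> * of_real ((ipw t \<omega> * score_at f t \<omega>)\<^sup>2)) = (CLINT \<omega>|M. (ipw t \<omega>)\<^sup>2 *\<^sub>R ?F (hcy t \<omega>))"
        by (intro Bochner_Integration.integral_cong) (auto simp: scaleR_conv_of_real power_mult_distrib)
      also have "\<dots> = (CLINT \<omega>|M. ?H \<omega> * of_real (1 / aprob t \<omega> a * ?s \<omega>))"
        unfolding expectation_ipw_square[OF t F] by (intro Bochner_Integration.integral_cong) (auto simp: scaleR_conv_of_real)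
      finally show ?thesis .
    qed
    \<comment> \<open>Unlike the actual propensity, \<open>q\<close> sees only the fresh context, so
      the integrand is independent of the history.\<close>
    have indep: "(CLINT \<omega>|M. ?H \<omega> * of_real (1 / q (X t \<omega>) * ?s \<omega>)) = (CLINT \<omega>|M. ?H \<omega>) * of_real \<sigma>2"
    proof -
      let ?g = "\<lambda>z :: (real^'p) \<times> (real^'k). complex_of_real (1 / q (fst z) * (f (fst z, snd z $ a))\<^sup>2)"
      have g: "?g \<in> borel_measurable (borel \<Otimes>\<^sub>M borel)"
        using measurable_outcome_component[OF fq2m(1)] by measurable
      have gi: "integrable M (\<lambda>\<omega>. ?g (X0 \<omega>, Y0 \<omega>))" using \<sigma>2i by (simp only: fst_conv snd_conv complex_of_real_integrable_eq)
      have "(CLINT \<omega>|M. ?H \<omega> * ?g (X t \<omega>, Y t \<omega>)) = (CLINT \<omega>|M. ?H \<omega>) * (CLINT \<omega>|M. ?g (X0 \<omega>, Y0 \<omega>))"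
        by (rule expectation_history_tuple[OF hm g t hi gi])
      then show ?thesis unfolding \<sigma>2_def fst_conv snd_conv integral_complex_of_real .
    qed
    have "(CLINT \<omega>|M. ?H \<omega> * complex_of_real ((ipw t \<omega> * score_at f t \<omega>)\<^sup>2 - \<sigma>2)) =
       (CLINT \<omega>|M. ?H \<omega> * of_real ((ipw t \<omega> * score_at f t \<omega>)\<^sup>2)) - (CLINT \<omega>|M. ?H \<omega>) * of_real \<sigma>2"
      by (simp only: of_real_diff right_diff_distrib Bochner_Integration.integral_diff[OF b[OF iq] integrable_mult_left[OF hi]] integral_mult_left_zero)
    also have "\<dots> = (CLINT \<omega>|M. ?H \<omega> * of_real (1 / aprob t \<omega> a * ?s \<omega>)) - (CLINT \<omega>|M. ?H \<omega> * of_real (1 / q (X t \<omega>) * ?s \<omega>))"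
      unfolding sq indep ..
    also have "\<dots> = (CLINT \<omega>|M. ?H \<omega> * of_real (1 / aprob t \<omega> a * ?s \<omega>) - ?H \<omega> * of_real (1 / q (X t \<omega>) * ?s \<omega>))"
      by (rule Bochner_Integration.integral_diff[symmetric]) (intro b ip)+
    finally have eq: "(CLINT \<omega>|M. ?H \<omega> * complex_of_real ((ipw t \<omega> * score_at f t \<omega>)\<^sup>2 - \<sigma>2)) =
      (CLINT \<omega>|M. ?H \<omega> * of_real (1 / aprob t \<omega> a * ?s \<omega>) - ?H \<omega> * of_real (1 / q (X t \<omega>) * ?s \<omega>))" .
    have "cmod (CLINT \<omega>|M. ?H \<omega> * complex_of_real ((ipw t \<omega> * score_at f t \<omega>)\<^sup>2 - \<sigma>2)) \<le>
      (LINT \<omega>|M. cmod (?H \<omega> * of_real (1 / aprob t \<omega> a * ?s \<omega>) - ?H \<omega> * of_real (1 / q (X t \<omega>) * ?s \<omega>)))"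
      unfolding eq by (rule integral_norm_bound)
    also have "\<dots> = ?\<delta> t"
    proof (intro Bochner_Integration.integral_cong refl)
      fix \<omega>
      have "?H \<omega> * of_real (1 / aprob t \<omega> a * ?s \<omega>) - ?H \<omega> * of_real (1 / q (X t \<omega>) * ?s \<omega>) = ?H \<omega> * of_real ((1 / aprob t \<omega> a - 1 / q (X t \<omega>)) * ?s \<omega>)"
        by (simp only: left_diff_distrib of_real_diff right_diff_distrib)
      then show "cmod (?H \<omega> * of_real (1 / aprob t \<omega> a * ?s \<omega>) - ?H \<omega> * of_real (1 / q (X t \<omega>) * ?s \<omega>)) = \<bar>1 / aprob t \<omega> a - 1 / q (X t \<omega>)\<bar> * ?s \<omega>"
        by (simp only: norm_mult h1 norm_of_real abs_mult) simp
    qed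
    finally show "cmod (CLINT \<omega>|M. cis (v * (\<Sum>s=1..t-1. ipw s \<omega> * score_at f s \<omega>)) * complex_of_real ((ipw t \<omega> * score_at f t \<omega>)\<^sup>2 - \<sigma>2)) \<le> ?\<delta> t"
      unfolding hh .
  qed (rule \<delta>_nonneg \<delta>_lim \<sigma>2_nonneg)+
qed

end

section \<open>Z-estimation\<close>

lemma spectral_norm_mult: "norm (B *v x) \<le> spectral_norm B * norm x"
  unfolding spectral_norm_def by (rule onorm) (rule matrix_vector_mul_bounded_linear)

lemma spectral_norm_nonneg: "0 \<le> spectral_norm B"
  unfolding spectral_norm_def by (rule onorm_pos_le) (rule matrix_vector_mul_bounded_linear)

lemma matrix_entry_le_spectral_norm:
  fixes B :: "real^'n^'m" shows "\<bar>B $ i $ j\<bar> \<le> spectral_norm B"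
proof -
  have "\<bar>B $ i $ j\<bar> = \<bar>(B *v axis j 1) $ i\<bar>" by (simp add: matrix_vector_mult_basis column_def)
  also have "\<dots> \<le> norm (B *v axis j 1)" by (rule component_le_norm_cart)
  also have "\<dots> \<le> spectral_norm B * norm (axis j (1::real))" by (rule spectral_norm_mult)
  finally show ?thesis by simp
qed

lemma norm_matrix_mult_le_entries:
  fixes B :: "real^'n^'m" shows "norm (B *v x) \<le> (\<Sum>i\<in>UNIV. \<Sum>j\<in>UNIV. \<bar>B $ i $ j\<bar>) * norm x"
proof -
  have "norm (B *v x) \<le> (\<Sum>i\<in>UNIV. \<bar>(B *v x) $ i\<bar>)" by (rule norm_le_l1_cart)
  also have "\<dots> \<le> (\<Sum>i\<in>UNIV. \<Sum>j\<in>UNIV. \<bar>B $ i $ j\<bar> * norm x)"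
  proof (intro sum_mono)
    fix i
    have "\<bar>(B *v x) $ i\<bar> \<le> (\<Sum>j\<in>UNIV. \<bar>B $ i $ j * x $ j\<bar>)"
      by (simp add: matrix_vector_mult_def sum_abs)
    also have "\<dots> \<le> (\<Sum>j\<in>UNIV. \<bar>B $ i $ j\<bar> * norm x)"
      unfolding abs_mult by (intro sum_mono mult_left_mono component_le_norm_cart) auto
    finally show "\<bar>(B *v x) $ i\<bar> \<le> (\<Sum>j\<in>UNIV. \<bar>B $ i $ j\<bar> * norm x)" .
  qed
  finally show ?thesis by (simp add: sum_distrib_right)
qed

lemma jacobian_bound_lipschitz:
  fixes f :: "real^'n \<Rightarrow> real^'m"
  assumes d: "\<And>\<theta>. f differentiable (at \<theta>)"
    and B: "\<And>\<theta>. norm \<theta> \<le> R \<Longrightarrow> spectral_norm (jacobian f (at \<theta>)) \<le> B"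
    and "norm \<theta> \<le> R" "norm \<theta>' \<le> R"
  shows "norm (f \<theta> - f \<theta>') \<le> B * norm (\<theta> - \<theta>')"
proof (rule differentiable_bound[of "cball 0 R" f "\<lambda>\<theta> h. jacobian f (at \<theta>) *v h"])
  show "(f has_derivative (\<lambda>h. jacobian f (at x) *v h)) (at x within cball 0 R)" for x
    using d[of x] unfolding jacobian_works by (rule has_derivative_at_withinI)
  show "onorm (\<lambda>h. jacobian f (at x) *v h) \<le> B" if "x \<in> cball 0 R" for x
    using B[of x] that by (simp add: spectral_norm_def)
qed (use assms in auto)

text \<open>\<open>hessian\<close> is built from \<open>gradient\<close>, whereas
  \<open>twice_differentiable\<close> speaks of the Jacobian. Identifying the gradient of a
  component with a row of the Jacobian makes the Hessian of that component the derivative of the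
  row.\<close>

lemma gradient_component:
  fixes f :: "real^'n \<Rightarrow> real^'m"
  assumes d: "\<And>\<theta>. f differentiable (at \<theta>)"
  shows "gradient (\<lambda>\<theta>. f \<theta> $ i) = (\<lambda>\<theta>. jacobian f (at \<theta>) $ i)"
    and "((\<lambda>\<theta>. f \<theta> $ i) has_derivative (\<lambda>h. jacobian f (at \<theta>) $ i \<bullet> h)) (at \<theta>)"
proof -
  have der: "((\<lambda>\<theta>. f \<theta> $ i) has_derivative (\<lambda>h. jacobian f (at \<theta>) $ i \<bullet> h)) (at \<theta>)" for \<theta>
  proof -
    have "((\<lambda>\<theta>. f \<theta> $ i) has_derivative (\<lambda>h. (jacobian f (at \<theta>) *v h) $ i)) (at \<theta>)"
      using d[of \<theta>] unfolding jacobian_works by (rule bounded_linear.has_derivative[OF bounded_linear_vec_nth])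
    then show ?thesis by (simp only: matrix_vector_mul_component)
  qed
  then show "((\<lambda>\<theta>. f \<theta> $ i) has_derivative (\<lambda>h. jacobian f (at \<theta>) $ i \<bullet> h)) (at \<theta>)" .
  show "gradient (\<lambda>\<theta>. f \<theta> $ i) = (\<lambda>\<theta>. jacobian f (at \<theta>) $ i)"
  proof
    fix \<theta>
    have "frechet_derivative (\<lambda>\<theta>. f \<theta> $ i) (at \<theta>) = (\<lambda>h. jacobian f (at \<theta>) $ i \<bullet> h)"
      using frechet_derivative_at[OF der] by simp
    then show "gradient (\<lambda>\<theta>. f \<theta> $ i) \<theta> = jacobian f (at \<theta>) $ i"
      by (simp add: gradient_def vec_eq_iff inner_axis)
  qed
qed

text \<open>The mean value inequality is applied twice: the Hessian bound makes each row of the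
  Jacobian Lipschitz at \<open>\<theta>0\<close> on the ball, and a component minus its linear part
  then has a derivative of size at most \<open>B * ?r\<close>. The factor \<open>CARD('m)\<close>
  comes from bounding the norm by the sum of the components.\<close>

lemma second_order_remainder:
  fixes f :: "real^'n \<Rightarrow> real^'m"
  assumes td: "twice_differentiable f"
    and B: "\<And>\<theta> i. norm (\<theta> - \<theta>0) \<le> \<epsilon> \<Longrightarrow> spectral_norm (hessian (\<lambda>\<theta>'. f \<theta>' $ i) \<theta>) \<le> B"
    and \<theta>: "norm (\<theta> - \<theta>0) \<le> \<epsilon>"
  shows "norm (f \<theta> - f \<theta>0 - jacobian f (at \<theta>0) *v (\<theta> - \<theta>0)) \<le> real CARD('m) * B * (norm (\<theta> - \<theta>0))\<^sup>2"
proof -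
  have d: "f differentiable (at t)" "(\<lambda>t. jacobian f (at t)) differentiable (at t)" for t
    using td by (auto simp: twice_differentiable_def)
  let ?r = "norm (\<theta> - \<theta>0)"
  have "0 \<le> ?r" by simp
  have sub: "norm (t - \<theta>0) \<le> \<epsilon>" if "t \<in> cball \<theta>0 ?r" for t
    using that \<theta> by (simp add: dist_norm norm_minus_commute)
  have comp: "\<bar>(f \<theta> - f \<theta>0 - jacobian f (at \<theta>0) *v (\<theta> - \<theta>0)) $ i\<bar> \<le> B * ?r\<^sup>2" for i
  proof -
    let ?G = "\<lambda>t. jacobian f (at t) $ i"
    note gc = gradient_component[of f i, OF d(1)]
    have dG: "?G differentiable (at t)" for t
      using d(2)[of t] by (rule differentiable_compose[of "\<lambda>A. A $ i", rotated, unfolded o_def])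
         (intro bounded_linear_imp_differentiable bounded_linear_vec_nth)
    have G_lip: "norm (?G t - ?G \<theta>0) \<le> B * ?r" if t: "t \<in> cball \<theta>0 ?r" for t
    proof -
      have "norm (?G t - ?G \<theta>0) \<le> B * norm (t - \<theta>0)"
      proof (rule differentiable_bound[of "cball \<theta>0 ?r" ?G "\<lambda>t h. hessian (\<lambda>\<theta>'. f \<theta>' $ i) t *v h"])
        show "(?G has_derivative (\<lambda>h. hessian (\<lambda>\<theta>'. f \<theta>' $ i) x *v h)) (at x within cball \<theta>0 ?r)" for x
          unfolding hessian_def gc(1) using dG[of x] unfolding jacobian_works by (rule has_derivative_at_withinI)
        show "onorm (\<lambda>h. hessian (\<lambda>\<theta>'. f \<theta>' $ i) x *v h) \<le> B" if "x \<in> cball \<theta>0 ?r" for x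
          using B[OF sub[OF that], of i] by (simp add: spectral_norm_def)
      qed (use t in auto)
      also have "\<dots> \<le> B * ?r"
      proof (rule mult_left_mono)
        show "norm (t - \<theta>0) \<le> ?r" using t by (simp add: dist_norm norm_minus_commute)
        show "0 \<le> B" using order_trans[OF spectral_norm_nonneg B[OF \<theta>]] .
      qed
      finally show ?thesis .
    qed
    \<comment> \<open>Removing the linear part at \<open>\<theta>0\<close> leaves a function whose
      derivative vanishes there and is controlled by \<open>G_lip\<close> on the ball.\<close>
    define F where "F t = f t $ i - ?G \<theta>0 \<bullet> t" for t
    have "norm (F \<theta> - F \<theta>0) \<le> (B * ?r) * norm (\<theta> - \<theta>0)"
    proof (rule differentiable_bound[of "cball \<theta>0 ?r" F "\<lambda>t h. (?G t - ?G \<theta>0) \<bullet> h"])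
      show "(F has_derivative (\<lambda>h. (?G x - ?G \<theta>0) \<bullet> h)) (at x within cball \<theta>0 ?r)" for x
        unfolding F_def inner_diff_left
        by (intro has_derivative_diff has_derivative_at_withinI[OF gc(2)] has_derivative_inner_right has_derivative_ident)
      show "onorm (\<lambda>h. (?G x - ?G \<theta>0) \<bullet> h) \<le> B * ?r" if "x \<in> cball \<theta>0 ?r" for x
      proof (rule onorm_le)
        fix h
        have "norm ((?G x - ?G \<theta>0) \<bullet> h) \<le> norm (?G x - ?G \<theta>0) * norm h"
          unfolding real_norm_def by (rule Cauchy_Schwarz_ineq2)
        also have "\<dots> \<le> B * ?r * norm h" by (intro mult_right_mono G_lip[OF that]) simp
        finally show "norm ((?G x - ?G \<theta>0) \<bullet> h) \<le> B * ?r * norm h" .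
      qed
    qed (auto simp: dist_norm norm_minus_commute)
    moreover have "F \<theta> - F \<theta>0 = (f \<theta> - f \<theta>0 - jacobian f (at \<theta>0) *v (\<theta> - \<theta>0)) $ i"
      by (simp add: F_def matrix_vector_mul_component inner_diff_right)
    ultimately show ?thesis by (simp add: power2_eq_square mult.assoc)
  qed
  have "norm (f \<theta> - f \<theta>0 - jacobian f (at \<theta>0) *v (\<theta> - \<theta>0)) \<le> (\<Sum>i\<in>UNIV. \<bar>(f \<theta> - f \<theta>0 - jacobian f (at \<theta>0) *v (\<theta> - \<theta>0)) $ i\<bar>)"
    by (rule norm_le_l1_cart)
  also have "\<dots> \<le> (\<Sum>i\<in>(UNIV :: 'm set). B * ?r\<^sup>2)" by (intro sum_mono comp)
  finally show ?thesis by simp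
qed

lemma borel_measurable_vec_lambda:
  fixes f :: "'n::finite \<Rightarrow> 'x \<Rightarrow> real"
  assumes "\<And>i. f i \<in> borel_measurable N"
  shows "(\<lambda>x. \<chi> i. f i x) \<in> borel_measurable N"
  unfolding borel_measurable_euclidean_space[of "\<lambda>x. \<chi> i. f i x"]
  using assms by (auto simp: Basis_vec_def inner_axis)

section \<open>Borel versions of the score and of the limit policy, and limits at a fixed
  parameter\<close>

locale ipw_z_estimation = ipw_bandit M XX X Y A \<pi> X0 Y0 a \<pi>min
  for M :: "'w measure" and XX :: "(real^'p::finite) set" and X :: "nat \<Rightarrow> 'w \<Rightarrow> real^'p"
    and Y :: "nat \<Rightarrow> 'w \<Rightarrow> real^'k::finite" and A :: "nat \<Rightarrow> 'w \<Rightarrow> 'k" and \<pi> :: "('p, 'k) policies"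
    and X0 :: "'w \<Rightarrow> real^'p" and Y0 :: "'w \<Rightarrow> real^'k" and a :: 'k and \<pi>min :: real +
  fixes g :: "('p, 'd::finite) score" and \<theta>s :: "real^'d" and R \<epsilon>0 :: real
    and \<phi> \<Phi> :: "real^'p \<Rightarrow> real \<Rightarrow> real" and \<pi>bar :: "real^'p \<Rightarrow> real^'k"
  assumes g_measurable: "\<And>\<theta>. (\<lambda>(x, y). g x y \<theta>) \<in> borel_measurable (restrict_space borel XX \<Otimes>\<^sub>M borel)"
    and root: "(\<integral>\<omega>. g (X0 \<omega>) (Y0 \<omega> $ a) \<theta>s \<partial>M) = 0"
    and well_separated: "\<And>\<epsilon>. \<epsilon> > 0 \<Longrightarrow>
         (INF \<theta>\<in>{\<theta>. norm (\<theta> - \<theta>s) > \<epsilon>}. norm (\<integral>\<omega>. g (X0 \<omega>) (Y0 \<omega> $ a) \<theta> \<partial>M)) > 0"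
    and \<theta>s_bound: "norm \<theta>s < R"
    and second_moment:
      "(SUP \<theta>\<in>{\<theta>. norm \<theta> \<le> R}. \<integral>\<^sup>+\<omega>. ennreal ((norm (g (X0 \<omega>) (Y0 \<omega> $ a) \<theta>))\<^sup>2) \<partial>M) < \<infinity>"
    and fourth_moment: "integrable M (\<lambda>\<omega>. norm (g (X0 \<omega>) (Y0 \<omega> $ a) \<theta>s) ^ 4)"
    and twice_diff: "\<And>x y. x \<in> XX \<Longrightarrow> twice_differentiable (g x y)"
    and nonsingular: "invertible (score_jacobian M X0 Y0 a g \<theta>s)"
    and \<phi>_measurable: "(\<lambda>(x, y). \<phi> x y) \<in> borel_measurable (borel \<Otimes>\<^sub>M borel)"
    and \<phi>_bound:
      "\<And>x y \<theta>. x \<in> XX \<Longrightarrow> norm \<theta> \<le> R \<Longrightarrow> spectral_norm (jacobian (g x y) (at \<theta>)) \<le> \<phi> x y"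
    and \<phi>_moment: "integrable M (\<lambda>\<omega>. (\<phi> (X0 \<omega>) (Y0 \<omega> $ a))\<^sup>2)"
    and \<epsilon>0_pos: "\<epsilon>0 > 0"
    and \<Phi>_measurable: "(\<lambda>(x, y). \<Phi> x y) \<in> borel_measurable (borel \<Otimes>\<^sub>M borel)"
    and \<Phi>_bound:
      "\<And>x y \<theta> i. x \<in> XX \<Longrightarrow> norm (\<theta> - \<theta>s) \<le> \<epsilon>0 \<Longrightarrow>
         spectral_norm (hessian (\<lambda>\<theta>'. g x y \<theta>' $ i) \<theta>) \<le> \<Phi> x y"
    and \<Phi>_moment: "integrable M (\<lambda>\<omega>. \<Phi> (X0 \<omega>) (Y0 \<omega> $ a))"
    and \<pi>bar_measurable: "\<pi>bar \<in> borel_measurable (restrict_space borel XX)"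
    and \<pi>bar_simplex: "\<And>x. x \<in> XX \<Longrightarrow> \<pi>bar x \<in> prob_simplex"
    and policy_converges: "tendsto_zero_in_prob M (\<lambda>t \<omega>. aprob t \<omega> a - \<pi>bar (X t \<omega>) $ a)"
begin

abbreviation "score_mean \<theta> \<equiv> (\<integral>\<omega>. g (X0 \<omega>) (Y0 \<omega> $ a) \<theta> \<partial>M)"
abbreviation "G T \<theta> \<omega> \<equiv> weighted_score \<pi> X Y A a g T \<theta> \<omega>"
abbreviation "J \<equiv> score_jacobian M X0 Y0 a g \<theta>s"
abbreviation "score_jac x y \<equiv> jacobian (g x y) (at \<theta>s)"

text \<open>As the context space need not be Borel, \<open>g\<close>, its Jacobian at \<open>\<theta>s\<close> and the limit
  policy are replaced by Borel functions agreeing with them on it.\<close>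

definition g_ext :: "real^'d \<Rightarrow> (real^'p) \<times> real \<Rightarrow> real^'d" where
  "g_ext \<theta> = (SOME F. F \<in> borel_measurable (borel \<Otimes>\<^sub>M borel) \<and> (\<forall>x\<in>XX. \<forall>y. F (x, y) = g x y \<theta>))"

lemma g_ext:
  shows g_ext_measurable: "g_ext \<theta> \<in> borel_measurable (borel \<Otimes>\<^sub>M borel)"
    and g_ext_eq: "x \<in> XX \<Longrightarrow> g_ext \<theta> (x, y) = g x y \<theta>"
proof -
  obtain F where F: "F \<in> borel_measurable (borel \<Otimes>\<^sub>M borel)"
    "\<And>x y. x \<in> XX \<Longrightarrow> y \<in> space borel \<Longrightarrow> F (x, y) = (\<lambda>(x, y). g x y \<theta>) (x, y)"
    by (rule borel_measurable_restrict_pair_extend[OF g_measurable[of \<theta>]]) auto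
  then have "\<exists>F. F \<in> borel_measurable (borel \<Otimes>\<^sub>M borel) \<and> (\<forall>x\<in>XX. \<forall>y. F (x, y) = g x y \<theta>)"
    by (intro exI[of _ F]) auto
  from someI_ex[OF this] have *: "g_ext \<theta> \<in> borel_measurable (borel \<Otimes>\<^sub>M borel) \<and> (\<forall>x\<in>XX. \<forall>y. g_ext \<theta> (x, y) = g x y \<theta>)"
    unfolding g_ext_def .
  from * show "g_ext \<theta> \<in> borel_measurable (borel \<Otimes>\<^sub>M borel)" by blast
  from * show "x \<in> XX \<Longrightarrow> g_ext \<theta> (x, y) = g x y \<theta>" by blast
qed

lemma g_differentiable: "x \<in> XX \<Longrightarrow> g x y differentiable (at \<theta>)"
  using twice_diff[of x y] by (simp add: twice_differentiable_def)

text \<open>Jacobian entries are limits of difference quotients of \<open>g_ext\<close> along the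
  steps \<open>1 / real (Suc n)\<close>, hence agree on the context space with a Borel function. Off
  it the quotients may diverge, and \<open>lim\<close> stays measurable.\<close>

lemma jac_ext_exists:
  "\<exists>F :: (real^'p) \<times> real \<Rightarrow> real. F \<in> borel_measurable (borel \<Otimes>\<^sub>M borel) \<and> (\<forall>x\<in>XX. \<forall>y. F (x, y) = score_jac x y $ i $ j)"
proof -
  let ?F = "\<lambda>n z. real (Suc n) * (g_ext (\<theta>s + (1 / real (Suc n)) *\<^sub>R axis j 1) z $ i - g_ext \<theta>s z $ i)"
  have lim: "(\<lambda>n. ?F n (x, y)) \<longlonglongrightarrow> score_jac x y $ i $ j" if x: "x \<in> XX" for x y
  proof -
    have "((\<lambda>\<theta>. g x y \<theta> $ i) has_derivative (\<lambda>h. score_jac x y $ i \<bullet> h)) (at \<theta>s)"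
      by (rule gradient_component(2)) (rule g_differentiable[OF x])
    then have d: "((\<lambda>\<theta>. g x y \<theta> $ i) has_derivative (\<lambda>h. score_jac x y $ i \<bullet> h)) (at (\<theta>s + 0 *\<^sub>R axis j 1))" by simp
    have "((\<lambda>t. \<theta>s + t *\<^sub>R axis j 1) has_derivative (\<lambda>t. t *\<^sub>R axis j (1::real))) (at 0)"
      by (auto intro!: derivative_eq_intros)
    from has_derivative_compose[OF this d]
    have "((\<lambda>t. g x y (\<theta>s + t *\<^sub>R axis j 1) $ i) has_derivative (\<lambda>t. score_jac x y $ i \<bullet> (t *\<^sub>R axis j 1))) (at 0)" .
    moreover have "(\<lambda>t. score_jac x y $ i \<bullet> (t *\<^sub>R axis j 1)) = (*) (score_jac x y $ i $ j)"
      by (rule ext) (simp add: inner_axis)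
    ultimately have "((\<lambda>t. g x y (\<theta>s + t *\<^sub>R axis j 1) $ i) has_field_derivative (score_jac x y $ i $ j)) (at 0)"
      unfolding has_field_derivative_def by (simp only:)
    then have "((\<lambda>h. (g x y (\<theta>s + h *\<^sub>R axis j 1) $ i - g x y \<theta>s $ i) / h) \<longlongrightarrow> score_jac x y $ i $ j) (at 0)"
      unfolding DERIV_def by simp
    moreover have "filterlim (\<lambda>n. 1 / real (Suc n)) (at 0) sequentially"
      unfolding filterlim_at using LIMSEQ_Suc[of "\<lambda>n. 1 / real n" 0, OF lim_1_over_n] by (auto intro!: always_eventually)
    ultimately have "(\<lambda>n. (g x y (\<theta>s + (1 / real (Suc n)) *\<^sub>R axis j 1) $ i - g x y \<theta>s $ i) / (1 / real (Suc n))) \<longlonglongrightarrow> score_jac x y $ i $ j"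
      by (rule filterlim_compose)
    then show ?thesis by (simp add: g_ext_eq[OF x] mult.commute)
  qed
  have m: "?F n \<in> borel_measurable (borel \<Otimes>\<^sub>M borel)" for n
    using g_ext_measurable by measurable
  show ?thesis
  proof (intro exI[of _ "\<lambda>z. lim (\<lambda>n. ?F n z)"] conjI ballI allI)
    show "(\<lambda>z. lim (\<lambda>n. ?F n z)) \<in> borel_measurable (borel \<Otimes>\<^sub>M borel)" by (rule borel_measurable_lim_metric[OF m])
    show "lim (\<lambda>n. ?F n (x, y)) = score_jac x y $ i $ j" if "x \<in> XX" for x y by (rule limI[OF lim[OF that]])
  qed
qed

definition jac_ext :: "'d \<Rightarrow> 'd \<Rightarrow> (real^'p) \<times> real \<Rightarrow> real" where
  "jac_ext i j = (SOME F. F \<in> borel_measurable (borel \<Otimes>\<^sub>M borel) \<and> (\<forall>x\<in>XX. \<forall>y. F (x, y) = score_jac x y $ i $ j))"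

lemma jac_ext:
  shows jac_ext_measurable: "jac_ext i j \<in> borel_measurable (borel \<Otimes>\<^sub>M borel)"
    and jac_ext_eq: "x \<in> XX \<Longrightarrow> jac_ext i j (x, y) = score_jac x y $ i $ j"
  using someI_ex[OF jac_ext_exists[of i j]] unfolding jac_ext_def[symmetric] by blast+

definition q_ext :: "real^'p \<Rightarrow> real" where
  "q_ext = (SOME F. F \<in> borel_measurable borel \<and> (\<forall>x\<in>XX. F x = \<pi>bar x $ a))"

lemma q_ext:
  shows q_ext_measurable: "q_ext \<in> borel_measurable borel"
    and q_ext_eq: "x \<in> XX \<Longrightarrow> q_ext x = \<pi>bar x $ a"
proof -
  have "(\<lambda>x. \<pi>bar x $ a) \<in> borel_measurable (restrict_space borel XX)" using \<pi>bar_measurable by measurable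
  then obtain F :: "real^'p \<Rightarrow> real" where "F \<in> borel_measurable borel" "\<And>x. x \<in> XX \<Longrightarrow> F x = \<pi>bar x $ a"
    by (rule borel_measurable_restrict_space_extend) auto
  then have "\<exists>F. F \<in> borel_measurable borel \<and> (\<forall>x\<in>XX. F x = \<pi>bar x $ a)" by blast
  from someI_ex[OF this] have *: "q_ext \<in> borel_measurable borel \<and> (\<forall>x\<in>XX. q_ext x = \<pi>bar x $ a)"
    unfolding q_ext_def .
  from * show "q_ext \<in> borel_measurable borel" by blast
  from * show "x \<in> XX \<Longrightarrow> q_ext x = \<pi>bar x $ a" by blast
qed

lemma q_ext_bounds: "x \<in> XX \<Longrightarrow> 0 \<le> q_ext x" "x \<in> XX \<Longrightarrow> q_ext x \<le> 1"
  using prob_simplex_bounds[OF \<pi>bar_simplex] by (simp_all add: q_ext_eq)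

lemma policy_converges_ext: "tendsto_zero_in_prob M (\<lambda>t \<omega>. aprob t \<omega> a - q_ext (X t \<omega>))"
proof (rule tendsto_zero_in_prob_le[where W = "\<lambda>t \<omega>. norm (aprob t \<omega> a - \<pi>bar (X t \<omega>) $ a)"])
  show "random_variable borel (\<lambda>\<omega>. norm (aprob t \<omega> a - \<pi>bar (X t \<omega>) $ a))" if t: "t \<ge> 1" for t
  proof -
    have "(\<lambda>\<omega>. \<pi>bar (X t \<omega>)) \<in> borel_measurable M" by (rule measurable_compose[OF context_restrict_rv[OF t] \<pi>bar_measurable])
    then show ?thesis using action_prob_rv[OF t] by measurable
  qed
  show "tendsto_zero_in_prob M (\<lambda>t \<omega>. norm (aprob t \<omega> a - \<pi>bar (X t \<omega>) $ a))"
    using policy_converges by (simp add: tendsto_zero_in_prob_def)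
  show "AE \<omega> in M. norm (aprob t \<omega> a - q_ext (X t \<omega>)) \<le> norm (aprob t \<omega> a - \<pi>bar (X t \<omega>) $ a)" if "t \<ge> 1" for t
    using context_mem[OF that] by (intro AE_I2) (simp add: q_ext_eq)
qed

text \<open>The lower bound is assumed for the actual propensities and has to pass to the limit.
  Since \<open>X t\<close> and \<open>X0\<close> have the same law, the probability that
  \<open>q_ext (X0 \<omega>)\<close> falls below \<open>\<pi>min - e\<close> equals that for
  \<open>X t\<close>, and this is at most the vanishing probability that the propensity is more than
  \<open>e\<close> away from its limit.\<close>

lemma q_ext_ge: "AE \<omega> in M. \<pi>min \<le> q_ext (X0 \<omega>)"
proof -
  note [measurable] = q_ext_measurable generic_context_rv
  have zero: "prob {\<omega>\<in>space M. q_ext (X0 \<omega>) < \<pi>min - e} = 0" if e: "e > 0" for e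
  proof (rule antisym[OF _ measure_nonneg])
    have "(\<lambda>t. prob {\<omega>\<in>space M. norm (aprob t \<omega> a - q_ext (X t \<omega>)) > e}) \<longlonglongrightarrow> 0"
      by (rule tendsto_zero_in_probD[OF policy_converges_ext e])
    then show "prob {\<omega>\<in>space M. q_ext (X0 \<omega>) < \<pi>min - e} \<le> 0"
    proof (rule tendsto_lowerbound)
      show "\<forall>\<^sub>F t in sequentially. prob {\<omega>\<in>space M. q_ext (X0 \<omega>) < \<pi>min - e} \<le> prob {\<omega>\<in>space M. norm (aprob t \<omega> a - q_ext (X t \<omega>)) > e}"
      proof (rule eventually_sequentiallyI[of 1])
        fix t :: nat assume t: "1 \<le> t"
        note [measurable] = context_rv[OF t] action_prob_rv[OF t]
        have "prob {\<omega>\<in>space M. q_ext (X0 \<omega>) < \<pi>min - e} = prob {\<omega>\<in>space M. q_ext (X t \<omega>) < \<pi>min - e}"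
          using prob_tuple[of "\<lambda>z. q_ext (fst z)" "{..<\<pi>min - e}" t] t by simp
        also have "\<dots> \<le> prob {\<omega>\<in>space M. norm (aprob t \<omega> a - q_ext (X t \<omega>)) > e}"
        proof (rule finite_measure_mono_AE)
          show "AE \<omega> in M. \<omega> \<in> {\<omega>\<in>space M. q_ext (X t \<omega>) < \<pi>min - e} \<longrightarrow> \<omega> \<in> {\<omega>\<in>space M. norm (aprob t \<omega> a - q_ext (X t \<omega>)) > e}"
            using aprob_ge[OF t] by eventually_elim auto
        qed measurable
        finally show "prob {\<omega>\<in>space M. q_ext (X0 \<omega>) < \<pi>min - e} \<le> prob {\<omega>\<in>space M. norm (aprob t \<omega> a - q_ext (X t \<omega>)) > e}" .
      qed
    qed simp
  qed
  \<comment> \<open>The slack \<open>e\<close> runs through a countable sequence so that the null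
    sets can be united.\<close>
  have "AE \<omega> in M. \<forall>n. \<pi>min - 1 / real (Suc n) \<le> q_ext (X0 \<omega>)"
    unfolding AE_all_countable
  proof
    fix n
    have "{\<omega>\<in>space M. q_ext (X0 \<omega>) < \<pi>min - 1 / real (Suc n)} \<in> null_sets M"
      using zero[of "1 / real (Suc n)"] by (simp add: null_setsI emeasure_eq_measure)
    then show "AE \<omega> in M. \<pi>min - 1 / real (Suc n) \<le> q_ext (X0 \<omega>)" by (rule AE_I') (auto simp: not_le)
  qed
  then show ?thesis
  proof eventually_elim
    case (elim \<omega>)
    show ?case
    proof (rule field_le_epsilon)
      fix e :: real assume "e > 0"
      then obtain n where "1 / real (Suc n) < e" using nat_approx_posE by blast
      then show "\<pi>min \<le> q_ext (X0 \<omega>) + e" using elim[rule_format, of n] by linarith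
    qed
  qed
qed

lemma q_ext_ge_context: assumes t: "t \<ge> 1" shows "AE \<omega> in M. \<pi>min \<le> q_ext (X t \<omega>)"
proof -
  note [measurable] = q_ext_measurable generic_context_rv context_rv[OF t]
  have "prob {\<omega>\<in>space M. q_ext (X t \<omega>) < \<pi>min} = prob {\<omega>\<in>space M. q_ext (X0 \<omega>) < \<pi>min}"
    using prob_tuple[of "\<lambda>z. q_ext (fst z)" "{..<\<pi>min}" t] t by simp
  also have "\<dots> = prob {}" using q_ext_ge by (intro finite_measure_eq_AE) (auto elim!: eventually_mono)
  finally have "{\<omega>\<in>space M. q_ext (X t \<omega>) < \<pi>min} \<in> null_sets M"
    by (simp add: null_setsI emeasure_eq_measure)
  then show ?thesis by (rule AE_I') (auto simp: not_le)
qed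

lemma G_component:
  assumes "\<omega> \<in> space M"
  shows "G T \<theta> \<omega> $ i = (\<Sum>t=1..T. ipw t \<omega> * score_at (\<lambda>z. g_ext \<theta> z $ i) t \<omega>) / real T"
proof -
  have "G T \<theta> \<omega> $ i = (1 / real T) * (\<Sum>t=1..T. (of_bool (A t \<omega> = a) / aprob t \<omega> (A t \<omega>)) * g (X t \<omega>) (Y t \<omega> $ A t \<omega>) \<theta> $ i)"
    unfolding weighted_score_def by (simp add: sum_component)
  also have "(\<Sum>t=1..T. (of_bool (A t \<omega> = a) / aprob t \<omega> (A t \<omega>)) * g (X t \<omega>) (Y t \<omega> $ A t \<omega>) \<theta> $ i) =
     (\<Sum>t=1..T. ipw t \<omega> * score_at (\<lambda>z. g_ext \<theta> z $ i) t \<omega>)"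
    using assms by (intro sum.cong) (auto simp: ipw_def g_ext_eq context_mem)
  finally show ?thesis by simp
qed

lemma G_eq:
  assumes "\<omega> \<in> space M"
  shows "G T \<theta> \<omega> = (1 / real T) *\<^sub>R (\<Sum>t=1..T. ipw t \<omega> *\<^sub>R g (X t \<omega>) (Y t \<omega> $ a) \<theta>)"
  unfolding weighted_score_def ipw_def by (rule arg_cong[of _ _ "scaleR _"], rule sum.cong) (auto simp: of_bool_def)

lemma g_ext_component_measurable: "(\<lambda>z. g_ext \<theta> z $ i) \<in> borel_measurable (borel \<Otimes>\<^sub>M borel)"
  using g_ext_measurable by measurable

lemma g_generic_rv: "random_variable borel (\<lambda>\<omega>. g (X0 \<omega>) (Y0 \<omega> $ a) \<theta>)"
proof -
  have "(\<lambda>\<omega>. g_ext \<theta> (X0 \<omega>, Y0 \<omega> $ a)) \<in> borel_measurable M"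
    by (rule measurable_compose[OF _ g_ext_measurable]) (use generic_context_rv generic_outcomes_rv in measurable)
  then show ?thesis by (rule measurable_cong[THEN iffD1, rotated]) (simp add: g_ext_eq generic_context_mem)
qed

lemma g_square_integrable:
  assumes "norm \<theta> \<le> R" shows "integrable M (\<lambda>\<omega>. (norm (g (X0 \<omega>) (Y0 \<omega> $ a) \<theta>))\<^sup>2)"
proof (rule integrableI_bounded)
  show "random_variable borel (\<lambda>\<omega>. (norm (g (X0 \<omega>) (Y0 \<omega> $ a) \<theta>))\<^sup>2)" using g_generic_rv[of \<theta>] by measurable
  have "(\<integral>\<^sup>+\<omega>. ennreal (norm ((norm (g (X0 \<omega>) (Y0 \<omega> $ a) \<theta>))\<^sup>2)) \<partial>M) = (\<integral>\<^sup>+\<omega>. ennreal ((norm (g (X0 \<omega>) (Y0 \<omega> $ a) \<theta>))\<^sup>2) \<partial>M)" by simp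
  also have "\<dots> \<le> (SUP \<theta>\<in>{\<theta>. norm \<theta> \<le> R}. \<integral>\<^sup>+\<omega>. ennreal ((norm (g (X0 \<omega>) (Y0 \<omega> $ a) \<theta>))\<^sup>2) \<partial>M)"
    using assms by (intro SUP_upper) simp
  finally show "(\<integral>\<^sup>+\<omega>. ennreal (norm ((norm (g (X0 \<omega>) (Y0 \<omega> $ a) \<theta>))\<^sup>2)) \<partial>M) < \<infinity>"
    using second_moment by (rule order.strict_trans1)
qed

lemma g_ext_generic: "\<omega> \<in> space M \<Longrightarrow> g_ext \<theta> (X0 \<omega>, Y0 \<omega> $ a) = g (X0 \<omega>) (Y0 \<omega> $ a) \<theta>"
  by (simp add: g_ext_eq generic_context_mem)

lemma g_component_square_integrable:
  assumes "norm \<theta> \<le> R" shows "integrable M (\<lambda>\<omega>. (g_ext \<theta> (X0 \<omega>, Y0 \<omega> $ a) $ i)\<^sup>2)"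
proof (rule Bochner_Integration.integrable_bound[OF g_square_integrable[OF assms]])
  have "(\<lambda>\<omega>. g_ext \<theta> (X0 \<omega>, Y0 \<omega> $ a)) \<in> borel_measurable M"
    by (rule measurable_compose[OF _ g_ext_measurable]) (use generic_context_rv generic_outcomes_rv in measurable)
  then show "random_variable borel (\<lambda>\<omega>. (g_ext \<theta> (X0 \<omega>, Y0 \<omega> $ a) $ i)\<^sup>2)" by measurable
  have "(v $ i)\<^sup>2 \<le> (norm v)\<^sup>2" for v :: "real^'d"
    using power_mono[OF component_le_norm_cart[of v i], of 2] by simp
  then show "AE \<omega> in M. norm ((g_ext \<theta> (X0 \<omega>, Y0 \<omega> $ a) $ i)\<^sup>2) \<le> norm ((norm (g (X0 \<omega>) (Y0 \<omega> $ a) \<theta>))\<^sup>2)"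
    by (intro AE_I2) (simp add: g_ext_generic)
qed

lemma g_integrable:
  assumes "norm \<theta> \<le> R" shows "integrable M (\<lambda>\<omega>. g (X0 \<omega>) (Y0 \<omega> $ a) \<theta>)"
proof -
  have "integrable M (\<lambda>\<omega>. norm (g (X0 \<omega>) (Y0 \<omega> $ a) \<theta>))"
    by (rule integrable_of_square[OF _ g_square_integrable[OF assms]]) (use g_generic_rv[of \<theta>] in measurable)
  then show ?thesis using g_generic_rv by (simp add: integrable_norm_iff)
qed

lemma score_mean_component:
  assumes "norm \<theta> \<le> R" shows "score_mean \<theta> $ i = expectation (\<lambda>\<omega>. g_ext \<theta> (X0 \<omega>, Y0 \<omega> $ a) $ i)"
proof -
  have "score_mean \<theta> $ i = expectation (\<lambda>\<omega>. g (X0 \<omega>) (Y0 \<omega> $ a) \<theta> $ i)"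
    by (rule integral_bounded_linear[OF bounded_linear_vec_nth g_integrable[OF assms], symmetric])
  also have "\<dots> = expectation (\<lambda>\<omega>. g_ext \<theta> (X0 \<omega>, Y0 \<omega> $ a) $ i)"
    by (intro Bochner_Integration.integral_cong) (auto simp: g_ext_generic)
  finally show ?thesis .
qed

lemma G_rv: "random_variable borel (\<lambda>\<omega>. G T \<theta> \<omega>)"
proof -
  have "random_variable borel (\<lambda>\<omega>. \<chi> i. (\<Sum>t=1..T. ipw t \<omega> * score_at (\<lambda>z. g_ext \<theta> z $ i) t \<omega>) / real T)"
    by (intro borel_measurable_vec_lambda borel_measurable_divide borel_measurable_sum ipw_term_rv g_ext_component_measurable borel_measurable_const) auto
  then show ?thesis
    by (rule measurable_cong[THEN iffD1, rotated]) (simp add: vec_eq_iff G_component)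
qed

text \<open>A law of large numbers at a fixed parameter, component by component. Uniformity over the
  ball is recovered later from a random Lipschitz constant.\<close>

lemma G_tendsto:
  assumes "norm \<theta> \<le> R" shows "tendsto_zero_in_prob M (\<lambda>T \<omega>. G T \<theta> \<omega> - score_mean \<theta>)"
proof (rule tendsto_zero_in_prob_le)
  let ?D = "\<lambda>i T \<omega>. (\<Sum>t=1..T. ipw t \<omega> * score_at (\<lambda>z. g_ext \<theta> z $ i) t \<omega>) / real T - expectation (\<lambda>\<omega>. g_ext \<theta> (X0 \<omega>, Y0 \<omega> $ a) $ i)"
  have rv: "random_variable borel (?D i T)" for i T
    by (intro borel_measurable_diff borel_measurable_divide borel_measurable_sum ipw_term_rv g_ext_component_measurable borel_measurable_const) auto
  show "random_variable borel (\<lambda>\<omega>. \<Sum>i\<in>UNIV. \<bar>?D i T \<omega>\<bar>)" for T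
    by (intro borel_measurable_sum borel_measurable_abs rv)
  have "tendsto_zero_in_prob M (?D i)" for i
    by (rule ipw_mean_tendsto[OF g_ext_component_measurable g_component_square_integrable[OF assms]])
  then show "tendsto_zero_in_prob M (\<lambda>T \<omega>. \<Sum>i\<in>UNIV. \<bar>?D i T \<omega>\<bar>)"
    by (intro tendsto_zero_in_prob_sum borel_measurable_abs rv) (simp_all add: tendsto_zero_in_prob_def)
  show "AE \<omega> in M. norm (G T \<theta> \<omega> - score_mean \<theta>) \<le> (\<Sum>i\<in>UNIV. \<bar>?D i T \<omega>\<bar>)" for T
  proof (rule AE_I2)
    fix \<omega> assume "\<omega> \<in> space M"
    then show "norm (G T \<theta> \<omega> - score_mean \<theta>) \<le> (\<Sum>i\<in>UNIV. \<bar>?D i T \<omega>\<bar>)"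
      using norm_le_l1_cart[of "G T \<theta> \<omega> - score_mean \<theta>"] by (simp add: G_component score_mean_component[OF assms])
  qed
qed

end

text \<open>A random parameter is substituted through simple approximations: the parameter is
  constant on each of finitely many pieces, and continuity in the parameter carries measurability to
  the limit.\<close>

lemma borel_measurable_caratheodory:
  fixes F :: "'b::{metric_space, second_countable_topology} \<Rightarrow> 'x \<Rightarrow> 'c::{metric_space, second_countable_topology, real_normed_vector}"
  assumes F: "\<And>v. F v \<in> borel_measurable N" and cont: "\<And>x. x \<in> space N \<Longrightarrow> continuous_on UNIV (\<lambda>v. F v x)"
    and s: "s \<in> borel_measurable N"
  shows "(\<lambda>x. F (s x) x) \<in> borel_measurable N"
proof -
  obtain S where S: "\<And>n. simple_function N (S n)" "\<And>x. x \<in> space N \<Longrightarrow> (\<lambda>n. S n x) \<longlonglongrightarrow> s x"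
    using borel_measurable_implies_sequence_metric[OF s] by blast
  show ?thesis
  proof (rule borel_measurable_LIMSEQ_metric)
    fix n
    have fin: "finite (S n ` space N)" using S(1)[of n] by (simp add: simple_function_def)
    have "(\<lambda>x. \<Sum>v\<in>S n ` space N. indicator (S n -` {v} \<inter> space N) x *\<^sub>R F v x) \<in> borel_measurable N"
      by (intro borel_measurable_sum borel_measurable_scaleR borel_measurable_indicator simple_functionD(2)[OF S(1)] F)
    moreover have "(\<Sum>v\<in>S n ` space N. indicator (S n -` {v} \<inter> space N) x *\<^sub>R F v x) = F (S n x) x" if x: "x \<in> space N" for x
    proof -
      have "(\<Sum>v\<in>S n ` space N. indicator (S n -` {v} \<inter> space N) x *\<^sub>R F v x) = (\<Sum>v\<in>S n ` space N. if v = S n x then F v x else 0)"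
        using x by (intro sum.cong) (auto simp: indicator_def)
      also have "\<dots> = F (S n x) x" using fin x by simp
      finally show ?thesis .
    qed
    ultimately show "(\<lambda>x. F (S n x) x) \<in> borel_measurable N" by (rule measurable_cong[THEN iffD1, rotated])
  next
    fix x assume x: "x \<in> space N"
    show "(\<lambda>n. F (S n x) x) \<longlonglongrightarrow> F (s x) x"
      using cont[OF x] S(2)[OF x] by (rule continuous_on_tendsto_compose) auto
  qed
qed

section \<open>Uniformity in the parameter and consistency\<close>

context ipw_bandit begin

text \<open>A first absolute moment suffices for boundedness in probability, so this reaches the
  Hessian envelope \<open>\<Phi>\<close>, of which no more is assumed. In the remainder terms such
  averages are always multiplied by a vanishing factor.\<close>

lemma ipw_mean_bounded:
  fixes f :: "(real^'p) \<times> real \<Rightarrow> real"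
  assumes f: "f \<in> borel_measurable (borel \<Otimes>\<^sub>M borel)" and i: "integrable M (\<lambda>\<omega>. f (X0 \<omega>, Y0 \<omega> $ a))"
  shows "bounded_in_prob (\<lambda>T \<omega>. (\<Sum>t=1..T. ipw t \<omega> * score_at f t \<omega>) / real T)"
proof (rule bounded_in_prob_expectation)
  let ?C = "1 / \<pi>min * expectation (\<lambda>\<omega>. \<bar>f (X0 \<omega>, Y0 \<omega> $ a)\<bar>)"
  have m: "integrable M (\<lambda>\<omega>. \<bar>ipw t \<omega> * score_at f t \<omega>\<bar>)" "expectation (\<lambda>\<omega>. \<bar>ipw t \<omega> * score_at f t \<omega>\<bar>) \<le> ?C" if "t \<ge> 1" for t
    using ipw_moment[OF f that, of 1] i by simp_all
  have m': "integrable M (\<lambda>\<omega>. ipw t \<omega> * score_at f t \<omega>)" if "t \<ge> 1" for t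
    using m(1)[OF that] ipw_term_rv[OF f that] by (simp add: integrable_abs_iff)
  fix T :: nat assume T: "T \<ge> 1"
  show "integrable M (\<lambda>\<omega>. (\<Sum>t=1..T. ipw t \<omega> * score_at f t \<omega>) / real T)"
    by (intro integrable_divide_zero Bochner_Integration.integrable_sum m') simp
  then have i1: "integrable M (\<lambda>\<omega>. \<bar>(\<Sum>t=1..T. ipw t \<omega> * score_at f t \<omega>) / real T\<bar>)" by (rule integrable_abs)
  have i2: "integrable M (\<lambda>\<omega>. (\<Sum>t=1..T. \<bar>ipw t \<omega> * score_at f t \<omega>\<bar>) / real T)"
    by (intro integrable_divide_zero Bochner_Integration.integrable_sum m) simp
  have "expectation (\<lambda>\<omega>. \<bar>(\<Sum>t=1..T. ipw t \<omega> * score_at f t \<omega>) / real T\<bar>) \<le> expectation (\<lambda>\<omega>. (\<Sum>t=1..T. \<bar>ipw t \<omega> * score_at f t \<omega>\<bar>) / real T)"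
    by (rule integral_mono[OF i1 i2]) (simp add: abs_divide divide_right_mono)
  also have "\<dots> = (\<Sum>t=1..T. expectation (\<lambda>\<omega>. \<bar>ipw t \<omega> * score_at f t \<omega>\<bar>)) / real T"
    using m(1) by (simp add: Bochner_Integration.integral_sum)
  also have "\<dots> \<le> (\<Sum>t=1..T. ?C) / real T" using m(2) by (intro divide_right_mono sum_mono) auto
  also have "\<dots> = ?C" using T by simp
  finally show "expectation (\<lambda>\<omega>. \<bar>(\<Sum>t=1..T. ipw t \<omega> * score_at f t \<omega>) / real T\<bar>) \<le> ?C" .
qed

end

context ipw_z_estimation begin

text \<open>A random Lipschitz constant of the weighted score on the ball of radius
  \<open>R\<close>, bounded in probability.\<close>

definition \<phi>_mean :: "nat \<Rightarrow> 'w \<Rightarrow> real" where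
  "\<phi>_mean T \<omega> = (\<Sum>t=1..T. ipw t \<omega> * score_at (\<lambda>(x, y). \<phi> x y) t \<omega>) / real T"

lemma \<phi>_nonneg: "x \<in> XX \<Longrightarrow> 0 \<le> \<phi> x y"
  using order_trans[OF spectral_norm_nonneg \<phi>_bound[of x \<theta>s y]] \<theta>s_bound by simp

lemma \<phi>_generic_rv: "random_variable borel (\<lambda>\<omega>. \<phi> (X0 \<omega>) (Y0 \<omega> $ a))"
proof -
  have "(\<lambda>\<omega>. (\<lambda>(x, y). \<phi> x y) (X0 \<omega>, Y0 \<omega> $ a)) \<in> borel_measurable M"
    by (rule measurable_compose[OF _ \<phi>_measurable]) (use generic_context_rv generic_outcomes_rv in measurable)
  then show ?thesis by simp
qed

lemma \<phi>_integrable: "integrable M (\<lambda>\<omega>. \<phi> (X0 \<omega>) (Y0 \<omega> $ a))"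
  by (rule integrable_of_square[OF \<phi>_generic_rv \<phi>_moment])

lemma \<phi>_mean_rv: "random_variable borel (\<phi>_mean T)"
  unfolding \<phi>_mean_def
  by (intro borel_measurable_divide borel_measurable_sum ipw_term_rv \<phi>_measurable borel_measurable_const) auto

lemma \<phi>_mean_bounded: "bounded_in_prob \<phi>_mean"
  unfolding \<phi>_mean_def[abs_def] using \<phi>_integrable by (intro ipw_mean_bounded \<phi>_measurable) simp

lemma g_lipschitz:
  assumes "x \<in> XX" "norm \<theta> \<le> R" "norm \<theta>' \<le> R"
  shows "norm (g x y \<theta> - g x y \<theta>') \<le> \<phi> x y * norm (\<theta> - \<theta>')"
  using assms by (intro jacobian_bound_lipschitz[where R = R] g_differentiable \<phi>_bound) auto

lemma G_lipschitz:
  assumes \<omega>: "\<omega> \<in> space M" and \<theta>: "norm \<theta> \<le> R" "norm \<theta>' \<le> R"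
  shows "norm (G T \<theta> \<omega> - G T \<theta>' \<omega>) \<le> \<phi>_mean T \<omega> * norm (\<theta> - \<theta>')"
proof -
  have "G T \<theta> \<omega> - G T \<theta>' \<omega> = (1 / real T) *\<^sub>R (\<Sum>t=1..T. ipw t \<omega> *\<^sub>R (g (X t \<omega>) (Y t \<omega> $ a) \<theta> - g (X t \<omega>) (Y t \<omega> $ a) \<theta>'))"
    unfolding G_eq[OF \<omega>] by (simp add: sum_subtractf scaleR_diff_right)
  also have "norm \<dots> \<le> (1 / real T) * (\<Sum>t=1..T. ipw t \<omega> * (\<phi> (X t \<omega>) (Y t \<omega> $ a) * norm (\<theta> - \<theta>')))"
  proof -
    have "norm (\<Sum>t=1..T. ipw t \<omega> *\<^sub>R (g (X t \<omega>) (Y t \<omega> $ a) \<theta> - g (X t \<omega>) (Y t \<omega> $ a) \<theta>')) \<le> (\<Sum>t=1..T. ipw t \<omega> * (\<phi> (X t \<omega>) (Y t \<omega> $ a) * norm (\<theta> - \<theta>')))"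
    proof (rule sum_norm_le)
      fix t assume "t \<in> {1..T}"
      then have t: "t \<ge> 1" by simp
      show "norm (ipw t \<omega> *\<^sub>R (g (X t \<omega>) (Y t \<omega> $ a) \<theta> - g (X t \<omega>) (Y t \<omega> $ a) \<theta>')) \<le> ipw t \<omega> * (\<phi> (X t \<omega>) (Y t \<omega> $ a) * norm (\<theta> - \<theta>'))"
        unfolding norm_scaleR abs_of_nonneg[OF ipw_nonneg[OF t \<omega>]]
        by (intro mult_left_mono g_lipschitz context_mem t \<omega> \<theta> ipw_nonneg)
    qed
    then show ?thesis by (simp add: divide_right_mono)
  qed
  also have "\<dots> = \<phi>_mean T \<omega> * norm (\<theta> - \<theta>')"
    unfolding \<phi>_mean_def by (simp add: sum_distrib_right mult.assoc)
  finally show ?thesis .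
qed

lemma score_mean_lipschitz:
  assumes \<theta>: "norm \<theta> \<le> R" "norm \<theta>' \<le> R"
  shows "norm (score_mean \<theta> - score_mean \<theta>') \<le> expectation (\<lambda>\<omega>. \<phi> (X0 \<omega>) (Y0 \<omega> $ a)) * norm (\<theta> - \<theta>')"
proof -
  have "score_mean \<theta> - score_mean \<theta>' = (\<integral>\<omega>. g (X0 \<omega>) (Y0 \<omega> $ a) \<theta> - g (X0 \<omega>) (Y0 \<omega> $ a) \<theta>' \<partial>M)"
    by (rule Bochner_Integration.integral_diff[symmetric]) (intro g_integrable \<theta>)+
  also have "norm \<dots> \<le> expectation (\<lambda>\<omega>. norm (g (X0 \<omega>) (Y0 \<omega> $ a) \<theta> - g (X0 \<omega>) (Y0 \<omega> $ a) \<theta>'))"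
    by (rule integral_norm_bound)
  also have "\<dots> \<le> expectation (\<lambda>\<omega>. \<phi> (X0 \<omega>) (Y0 \<omega> $ a) * norm (\<theta> - \<theta>'))"
    by (intro integral_mono integrable_norm Bochner_Integration.integrable_diff g_integrable integrable_mult_left \<phi>_integrable \<theta> g_lipschitz generic_context_mem)
  finally show ?thesis by simp
qed

lemma G_continuous: "\<omega> \<in> space M \<Longrightarrow> continuous_on UNIV (\<lambda>\<theta>. G T \<theta> \<omega>)"
proof -
  assume \<omega>: "\<omega> \<in> space M"
  have "continuous_on UNIV (g (X t \<omega>) (Y t \<omega> $ a))" if "t \<ge> 1" for t
    by (intro differentiable_imp_continuous_on) (simp add: differentiable_on_def g_differentiable[OF context_mem[OF that \<omega>]])
  then show "continuous_on UNIV (\<lambda>\<theta>. G T \<theta> \<omega>)"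
    unfolding G_eq[OF \<omega>] by (intro continuous_intros) auto
qed

lemma G_compose_rv: "random_variable borel \<theta>hat \<Longrightarrow> random_variable borel (\<lambda>\<omega>. G T (\<theta>hat \<omega>) \<omega>)"
  by (rule borel_measurable_caratheodory[OF G_rv G_continuous])

text \<open>Where the estimator is more than \<open>e\<close> from \<open>\<theta>s\<close>, the
  population score at it has norm at least \<open>c\<close>. But the population score is close to
  the sample score at the estimator, which tends to 0: both change little on moving to a nearby net
  point, and there the fixed-parameter law of large numbers applies. Confinement to the compact ball
  is what makes a finite net possible.\<close>

lemma consistency:
  fixes \<theta>hat :: "nat \<Rightarrow> 'w \<Rightarrow> real^'d"
  assumes rv: "\<And>T. T \<ge> 1 \<Longrightarrow> random_variable borel (\<theta>hat T)"
    and bd: "\<And>T \<omega>. T \<ge> 1 \<Longrightarrow> \<omega> \<in> space M \<Longrightarrow> norm (\<theta>hat T \<omega>) \<le> R"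
    and op: "tendsto_zero_in_prob M (\<lambda>T \<omega>. G T (\<theta>hat T \<omega>) \<omega>)"
  shows "tendsto_zero_in_prob M (\<lambda>T \<omega>. \<theta>hat T \<omega> - \<theta>s)"
  unfolding tendsto_zero_in_prob_def
proof (intro allI impI LIMSEQ_I)
  fix e r :: real assume e: "0 < e" and r: "0 < r"
  define c where "c = (INF \<theta>\<in>{\<theta>. norm (\<theta> - \<theta>s) > e}. norm (score_mean \<theta>))"
  have c: "c > 0" unfolding c_def by (rule well_separated[OF e])
  have c_le: "c \<le> norm (score_mean \<theta>)" if "norm (\<theta> - \<theta>s) > e" for \<theta>
    unfolding c_def using that by (intro cINF_lower bdd_belowI2[where m = 0]) auto
  \<comment> \<open>\<open>K\<close> caps the random Lipschitz constant up to probability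
    \<open>r / 2\<close>. It is fixed before the net, so that the net does not depend on
    \<open>T\<close>.\<close>
  obtain K where K: "K > 0" "\<And>n. n \<ge> 1 \<Longrightarrow> prob {\<omega>\<in>space M. \<bar>\<phi>_mean n \<omega>\<bar> > K} \<le> r/2"
    using \<phi>_mean_bounded[unfolded bounded_in_prob_def, rule_format, of "r/2"] half_gt_zero[OF r] by blast
  define E where "E = expectation (\<lambda>\<omega>. \<phi> (X0 \<omega>) (Y0 \<omega> $ a))"
  have E: "E \<ge> 0" unfolding E_def by (intro Bochner_Integration.integral_nonneg \<phi>_nonneg generic_context_mem)
  \<comment> \<open>Mesh of the net: moving to a net point changes the population score by at most
    \<open>E * \<delta>\<close> and the sample score by at most \<open>K * \<delta>\<close>,
    together \<open>c / 4\<close>.\<close>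
  define \<delta> where "\<delta> = c / (4 * (K + E))"
  have \<delta>: "\<delta> > 0" "(K + E) * \<delta> = c / 4" using c K(1) E by (simp_all add: \<delta>_def field_simps)
  obtain N where N: "finite N" "N \<subseteq> cball (0 :: real^'d) R" "cball 0 R \<subseteq> (\<Union>v\<in>N. ball v \<delta>)"
    using seq_compact_imp_totally_bounded[of "cball (0 :: real^'d) R"] \<delta>(1) by (auto simp: compact_imp_seq_compact)
  \<comment> \<open>All the stochastic error: deviations at the net points plus the score at the
    estimator. A bad estimate with the Lipschitz constant under \<open>K\<close> forces it to at
    least \<open>3 * c / 4\<close>, above the threshold \<open>c / 4\<close>.\<close>
  define U where "U T \<omega> = (\<Sum>v\<in>N. norm (G T v \<omega> - score_mean v)) + norm (G T (\<theta>hat T \<omega>) \<omega>)" for T \<omega>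
  have U_rv: "random_variable borel (U T)" if T: "T \<ge> 1" for T
    unfolding U_def using G_compose_rv[OF rv[OF T], of T] G_rv by measurable
  have "tendsto_zero_in_prob M U"
    unfolding U_def[abs_def]
  proof (rule tendsto_zero_in_prob_add)
    show "random_variable borel (\<lambda>\<omega>. \<Sum>v\<in>N. norm (G T v \<omega> - score_mean v))" for T using G_rv by measurable
    show "random_variable borel (\<lambda>\<omega>. norm (G T (\<theta>hat T \<omega>) \<omega>))" if "T \<ge> 1" for T using G_compose_rv[OF rv[OF that], of T] by measurable
    show "tendsto_zero_in_prob M (\<lambda>T \<omega>. norm (G T (\<theta>hat T \<omega>) \<omega>))" using op by (simp add: tendsto_zero_in_prob_def)
    show "tendsto_zero_in_prob M (\<lambda>T \<omega>. \<Sum>v\<in>N. norm (G T v \<omega> - score_mean v))"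
    proof (rule tendsto_zero_in_prob_sum[OF N(1)])
      fix v assume "v \<in> N"
      then have "norm v \<le> R" using N(2) by auto
      from G_tendsto[OF this] show "tendsto_zero_in_prob M (\<lambda>T \<omega>. norm (G T v \<omega> - score_mean v))" by (simp add: tendsto_zero_in_prob_def)
    next
      show "random_variable borel (\<lambda>\<omega>. norm (G T v \<omega> - score_mean v))" for T v using G_rv by measurable
    qed
  qed
  then have "(\<lambda>T. prob {\<omega>\<in>space M. norm (U T \<omega>) > c / 4}) \<longlonglongrightarrow> 0" using c by (intro tendsto_zero_in_probD) auto
  from LIMSEQ_D[OF this, of "r/2"] r obtain n0 where n0: "\<And>n. n \<ge> n0 \<Longrightarrow> prob {\<omega>\<in>space M. norm (U n \<omega>) > c / 4} < r/2" by auto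
  have "norm (prob {\<omega>\<in>space M. norm (\<theta>hat T \<omega> - \<theta>s) > e} - 0) < r" if T: "T \<ge> max n0 1" for T
  proof -
    have T1: "T \<ge> 1" using T by simp
    note [measurable] = U_rv[OF T1] \<phi>_mean_rv
    have "prob {\<omega>\<in>space M. norm (\<theta>hat T \<omega> - \<theta>s) > e} \<le> prob ({\<omega>\<in>space M. \<bar>\<phi>_mean T \<omega>\<bar> > K} \<union> {\<omega>\<in>space M. norm (U T \<omega>) > c / 4})"
    proof (rule finite_measure_mono)
      show "{\<omega>\<in>space M. norm (\<theta>hat T \<omega> - \<theta>s) > e} \<subseteq> {\<omega>\<in>space M. \<bar>\<phi>_mean T \<omega>\<bar> > K} \<union> {\<omega>\<in>space M. norm (U T \<omega>) > c / 4}"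
      proof
        fix \<omega> assume "\<omega> \<in> {\<omega>\<in>space M. norm (\<theta>hat T \<omega> - \<theta>s) > e}"
        then have \<omega>: "\<omega> \<in> space M" "norm (\<theta>hat T \<omega> - \<theta>s) > e" by auto
        have th: "norm (\<theta>hat T \<omega>) \<le> R" by (rule bd[OF T1 \<omega>(1)])
        then obtain v where v: "v \<in> N" "dist v (\<theta>hat T \<omega>) < \<delta>" using N(3) by (auto simp: subset_iff)
        have vR: "norm v \<le> R" using v(1) N(2) by auto
        have vd: "norm (\<theta>hat T \<omega> - v) \<le> \<delta>" using v(2) by (simp add: dist_norm norm_minus_commute)
        have "norm (U T \<omega>) > c / 4" if "\<bar>\<phi>_mean T \<omega>\<bar> \<le> K"
        proof -
          have "c \<le> norm (score_mean (\<theta>hat T \<omega>))" by (rule c_le[OF \<omega>(2)])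
          moreover have "norm (score_mean (\<theta>hat T \<omega>)) \<le> norm (score_mean (\<theta>hat T \<omega>) - score_mean v) + norm (G T v \<omega> - score_mean v) + norm (G T (\<theta>hat T \<omega>) \<omega> - G T v \<omega>) + norm (G T (\<theta>hat T \<omega>) \<omega>)"
          proof -
            have "(score_mean (\<theta>hat T \<omega>) - score_mean v) - (G T v \<omega> - score_mean v) - (G T (\<theta>hat T \<omega>) \<omega> - G T v \<omega>) + G T (\<theta>hat T \<omega>) \<omega> = score_mean (\<theta>hat T \<omega>)"
              by simp
            note eq = this
            have "norm (p - q - s + z) \<le> norm p + norm q + norm s + norm z" for p q s z :: "real^'d"
              using norm_triangle_ineq[of "p - q - s" z] norm_triangle_ineq4[of "p - q" s] norm_triangle_ineq4[of p q] by linarith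
            from this[of "score_mean (\<theta>hat T \<omega>) - score_mean v" "G T v \<omega> - score_mean v" "G T (\<theta>hat T \<omega>) \<omega> - G T v \<omega>" "G T (\<theta>hat T \<omega>) \<omega>"]
            show ?thesis by (simp only: eq)
          qed
          moreover have "norm (score_mean (\<theta>hat T \<omega>) - score_mean v) \<le> E * \<delta>"
            using order_trans[OF score_mean_lipschitz[OF th vR] mult_left_mono[OF vd]] E unfolding E_def by simp
          moreover have "norm (G T (\<theta>hat T \<omega>) \<omega> - G T v \<omega>) \<le> K * \<delta>"
          proof -
            have "norm (G T (\<theta>hat T \<omega>) \<omega> - G T v \<omega>) \<le> \<phi>_mean T \<omega> * norm (\<theta>hat T \<omega> - v)" by (rule G_lipschitz[OF \<omega>(1) th vR])
            also have "\<dots> \<le> K * \<delta>" using that vd K(1) by (intro mult_mono) auto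
            finally show ?thesis .
          qed
          moreover have "norm (G T v \<omega> - score_mean v) \<le> (\<Sum>v\<in>N. norm (G T v \<omega> - score_mean v))"
            by (rule member_le_sum[OF v(1)]) (use N(1) in auto)
          moreover have "E * \<delta> + K * \<delta> = c / 4" using \<delta>(2) by (simp add: distrib_right)
          moreover have "U T \<omega> \<le> norm (U T \<omega>)" by simp
          ultimately show ?thesis using c unfolding U_def by linarith
        qed
        then show "\<omega> \<in> {\<omega>\<in>space M. \<bar>\<phi>_mean T \<omega>\<bar> > K} \<union> {\<omega>\<in>space M. norm (U T \<omega>) > c / 4}"
          using \<omega>(1) by (cases "\<bar>\<phi>_mean T \<omega>\<bar> \<le> K") auto
      qed
    qed measurable
    also have "\<dots> \<le> prob {\<omega>\<in>space M. \<bar>\<phi>_mean T \<omega>\<bar> > K} + prob {\<omega>\<in>space M. norm (U T \<omega>) > c / 4}"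
      by (intro measure_Un_le) measurable
    also have "\<dots> < r" using K(2)[OF T1] n0[of T] T by simp
    finally show ?thesis by simp
  qed
  then show "\<exists>no. \<forall>n\<ge>no. norm (prob {\<omega>\<in>space M. norm (\<theta>hat n \<omega> - \<theta>s) > e} - 0) < r" by (intro exI[of _ "max n0 1"] allI impI)
qed

end

lemma integrable_matrix:
  fixes F :: "'x \<Rightarrow> real^'n^'m"
  assumes "\<And>i j. integrable N (\<lambda>x. F x $ i $ j)" shows "integrable N F"
proof -
  have "F = (\<lambda>x. \<Sum>i\<in>UNIV. \<Sum>j\<in>UNIV. F x $ i $ j *\<^sub>R axis i (axis j 1))"
  proof
    fix x
    have "(\<Sum>i\<in>UNIV. \<Sum>j\<in>UNIV. F x $ i $ j *\<^sub>R axis i (axis j 1)) $ k $ l = F x $ k $ l" for k l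
    proof -
      have "(\<Sum>i\<in>UNIV. \<Sum>j\<in>UNIV. F x $ i $ j *\<^sub>R axis i (axis j 1)) $ k $ l = (\<Sum>i\<in>UNIV. \<Sum>j\<in>UNIV. if j = l then (if i = k then F x $ i $ j else 0) else 0)"
        unfolding sum_component by (intro sum.cong refl) (auto simp: axis_def)
      also have "\<dots> = F x $ k $ l" by simp
      finally show ?thesis .
    qed
    then show "F x = (\<Sum>i\<in>UNIV. \<Sum>j\<in>UNIV. F x $ i $ j *\<^sub>R axis i (axis j 1))" by (simp add: vec_eq_iff)
  qed
  moreover have "integrable N (\<lambda>x. \<Sum>i\<in>UNIV. \<Sum>j\<in>UNIV. F x $ i $ j *\<^sub>R (axis i (axis j 1) :: real^'n^'m))"
    by (intro Bochner_Integration.integrable_sum integrable_scaleR_left assms)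
  ultimately show ?thesis by simp
qed

lemma integral_matrix_component:
  fixes F :: "'x \<Rightarrow> real^'n^'m"
  assumes "\<And>i j. integrable N (\<lambda>x. F x $ i $ j)"
  shows "integral\<^sup>L N F $ i $ j = (\<integral>x. F x $ i $ j \<partial>N)"
  using integral_bounded_linear[OF bounded_linear_compose[OF bounded_linear_vec_nth[of j] bounded_linear_vec_nth[of i]] integrable_matrix[OF assms]]
  by simp

lemma sum_matrix_vector_mult:
  fixes B :: "'i \<Rightarrow> real^'n^'m"
  shows "(\<Sum>i\<in>I. B i) *v x = (\<Sum>i\<in>I. B i *v x)"
  by (induction I rule: infinite_finite_induct) (simp_all add: matrix_vector_mult_add_rdistrib)

lemma borel_measurable_matrix_vector_mult:
  fixes B :: "real^'n^'m"
  assumes "f \<in> borel_measurable N" shows "(\<lambda>x. B *v f x) \<in> borel_measurable N"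
  by (rule measurable_compose[OF assms], rule borel_measurable_continuous_onI)
     (rule linear_continuous_on[OF matrix_vector_mul_bounded_linear])

context prob_space begin

lemma tendsto_zero_in_prob_cmult:
  fixes Z :: "nat \<Rightarrow> 'a \<Rightarrow> real"
  assumes "\<And>n. n \<ge> 1 \<Longrightarrow> random_variable borel (Z n)" "tendsto_zero_in_prob M Z"
  shows "tendsto_zero_in_prob M (\<lambda>n \<omega>. c * Z n \<omega>)"
proof -
  have "bounded_in_prob (\<lambda>_ _. c)"
    unfolding bounded_in_prob_def by (auto intro!: exI[of _ "\<bar>c\<bar> + 1"])
  from tendsto_zero_in_prob_mult_bounded[OF assms _ this] show ?thesis by (simp add: mult.commute)
qed

end

section \<open>Linearization at the true parameter\<close>

context ipw_z_estimation begin

abbreviation "Jinv \<equiv> matrix_inv J"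
abbreviation "jac_mean i j T \<omega> \<equiv> (\<Sum>t=1..T. ipw t \<omega> * score_at (jac_ext i j) t \<omega>) / real T"

text \<open>An entrywise distance, since the law of large numbers is available entry by entry; it
  dominates the operator norm of the difference.\<close>

definition jac_error :: "nat \<Rightarrow> 'w \<Rightarrow> real" where
  "jac_error T \<omega> = (\<Sum>i\<in>UNIV. \<Sum>j\<in>UNIV. \<bar>jac_mean i j T \<omega> - J $ i $ j\<bar>)"

definition \<Phi>_mean :: "nat \<Rightarrow> 'w \<Rightarrow> real" where
  "\<Phi>_mean T \<omega> = (\<Sum>t=1..T. ipw t \<omega> * score_at (\<lambda>(x, y). \<Phi> x y) t \<omega>) / real T"

text \<open>The multiplier of \<open>norm (\<theta> - \<theta>s)\<close> in the linearization error,
  with \<open>r\<close> standing for that distance: sampling error of the Jacobian plus the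
  second-order remainder. It is o_p(1) along any distance that tends to 0 in probability.\<close>

definition taylor_rate :: "nat \<Rightarrow> 'w \<Rightarrow> real \<Rightarrow> real" where
  "taylor_rate T \<omega> r = jac_error T \<omega> + real CARD('d) * (\<Phi>_mean T \<omega> * r)"

lemma jac_ext_generic_le: "\<omega> \<in> space M \<Longrightarrow> \<bar>jac_ext i j (X0 \<omega>, Y0 \<omega> $ a)\<bar> \<le> \<phi> (X0 \<omega>) (Y0 \<omega> $ a)"
  unfolding jac_ext_eq[OF generic_context_mem]
  by (rule order_trans[OF matrix_entry_le_spectral_norm \<phi>_bound[OF generic_context_mem]]) (use \<theta>s_bound in auto)

lemma jac_ext_generic_rv: "random_variable borel (\<lambda>\<omega>. jac_ext i j (X0 \<omega>, Y0 \<omega> $ a))"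
  by (rule measurable_compose[OF _ jac_ext_measurable]) (use generic_context_rv generic_outcomes_rv in measurable)

lemma jac_ext_square_integrable: "integrable M (\<lambda>\<omega>. (jac_ext i j (X0 \<omega>, Y0 \<omega> $ a))\<^sup>2)"
proof (rule Bochner_Integration.integrable_bound[OF \<phi>_moment])
  show "random_variable borel (\<lambda>\<omega>. (jac_ext i j (X0 \<omega>, Y0 \<omega> $ a))\<^sup>2)" using jac_ext_generic_rv by measurable
  show "AE \<omega> in M. norm ((jac_ext i j (X0 \<omega>, Y0 \<omega> $ a))\<^sup>2) \<le> norm ((\<phi> (X0 \<omega>) (Y0 \<omega> $ a))\<^sup>2)"
  proof (rule AE_I2)
    fix \<omega> assume "\<omega> \<in> space M"
    from power_mono[OF jac_ext_generic_le[OF this], of i j 2]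
    show "norm ((jac_ext i j (X0 \<omega>, Y0 \<omega> $ a))\<^sup>2) \<le> norm ((\<phi> (X0 \<omega>) (Y0 \<omega> $ a))\<^sup>2)" by simp
  qed
qed

lemma J_component: "J $ i $ j = expectation (\<lambda>\<omega>. jac_ext i j (X0 \<omega>, Y0 \<omega> $ a))"
proof -
  have eq: "jac_ext i j (X0 \<omega>, Y0 \<omega> $ a) = score_jac (X0 \<omega>) (Y0 \<omega> $ a) $ i $ j" if "\<omega> \<in> space M" for \<omega> i j
    using that by (simp add: jac_ext_eq generic_context_mem)
  have "integrable M (\<lambda>\<omega>. jac_ext i j (X0 \<omega>, Y0 \<omega> $ a))" for i j
    by (rule integrable_of_square[OF jac_ext_generic_rv jac_ext_square_integrable])
  then have "integrable M (\<lambda>\<omega>. score_jac (X0 \<omega>) (Y0 \<omega> $ a) $ i $ j)" for i j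
    by (rule Bochner_Integration.integrable_cong[THEN iffD1, rotated 2]) (simp_all add: eq)
  from integral_matrix_component[OF this]
  have "J $ i $ j = expectation (\<lambda>\<omega>. score_jac (X0 \<omega>) (Y0 \<omega> $ a) $ i $ j)" unfolding score_jacobian_def .
  also have "\<dots> = expectation (\<lambda>\<omega>. jac_ext i j (X0 \<omega>, Y0 \<omega> $ a))"
    by (intro Bochner_Integration.integral_cong) (simp_all add: eq)
  finally show ?thesis .
qed

lemma jac_mean_rv: "random_variable borel (jac_mean i j T)"
  by (intro borel_measurable_divide borel_measurable_sum ipw_term_rv jac_ext_measurable borel_measurable_const) auto

lemma jac_error_rv: "random_variable borel (jac_error T)"
  unfolding jac_error_def by (intro borel_measurable_sum borel_measurable_abs borel_measurable_diff jac_mean_rv borel_measurable_const)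

lemma jac_error_tendsto: "tendsto_zero_in_prob M jac_error"
proof -
  have "tendsto_zero_in_prob M (\<lambda>T \<omega>. \<bar>jac_mean i j T \<omega> - J $ i $ j\<bar>)" for i j
    using ipw_mean_tendsto[OF jac_ext_measurable jac_ext_square_integrable, of i j] unfolding J_component by (simp add: tendsto_zero_in_prob_def)
  then show ?thesis unfolding jac_error_def[abs_def]
    by (intro tendsto_zero_in_prob_sum finite borel_measurable_sum borel_measurable_abs borel_measurable_diff jac_mean_rv borel_measurable_const)
qed

lemma \<Phi>_mean_rv: "random_variable borel (\<Phi>_mean T)"
  unfolding \<Phi>_mean_def
  by (intro borel_measurable_divide borel_measurable_sum ipw_term_rv \<Phi>_measurable borel_measurable_const) auto

lemma \<Phi>_mean_bounded: "bounded_in_prob \<Phi>_mean"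
  unfolding \<Phi>_mean_def[abs_def] using \<Phi>_moment by (intro ipw_mean_bounded \<Phi>_measurable) simp

lemma taylor_rate_tendsto:
  assumes "\<And>T. T \<ge> 1 \<Longrightarrow> random_variable borel (r T)" "tendsto_zero_in_prob M r"
  shows "tendsto_zero_in_prob M (\<lambda>T \<omega>. taylor_rate T \<omega> (r T \<omega>))"
    and "\<And>T. T \<ge> 1 \<Longrightarrow> random_variable borel (\<lambda>\<omega>. taylor_rate T \<omega> (r T \<omega>))"
proof -
  have "tendsto_zero_in_prob M (\<lambda>T \<omega>. r T \<omega> * \<Phi>_mean T \<omega>)"
    by (rule tendsto_zero_in_prob_mult_bounded[OF assms \<Phi>_mean_rv \<Phi>_mean_bounded])
  then have 1: "tendsto_zero_in_prob M (\<lambda>T \<omega>. \<Phi>_mean T \<omega> * r T \<omega>)" by (simp only: mult.commute)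
  have m: "random_variable borel (\<lambda>\<omega>. \<Phi>_mean T \<omega> * r T \<omega>)" if "T \<ge> 1" for T
    using \<Phi>_mean_rv assms(1)[OF that] by measurable
  have 2: "tendsto_zero_in_prob M (\<lambda>T \<omega>. real CARD('d) * (\<Phi>_mean T \<omega> * r T \<omega>))"
    by (rule tendsto_zero_in_prob_cmult[OF m 1])
  have m2: "random_variable borel (\<lambda>\<omega>. real CARD('d) * (\<Phi>_mean T \<omega> * r T \<omega>))" if "T \<ge> 1" for T
    using m[OF that] by measurable
  show "tendsto_zero_in_prob M (\<lambda>T \<omega>. taylor_rate T \<omega> (r T \<omega>))"
    unfolding taylor_rate_def by (rule tendsto_zero_in_prob_add[OF jac_error_rv jac_error_tendsto m2 2])
  show "\<And>T. T \<ge> 1 \<Longrightarrow> random_variable borel (\<lambda>\<omega>. taylor_rate T \<omega> (r T \<omega>))"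
    unfolding taylor_rate_def using m2 jac_error_rv by (intro borel_measurable_add) 
qed

text \<open>Each summand is expanded with its own Jacobian at \<open>\<theta>s\<close>; the weighted
  average \<open>H\<close> of these Jacobians is then exchanged for the deterministic
  \<open>J\<close> at the cost of \<open>jac_error\<close>.\<close>

lemma G_taylor:
  assumes \<omega>: "\<omega> \<in> space M" and \<theta>: "norm (\<theta> - \<theta>s) \<le> \<epsilon>0"
  shows "norm (G T \<theta> \<omega> - G T \<theta>s \<omega> - J *v (\<theta> - \<theta>s)) \<le> taylor_rate T \<omega> (norm (\<theta> - \<theta>s)) * norm (\<theta> - \<theta>s)"
proof -
  let ?\<Delta> = "\<theta> - \<theta>s" and ?jac = "\<lambda>t. score_jac (X t \<omega>) (Y t \<omega> $ a)" and ?g = "\<lambda>t \<theta>. g (X t \<omega>) (Y t \<omega> $ a) \<theta>"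
  define H where "H = (1 / real T) *\<^sub>R (\<Sum>t=1..T. ipw t \<omega> *\<^sub>R ?jac t)"
  have H: "H $ i $ j = jac_mean i j T \<omega>" for i j
    unfolding H_def using \<omega> by (simp add: sum_component jac_ext_eq context_mem)
  have Hv: "H *v ?\<Delta> = (1 / real T) *\<^sub>R (\<Sum>t=1..T. ipw t \<omega> *\<^sub>R (?jac t *v ?\<Delta>))"
    unfolding H_def by (simp only: scaleR_matrix_vector_assoc[symmetric] sum_matrix_vector_mult)
  have eq: "G T \<theta> \<omega> - G T \<theta>s \<omega> - H *v ?\<Delta> = (1 / real T) *\<^sub>R (\<Sum>t=1..T. ipw t \<omega> *\<^sub>R (?g t \<theta> - ?g t \<theta>s - ?jac t *v ?\<Delta>))"
    unfolding G_eq[OF \<omega>] Hv by (simp only: scaleR_diff_right sum_subtractf)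
  have "norm (\<Sum>t=1..T. ipw t \<omega> *\<^sub>R (?g t \<theta> - ?g t \<theta>s - ?jac t *v ?\<Delta>)) \<le> (\<Sum>t=1..T. ipw t \<omega> * (real CARD('d) * \<Phi> (X t \<omega>) (Y t \<omega> $ a) * (norm ?\<Delta>)\<^sup>2))"
  proof (rule sum_norm_le)
    fix t assume "t \<in> {1..T}"
    then have t: "t \<ge> 1" by simp
    note x = context_mem[OF t \<omega>]
    show "norm (ipw t \<omega> *\<^sub>R (?g t \<theta> - ?g t \<theta>s - ?jac t *v ?\<Delta>)) \<le> ipw t \<omega> * (real CARD('d) * \<Phi> (X t \<omega>) (Y t \<omega> $ a) * (norm ?\<Delta>)\<^sup>2)"
      unfolding norm_scaleR abs_of_nonneg[OF ipw_nonneg[OF t \<omega>]]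
      by (intro mult_left_mono second_order_remainder[OF twice_diff[OF x] \<Phi>_bound[OF x] \<theta>] ipw_nonneg t \<omega>)
  qed
  then have "norm (G T \<theta> \<omega> - G T \<theta>s \<omega> - H *v ?\<Delta>) \<le> (1 / real T) * (\<Sum>t=1..T. ipw t \<omega> * (real CARD('d) * \<Phi> (X t \<omega>) (Y t \<omega> $ a) * (norm ?\<Delta>)\<^sup>2))"
    unfolding eq norm_scaleR by (intro mult_mono) auto
  also have "(1 / real T) * (\<Sum>t=1..T. ipw t \<omega> * (real CARD('d) * \<Phi> (X t \<omega>) (Y t \<omega> $ a) * (norm ?\<Delta>)\<^sup>2)) = real CARD('d) * (\<Phi>_mean T \<omega> * norm ?\<Delta>) * norm ?\<Delta>"
    unfolding \<Phi>_mean_def by (simp add: sum_distrib_left sum_distrib_right sum_divide_distrib power2_eq_square mult_ac)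
  finally have 1: "norm (G T \<theta> \<omega> - G T \<theta>s \<omega> - H *v ?\<Delta>) \<le> real CARD('d) * (\<Phi>_mean T \<omega> * norm ?\<Delta>) * norm ?\<Delta>" .
  have 2: "norm ((H - J) *v ?\<Delta>) \<le> jac_error T \<omega> * norm ?\<Delta>"
    using norm_matrix_mult_le_entries[of "H - J" ?\<Delta>] by (simp add: H jac_error_def)
  have split: "G T \<theta> \<omega> - G T \<theta>s \<omega> - J *v ?\<Delta> = (G T \<theta> \<omega> - G T \<theta>s \<omega> - H *v ?\<Delta>) + (H - J) *v ?\<Delta>"
    by (simp add: matrix_vector_mult_diff_rdistrib)
  have "norm (G T \<theta> \<omega> - G T \<theta>s \<omega> - J *v ?\<Delta>) \<le> norm (G T \<theta> \<omega> - G T \<theta>s \<omega> - H *v ?\<Delta>) + norm ((H - J) *v ?\<Delta>)"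
    unfolding split by (rule norm_triangle_ineq)
  then show ?thesis using 1 2 unfolding taylor_rate_def distrib_right by linarith
qed

lemma J_inverse: "J *v (Jinv *v v) = v" "Jinv *v (J *v v) = v"
proof -
  have "J ** Jinv = mat 1 \<and> Jinv ** J = mat 1"
    using nonsingular unfolding invertible_def matrix_inv_def by (rule someI_ex)
  then show "J *v (Jinv *v v) = v" "Jinv *v (J *v v) = v" by (simp_all add: matrix_vector_mul_assoc)
qed

text \<open>The scaled solution of the linearized equation: setting
  \<open>G T \<theta>s \<omega> + J *v (\<theta> - \<theta>s)\<close> to 0 gives this value of
  \<open>sqrt (real T) *\<^sub>R (\<theta> - \<theta>s)\<close>.\<close>

definition leading_term :: "nat \<Rightarrow> 'w \<Rightarrow> real^'d" where
  "leading_term T \<omega> = - (Jinv *v (sqrt (real T) *\<^sub>R G T \<theta>s \<omega>))"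

abbreviation "asym_cov \<equiv> Jinv ** weighted_information M X0 Y0 \<pi>bar a g \<theta>s ** transpose Jinv"

text \<open>The influence function in direction \<open>u\<close>, before weighting. It makes every
  projection of the leading term a normalized sum of weighted scalar terms, to which the scalar
  limit theorem applies; the sign is that of \<open>leading_term\<close>.\<close>

definition influence :: "real^'d \<Rightarrow> (real^'p) \<times> real \<Rightarrow> real" where
  "influence u z = - ((transpose Jinv *v u) \<bullet> g_ext \<theta>s z)"

lemma influence_measurable: "influence u \<in> borel_measurable (borel \<Otimes>\<^sub>M borel)"
  unfolding influence_def[abs_def] using g_ext_measurable by measurable

lemma leading_term_inner:
  assumes \<omega>: "\<omega> \<in> space M" and T: "T \<ge> 1"
  shows "u \<bullet> leading_term T \<omega> = (\<Sum>t=1..T. ipw t \<omega> * score_at (influence u) t \<omega>) / sqrt (real T)"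
proof -
  let ?w = "transpose Jinv *v u"
  have "u \<bullet> leading_term T \<omega> = - (?w \<bullet> (sqrt (real T) *\<^sub>R G T \<theta>s \<omega>))"
    unfolding leading_term_def transpose_matrix_vector by (simp only: dot_lmul_matrix inner_minus_right)
  also have "\<dots> = (sqrt (real T) / real T) * (\<Sum>t=1..T. ipw t \<omega> * score_at (influence u) t \<omega>)"
    unfolding G_eq[OF \<omega>] using \<omega> by (simp add: inner_sum_right influence_def g_ext_eq context_mem sum_negf)
  also have "sqrt (real T) / real T = 1 / sqrt (real T)" using T by (simp add: real_div_sqrt divide_simps)
  finally show ?thesis by simp
qed

lemma influence_generic_rv: "random_variable borel (\<lambda>\<omega>. influence u (X0 \<omega>, Y0 \<omega> $ a))"
  by (rule measurable_compose[OF _ influence_measurable]) (use generic_context_rv generic_outcomes_rv in measurable)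

lemma influence_generic: "\<omega> \<in> space M \<Longrightarrow> influence u (X0 \<omega>, Y0 \<omega> $ a) = - ((transpose Jinv *v u) \<bullet> g (X0 \<omega>) (Y0 \<omega> $ a) \<theta>s)"
  by (simp add: influence_def g_ext_generic)

lemma influence_fourth_moment: "integrable M (\<lambda>\<omega>. (influence u (X0 \<omega>, Y0 \<omega> $ a)) ^ 4)"
proof (rule Bochner_Integration.integrable_bound)
  let ?w = "transpose Jinv *v u"
  show "integrable M (\<lambda>\<omega>. norm ?w ^ 4 * norm (g (X0 \<omega>) (Y0 \<omega> $ a) \<theta>s) ^ 4)" by (rule integrable_mult_right[OF fourth_moment])
  show "random_variable borel (\<lambda>\<omega>. (influence u (X0 \<omega>, Y0 \<omega> $ a)) ^ 4)" using influence_generic_rv by measurable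
  show "AE \<omega> in M. norm ((influence u (X0 \<omega>, Y0 \<omega> $ a)) ^ 4) \<le> norm (norm ?w ^ 4 * norm (g (X0 \<omega>) (Y0 \<omega> $ a) \<theta>s) ^ 4)"
  proof (rule AE_I2)
    fix \<omega> assume \<omega>: "\<omega> \<in> space M"
    have "\<bar>influence u (X0 \<omega>, Y0 \<omega> $ a)\<bar> \<le> norm ?w * norm (g (X0 \<omega>) (Y0 \<omega> $ a) \<theta>s)"
      unfolding influence_generic[OF \<omega>] using Cauchy_Schwarz_ineq2 by simp
    from power_mono[OF this abs_ge_zero, of 4]
    show "norm ((influence u (X0 \<omega>, Y0 \<omega> $ a)) ^ 4) \<le> norm (norm ?w ^ 4 * norm (g (X0 \<omega>) (Y0 \<omega> $ a) \<theta>s) ^ 4)"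
      by (simp add: power_mult_distrib power_abs)
  qed
qed

lemma influence_second_moment: "integrable M (\<lambda>\<omega>. (influence u (X0 \<omega>, Y0 \<omega> $ a))\<^sup>2)"
proof (rule integrable_of_square)
  show "random_variable borel (\<lambda>\<omega>. (influence u (X0 \<omega>, Y0 \<omega> $ a))\<^sup>2)" using influence_generic_rv by measurable
  show "integrable M (\<lambda>\<omega>. ((influence u (X0 \<omega>, Y0 \<omega> $ a))\<^sup>2)\<^sup>2)" using influence_fourth_moment by simp
qed

lemma influence_mean: "expectation (\<lambda>\<omega>. influence u (X0 \<omega>, Y0 \<omega> $ a)) = 0"
proof -
  let ?w = "transpose Jinv *v u"
  have "expectation (\<lambda>\<omega>. influence u (X0 \<omega>, Y0 \<omega> $ a)) = expectation (\<lambda>\<omega>. - (?w \<bullet> g (X0 \<omega>) (Y0 \<omega> $ a) \<theta>s))"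
    by (intro Bochner_Integration.integral_cong) (simp_all add: influence_generic)
  also have "\<dots> = - (?w \<bullet> score_mean \<theta>s)"
    using integral_bounded_linear[OF bounded_linear_inner_right g_integrable, of \<theta>s ?w] \<theta>s_bound by simp
  finally show ?thesis by (simp add: root)
qed

text \<open>The limit propensity inherits the bound \<open>\<pi>min\<close>, so its inverse is
  almost surely bounded and the product of two square integrable components stays integrable. This
  licenses reading the matrix integral entry by entry.\<close>

lemma information_component_integrable:
  "integrable M (\<lambda>\<omega>. ((1 / \<pi>bar (X0 \<omega>) $ a) *\<^sub>R outer_prod (g (X0 \<omega>) (Y0 \<omega> $ a) \<theta>s)) $ i $ j)"
proof -
  have gi: "integrable M (\<lambda>\<omega>. (g_ext \<theta>s (X0 \<omega>, Y0 \<omega> $ a) $ i)\<^sup>2)" for i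
    using \<theta>s_bound by (intro g_component_square_integrable) simp
  have gm: "random_variable borel (\<lambda>\<omega>. g_ext \<theta>s (X0 \<omega>, Y0 \<omega> $ a) $ i)" for i
    by (rule measurable_compose[OF _ g_ext_component_measurable]) (use generic_context_rv generic_outcomes_rv in measurable)
  note [measurable] = gm q_ext_measurable generic_context_rv
  have "integrable M (\<lambda>\<omega>. (1 / q_ext (X0 \<omega>)) * (g_ext \<theta>s (X0 \<omega>, Y0 \<omega> $ a) $ i * g_ext \<theta>s (X0 \<omega>, Y0 \<omega> $ a) $ j))"
  proof (rule Bochner_Integration.integrable_bound)
    show "integrable M (\<lambda>\<omega>. (1 / \<pi>min) * (g_ext \<theta>s (X0 \<omega>, Y0 \<omega> $ a) $ i * g_ext \<theta>s (X0 \<omega>, Y0 \<omega> $ a) $ j))"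
      by (intro integrable_mult_right integrable_mult_L2 gm gi)
    show "random_variable borel (\<lambda>\<omega>. (1 / q_ext (X0 \<omega>)) * (g_ext \<theta>s (X0 \<omega>, Y0 \<omega> $ a) $ i * g_ext \<theta>s (X0 \<omega>, Y0 \<omega> $ a) $ j))" by measurable
    show "AE \<omega> in M. norm ((1 / q_ext (X0 \<omega>)) * (g_ext \<theta>s (X0 \<omega>, Y0 \<omega> $ a) $ i * g_ext \<theta>s (X0 \<omega>, Y0 \<omega> $ a) $ j)) \<le> norm ((1 / \<pi>min) * (g_ext \<theta>s (X0 \<omega>, Y0 \<omega> $ a) $ i * g_ext \<theta>s (X0 \<omega>, Y0 \<omega> $ a) $ j))"
      using q_ext_ge
    proof eventually_elim
      case (elim \<omega>)
      then have "\<bar>1 / q_ext (X0 \<omega>)\<bar> \<le> \<bar>1 / \<pi>min\<bar>" using \<pi>min_pos by (simp add: frac_le)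
      then show ?case unfolding real_norm_def abs_mult[of "1 / q_ext (X0 \<omega>)"] abs_mult[of "1 / \<pi>min"] by (rule mult_right_mono) simp
    qed
  qed
  then show ?thesis
    by (rule Bochner_Integration.integrable_cong[THEN iffD1, rotated 2])
       (simp_all add: outer_prod_def g_ext_generic q_ext_eq generic_context_mem)
qed

lemma information_quadratic:
  "w \<bullet> (weighted_information M X0 Y0 \<pi>bar a g \<theta>s *v w) =
    expectation (\<lambda>\<omega>. 1 / q_ext (X0 \<omega>) * (w \<bullet> g (X0 \<omega>) (Y0 \<omega> $ a) \<theta>s)\<^sup>2)"
proof -
  let ?F = "\<lambda>\<omega>. (1 / \<pi>bar (X0 \<omega>) $ a) *\<^sub>R outer_prod (g (X0 \<omega>) (Y0 \<omega> $ a) \<theta>s)"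
  have outer: "w \<bullet> (outer_prod v *v w) = (w \<bullet> v)\<^sup>2" for v
    by (simp add: outer_prod_def matrix_vector_mult_def inner_vec_def power2_eq_square sum_distrib_left sum_distrib_right mult_ac)
  have "bounded_linear (\<lambda>B :: real^'d^'d. w \<bullet> (B *v w))"
    by (rule linear_conv_bounded_linear[THEN iffD1], rule linearI)
       (simp_all add: matrix_vector_mult_add_rdistrib inner_add_right scaleR_matrix_vector_assoc[symmetric])
  from integral_bounded_linear[OF this integrable_matrix[OF information_component_integrable]]
  have "w \<bullet> (weighted_information M X0 Y0 \<pi>bar a g \<theta>s *v w) = expectation (\<lambda>\<omega>. w \<bullet> (?F \<omega> *v w))"
    unfolding weighted_information_def by simp
  also have "\<dots> = expectation (\<lambda>\<omega>. 1 / q_ext (X0 \<omega>) * (w \<bullet> g (X0 \<omega>) (Y0 \<omega> $ a) \<theta>s)\<^sup>2)"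
    by (intro Bochner_Integration.integral_cong refl)
       (simp add: scaleR_matrix_vector_assoc[symmetric] outer q_ext_eq generic_context_mem)
  finally show ?thesis .
qed

text \<open>Moving \<open>Jinv\<close> to the other side of the inner product turns the sandwich
  form into the limit variance of the scalar increments in direction \<open>u\<close>; positive
  semidefiniteness of the covariance can then be read off.\<close>

lemma asym_cov_quadratic:
  "u \<bullet> (asym_cov *v u) = expectation (\<lambda>\<omega>. 1 / q_ext (X0 \<omega>) * (influence u (X0 \<omega>, Y0 \<omega> $ a))\<^sup>2)"
proof -
  let ?w = "transpose Jinv *v u"
  have "u \<bullet> (asym_cov *v u) = u \<bullet> (Jinv *v (weighted_information M X0 Y0 \<pi>bar a g \<theta>s *v ?w))"
    by (simp only: matrix_vector_mul_assoc matrix_mul_assoc)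
  also have "\<dots> = ?w \<bullet> (weighted_information M X0 Y0 \<pi>bar a g \<theta>s *v ?w)"
    unfolding transpose_matrix_vector by (simp only: dot_lmul_matrix)
  also have "\<dots> = expectation (\<lambda>\<omega>. 1 / q_ext (X0 \<omega>) * (influence u (X0 \<omega>, Y0 \<omega> $ a))\<^sup>2)"
    unfolding information_quadratic by (intro Bochner_Integration.integral_cong refl) (simp add: influence_generic)
  finally show ?thesis .
qed

lemma asym_cov_psd: "0 \<le> u \<bullet> (asym_cov *v u)"
  unfolding asym_cov_quadratic
  by (intro Bochner_Integration.integral_nonneg mult_nonneg_nonneg) (simp_all add: q_ext_bounds generic_context_mem)

lemma asym_cov_symmetric: "transpose asym_cov = asym_cov"
proof -
  have "transpose (weighted_information M X0 Y0 \<pi>bar a g \<theta>s) = weighted_information M X0 Y0 \<pi>bar a g \<theta>s"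
    unfolding weighted_information_def transpose_def vec_eq_iff vec_lambda_beta integral_matrix_component[OF information_component_integrable]
    by (simp add: outer_prod_def mult.commute)
  then show ?thesis by (simp only: matrix_transpose_mul transpose_transpose matrix_mul_assoc)
qed

lemma leading_term_rv: "random_variable borel (leading_term T)"
  unfolding leading_term_def[abs_def]
  by (rule borel_measurable_uminus, rule borel_measurable_matrix_vector_mult, rule borel_measurable_scaleR[OF borel_measurable_const G_rv])

end

section \<open>Limit law of the leading term and its transfer to the estimator\<close>

context ipw_z_estimation begin

lemma leading_term_component_moment:
  assumes T: "T \<ge> 1"
  shows "integrable M (\<lambda>\<omega>. (leading_term T \<omega> $ i)\<^sup>2)"
    and "expectation (\<lambda>\<omega>. (leading_term T \<omega> $ i)\<^sup>2) \<le> (1 / \<pi>min)\<^sup>2 * expectation (\<lambda>\<omega>. (influence (axis i 1) (X0 \<omega>, Y0 \<omega> $ a))\<^sup>2)"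
proof -
  let ?S = "\<lambda>\<omega>. \<Sum>t=1..T. ipw t \<omega> * score_at (influence (axis i 1)) t \<omega>"
  let ?C = "(1 / \<pi>min)\<^sup>2 * expectation (\<lambda>\<omega>. (influence (axis i 1) (X0 \<omega>, Y0 \<omega> $ a))\<^sup>2)"
  have eq: "(leading_term T \<omega> $ i)\<^sup>2 = (?S \<omega>)\<^sup>2 / real T" if "\<omega> \<in> space M" for \<omega>
    using leading_term_inner[OF that T, of "axis i 1"] by (simp add: inner_axis' power_divide)
  have S: "integrable M (\<lambda>\<omega>. (?S \<omega>)\<^sup>2)" "expectation (\<lambda>\<omega>. (?S \<omega>)\<^sup>2) \<le> real T * ?C"
    using ipw_sum_second_moment[OF influence_measurable[of "axis i 1"] influence_second_moment, of T] by (simp_all only: influence_mean diff_0_right)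
  have "integrable M (\<lambda>\<omega>. (?S \<omega>)\<^sup>2 / real T)" using S(1) by (rule integrable_divide_zero)
  then show "integrable M (\<lambda>\<omega>. (leading_term T \<omega> $ i)\<^sup>2)"
    by (rule Bochner_Integration.integrable_cong[THEN iffD1, rotated 2]) (simp_all add: eq)
  have "expectation (\<lambda>\<omega>. (leading_term T \<omega> $ i)\<^sup>2) = expectation (\<lambda>\<omega>. (?S \<omega>)\<^sup>2 / real T)"
    by (rule Bochner_Integration.integral_cong) (simp_all only: eq)
  also have "\<dots> = expectation (\<lambda>\<omega>. (?S \<omega>)\<^sup>2) / real T" by (rule integral_divide_zero)
  also have "\<dots> \<le> (real T * ?C) / real T" by (rule divide_right_mono[OF S(2)]) simp
  also have "\<dots> = ?C" using T by simp
  finally show "expectation (\<lambda>\<omega>. (leading_term T \<omega> $ i)\<^sup>2) \<le> ?C" .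
qed

text \<open>Orthogonality of the increments makes the second moment of the sum linear in
  \<open>T\<close>, which the scaling cancels. The uniform bound feeds the continuity theorem, the
  Slutsky step and boundedness in probability.\<close>

lemma leading_term_moment:
  shows "T \<ge> 1 \<Longrightarrow> integrable M (\<lambda>\<omega>. (norm (leading_term T \<omega>))\<^sup>2)"
    and "\<exists>C. \<forall>T\<ge>1. expectation (\<lambda>\<omega>. (norm (leading_term T \<omega>))\<^sup>2) \<le> C"
proof -
  have n2: "(norm v)\<^sup>2 = (\<Sum>i\<in>UNIV. (v $ i)\<^sup>2)" for v :: "real^'d"
    by (simp add: norm_vec_def L2_set_def sum_nonneg)
  show "integrable M (\<lambda>\<omega>. (norm (leading_term T \<omega>))\<^sup>2)" if "T \<ge> 1"
    unfolding n2 by (intro Bochner_Integration.integrable_sum leading_term_component_moment that)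
  show "\<exists>C. \<forall>T\<ge>1. expectation (\<lambda>\<omega>. (norm (leading_term T \<omega>))\<^sup>2) \<le> C"
  proof (intro exI allI impI)
    fix T :: nat assume T: "T \<ge> 1"
    have "expectation (\<lambda>\<omega>. (norm (leading_term T \<omega>))\<^sup>2) = (\<Sum>i\<in>UNIV. expectation (\<lambda>\<omega>. (leading_term T \<omega> $ i)\<^sup>2))"
      unfolding n2 by (intro Bochner_Integration.integral_sum leading_term_component_moment T)
    also have "\<dots> \<le> (\<Sum>i\<in>UNIV. (1 / \<pi>min)\<^sup>2 * expectation (\<lambda>\<omega>. (influence (axis i 1) (X0 \<omega>, Y0 \<omega> $ a))\<^sup>2))"
      by (intro sum_mono leading_term_component_moment T)
    finally show "expectation (\<lambda>\<omega>. (norm (leading_term T \<omega>))\<^sup>2) \<le> (\<Sum>i\<in>UNIV. (1 / \<pi>min)\<^sup>2 * expectation (\<lambda>\<omega>. (influence (axis i 1) (X0 \<omega>, Y0 \<omega> $ a))\<^sup>2))" .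
  qed
qed

lemma leading_term_bounded: "bounded_in_prob (\<lambda>T \<omega>. norm (leading_term T \<omega>))"
proof -
  obtain C where C: "\<And>T. T \<ge> 1 \<Longrightarrow> expectation (\<lambda>\<omega>. (norm (leading_term T \<omega>))\<^sup>2) \<le> C" using leading_term_moment(2) by blast
  note [measurable] = leading_term_rv
  have le: "r \<le> 1 + r\<^sup>2" for r :: real
  proof -
    have "0 \<le> (r - 1/2)\<^sup>2" by simp
    then show ?thesis by (simp add: power2_diff power_divide)
  qed
  have i: "integrable M (\<lambda>\<omega>. norm (leading_term T \<omega>))" if T: "T \<ge> 1" for T
    by (rule integrable_of_square[OF _ leading_term_moment(1)[OF T]]) measurable
  show ?thesis
  proof (rule bounded_in_prob_expectation[OF i])
    fix T :: nat assume T: "T \<ge> 1"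
    have "expectation (\<lambda>\<omega>. \<bar>norm (leading_term T \<omega>)\<bar>) \<le> expectation (\<lambda>\<omega>. 1 + (norm (leading_term T \<omega>))\<^sup>2)"
      using i[OF T] leading_term_moment(1)[OF T] by (intro integral_mono) (simp_all add: le)
    also have "\<dots> \<le> 1 + C" using leading_term_moment(1)[OF T] C[OF T] by (simp add: prob_space)
    finally show "expectation (\<lambda>\<omega>. \<bar>norm (leading_term T \<omega>)\<bar>) \<le> 1 + C" .
  qed
qed

text \<open>The Cramer-Wold device at the level of characteristic functions: the value at
  \<open>u\<close> is that of the scalar sum for \<open>influence u\<close> at frequency 1, since
  scaling is absorbed in the direction.\<close>

lemma leading_term_tendsto: "tendsto_in_distribution M leading_term (multivariate_normal 0 asym_cov)"
proof -
  obtain C where C: "\<And>T. T \<ge> 1 \<Longrightarrow> expectation (\<lambda>\<omega>. (norm (leading_term T \<omega>))\<^sup>2) \<le> C" using leading_term_moment(2) by blast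
  note mvn = multivariate_normal_properties[OF asym_cov_symmetric asym_cov_psd]
  show ?thesis
  proof (rule levy_continuity_L2[OF prob_space_axioms mvn(1,2) leading_term_rv _ leading_term_moment(1) C mvn(4)])
    fix u :: "real^'d"
    let ?\<sigma>2 = "expectation (\<lambda>\<omega>. 1 / q_ext (X0 \<omega>) * (influence u (X0 \<omega>, Y0 \<omega> $ a))\<^sup>2)"
    have "(\<lambda>T. CLINT \<omega>|M. cis ((\<Sum>t=1..T. ipw t \<omega> * score_at (influence u) t \<omega>) / sqrt T)) \<longlonglongrightarrow> exp (- (?\<sigma>2 / 2))"
      by (rule ipw_char_tendsto[OF influence_measurable influence_fourth_moment influence_mean q_ext_measurable q_ext_bounds q_ext_ge_context q_ext_ge policy_converges_ext])
    moreover have "\<forall>\<^sub>F T in sequentially. (CLINT \<omega>|M. cis ((\<Sum>t=1..T. ipw t \<omega> * score_at (influence u) t \<omega>) / sqrt T)) = (CLINT \<omega>|M. cis (u \<bullet> leading_term T \<omega>))"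
      by (intro eventually_sequentiallyI[of 1] Bochner_Integration.integral_cong refl) (simp only: leading_term_inner)
    moreover have "(CLINT x|multivariate_normal 0 asym_cov. cis (u \<bullet> x)) = exp (- (?\<sigma>2 / 2))"
      unfolding mvn(3) asym_cov_quadratic by simp
    ultimately show "(\<lambda>T. CLINT \<omega>|M. cis (u \<bullet> leading_term T \<omega>)) \<longlonglongrightarrow> (CLINT x|multivariate_normal 0 asym_cov. cis (u \<bullet> x))"
      by (simp only: tendsto_cong)
  qed
qed

lemma leading_term_eq: "leading_term T \<omega> = sqrt (real T) *\<^sub>R (- (Jinv *v G T \<theta>s \<omega>))"
  by (simp add: leading_term_def matrix_vector_mult_scaleR)

text \<open>Linearization bounds the error by the score at \<open>\<theta>\<close> plus a small
  multiple of the scaled estimation error itself. With that multiple at most one half it can be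
  absorbed, so the scaled estimation error is bounded by the leading term and the score; the root-T
  rate comes out of the same inequality.\<close>

lemma expansion_error:
  assumes \<omega>: "\<omega> \<in> space M" and \<theta>: "norm (\<theta> - \<theta>s) \<le> \<epsilon>0"
    and small: "spectral_norm Jinv * taylor_rate T \<omega> (norm (\<theta> - \<theta>s)) \<le> 1/2"
    and nonneg: "0 \<le> taylor_rate T \<omega> (norm (\<theta> - \<theta>s))"
  shows "norm (sqrt (real T) *\<^sub>R (\<theta> - \<theta>s) - leading_term T \<omega>) \<le>
    spectral_norm Jinv * norm (sqrt (real T) *\<^sub>R G T \<theta> \<omega>) +
    2 * (spectral_norm Jinv * taylor_rate T \<omega> (norm (\<theta> - \<theta>s))) *
      (norm (leading_term T \<omega>) + spectral_norm Jinv * norm (sqrt (real T) *\<^sub>R G T \<theta> \<omega>))"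
proof -
  let ?L = "spectral_norm Jinv" and ?\<rho> = "taylor_rate T \<omega> (norm (\<theta> - \<theta>s))" and ?s = "sqrt (real T)"
  let ?W = "?s *\<^sub>R (\<theta> - \<theta>s)" and ?r = "norm (?s *\<^sub>R G T \<theta> \<omega>)" and ?Z = "leading_term T \<omega>"
  let ?E = "G T \<theta> \<omega> - G T \<theta>s \<omega> - J *v (\<theta> - \<theta>s)"
  have "?W - ?Z = ?s *\<^sub>R (Jinv *v (J *v (\<theta> - \<theta>s) + G T \<theta>s \<omega>))"
    unfolding leading_term_eq by (simp add: matrix_vector_right_distrib J_inverse scaleR_diff_right scaleR_right_distrib)
  also have "J *v (\<theta> - \<theta>s) + G T \<theta>s \<omega> = G T \<theta> \<omega> - ?E" by simp
  finally have eq: "?W - ?Z = ?s *\<^sub>R (Jinv *v (G T \<theta> \<omega> - ?E))" .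
  have "norm (?W - ?Z) = ?s * norm (Jinv *v (G T \<theta> \<omega> - ?E))" unfolding eq by simp
  also have "\<dots> \<le> ?s * (?L * (norm (G T \<theta> \<omega>) + ?\<rho> * norm (\<theta> - \<theta>s)))"
  proof (rule mult_left_mono)
    have "norm (G T \<theta> \<omega> - ?E) \<le> norm (G T \<theta> \<omega>) + ?\<rho> * norm (\<theta> - \<theta>s)"
      using norm_triangle_ineq4[of "G T \<theta> \<omega>" ?E] G_taylor[OF \<omega> \<theta>, of T] by linarith
    then show "norm (Jinv *v (G T \<theta> \<omega> - ?E)) \<le> ?L * (norm (G T \<theta> \<omega>) + ?\<rho> * norm (\<theta> - \<theta>s))"
      by (intro order_trans[OF spectral_norm_mult] mult_left_mono spectral_norm_nonneg)
  qed simp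
  also have "\<dots> = ?L * ?r + (?L * ?\<rho>) * norm ?W"
  proof -
    have "norm (?s *\<^sub>R v) = ?s * norm v" for v :: "real^'d" by simp
    then show ?thesis by (simp only: distrib_left mult_ac)
  qed
  finally have 1: "norm (?W - ?Z) \<le> ?L * ?r + (?L * ?\<rho>) * norm ?W" .
  have "(?L * ?\<rho>) * norm ?W \<le> 1/2 * norm ?W" using small by (rule mult_right_mono) simp
  \<comment> \<open>The absorption: half of \<open>w\<close> moves to the left.\<close>
  moreover have "w \<le> 2 * (z + y)" if "x \<le> 1/2 * w" "d \<le> y + x" "w \<le> z + d" for d w x y z :: real
    using that by (simp add: field_simps)
  ultimately have "norm ?W \<le> 2 * (norm ?Z + ?L * ?r)" using 1 norm_triangle_sub[of ?W ?Z] by blast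
  then have "(?L * ?\<rho>) * norm ?W \<le> (?L * ?\<rho>) * (2 * (norm ?Z + ?L * ?r))"
    by (rule mult_left_mono) (intro mult_nonneg_nonneg spectral_norm_nonneg nonneg)
  with 1 show ?thesis by (simp only: mult_ac)
qed

lemma taylor_rate_nonneg: "\<omega> \<in> space M \<Longrightarrow> 0 \<le> r \<Longrightarrow> 0 \<le> taylor_rate T \<omega> r"
proof -
  assume \<omega>: "\<omega> \<in> space M" and r: "0 \<le> r"
  have "0 \<le> \<Phi> (X t \<omega>) (Y t \<omega> $ a)" if t: "t \<ge> 1" for t
    using order_trans[OF spectral_norm_nonneg \<Phi>_bound[OF context_mem[OF t \<omega>], of \<theta>s]] \<epsilon>0_pos by simp
  then have "0 \<le> \<Phi>_mean T \<omega>"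
    unfolding \<Phi>_mean_def using ipw_nonneg \<omega> by (intro divide_nonneg_nonneg sum_nonneg mult_nonneg_nonneg) auto
  moreover have "0 \<le> jac_error T \<omega>" unfolding jac_error_def by (intro sum_nonneg) auto
  ultimately show ?thesis unfolding taylor_rate_def using r by simp
qed

lemma estimator_rv:
  assumes "approx_root_estimator M \<pi> X Y A a g R \<theta>hat" "T \<ge> 1"
  shows "random_variable borel (\<lambda>\<omega>. \<theta>hat T (hist T \<omega>))"
  using assms by (intro measurable_compose[OF history_rv]) (simp add: approx_root_estimator_def)

text \<open>Consistency makes the distance \<open>\<Delta>\<close> vanish, hence also the multiplier
  \<open>\<rho>\<close>; the leading term is O_p(1) and the scaled score \<open>r\<close> at the
  estimator is o_p(1). So the expansion error vanishes in probability and the limit law of the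
  leading term is inherited.\<close>

lemma asymptotic_normality:
  assumes est: "approx_root_estimator M \<pi> X Y A a g R \<theta>hat"
  shows "tendsto_in_distribution M (\<lambda>T \<omega>. sqrt (real T) *\<^sub>R (\<theta>hat T (hist T \<omega>) - \<theta>s)) (multivariate_normal 0 asym_cov)"
proof -
  let ?\<theta> = "\<lambda>T \<omega>. \<theta>hat T (hist T \<omega>)"
  let ?L = "spectral_norm Jinv"
  define r where "r T \<omega> = norm (sqrt (real T) *\<^sub>R G T (?\<theta> T \<omega>) \<omega>)" for T \<omega>
  define \<Delta> where "\<Delta> T \<omega> = norm (?\<theta> T \<omega> - \<theta>s)" for T \<omega>
  define \<rho> where "\<rho> T \<omega> = ?L * taylor_rate T \<omega> (\<Delta> T \<omega>)" for T \<omega>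
  note rv = estimator_rv[OF est]
  have r_rv: "random_variable borel (r T)" if "T \<ge> 1" for T
    unfolding r_def using G_compose_rv[OF rv[OF that], of T] by measurable
  have r_op: "tendsto_zero_in_prob M r"
    using est by (simp add: approx_root_estimator_def tendsto_zero_in_prob_def r_def)
  have \<Delta>_rv: "random_variable borel (\<Delta> T)" if "T \<ge> 1" for T
    unfolding \<Delta>_def using rv[OF that] by measurable
  \<comment> \<open>Consistency asks the unscaled score to vanish; this follows from the scaled
    condition because \<open>sqrt (real T)\<close> is at least 1.\<close>
  have "tendsto_zero_in_prob M (\<lambda>T \<omega>. G T (?\<theta> T \<omega>) \<omega>)"
  proof (rule tendsto_zero_in_prob_le[OF r_rv r_op])
    fix T :: nat assume "T \<ge> 1"
    then have "1 \<le> sqrt (real T)" by simp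
    then have "1 * norm v \<le> sqrt (real T) * norm v" for v :: "real^'d" by (rule mult_right_mono) simp
    then show "AE \<omega> in M. norm (G T (?\<theta> T \<omega>) \<omega>) \<le> r T \<omega>" unfolding r_def by (intro AE_I2) simp
  qed
  moreover have "norm (?\<theta> T \<omega>) \<le> R" if "T \<ge> 1" "\<omega> \<in> space M" for T \<omega>
    using est that by (simp add: approx_root_estimator_def)
  ultimately have "tendsto_zero_in_prob M (\<lambda>T \<omega>. ?\<theta> T \<omega> - \<theta>s)" by (intro consistency rv)
  then have \<Delta>_op: "tendsto_zero_in_prob M \<Delta>" by (simp add: tendsto_zero_in_prob_def \<Delta>_def)
  have \<rho>_op: "tendsto_zero_in_prob M \<rho>" and \<rho>_rv: "\<And>T. T \<ge> 1 \<Longrightarrow> random_variable borel (\<rho> T)"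
    unfolding \<rho>_def using taylor_rate_tendsto[OF \<Delta>_rv \<Delta>_op] by (auto intro!: tendsto_zero_in_prob_cmult)
  note Z_rv = leading_term_rv
  have Zn_rv: "random_variable borel (\<lambda>\<omega>. norm (leading_term T \<omega>))" for T using Z_rv by measurable
  have Lr_rv: "random_variable borel (\<lambda>\<omega>. ?L * r T \<omega>)" if "T \<ge> 1" for T using r_rv[OF that] by measurable
  have Lr_op: "tendsto_zero_in_prob M (\<lambda>T \<omega>. ?L * r T \<omega>)" by (rule tendsto_zero_in_prob_cmult[OF r_rv r_op])
  have Lr_bd: "bounded_in_prob (\<lambda>T \<omega>. norm (leading_term T \<omega>))" by (rule leading_term_bounded)
  have \<rho>Z_op: "tendsto_zero_in_prob M (\<lambda>T \<omega>. \<rho> T \<omega> * norm (leading_term T \<omega>))"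
    by (rule tendsto_zero_in_prob_mult_bounded[OF \<rho>_rv \<rho>_op Zn_rv Lr_bd])
  have "tendsto_zero_in_prob M (\<lambda>T \<omega>. sqrt (real T) *\<^sub>R (?\<theta> T \<omega> - \<theta>s) - leading_term T \<omega>)"
  \<comment> \<open>The exceptional events are those where the estimator leaves the Taylor ball or
    the absorption condition fails; both have vanishing probability.\<close>
  proof (rule tendsto_zero_in_prob_dominated[where B = "\<lambda>T. {\<omega>\<in>space M. norm (\<Delta> T \<omega>) > \<epsilon>0} \<union> {\<omega>\<in>space M. norm (\<rho> T \<omega>) > 1/2}"
        and W = "\<lambda>T \<omega>. ?L * r T \<omega> + (2 * (\<rho> T \<omega> * norm (leading_term T \<omega>)) + ?L * r T \<omega>)"])
    show "random_variable borel (\<lambda>\<omega>. ?L * r T \<omega> + (2 * (\<rho> T \<omega> * norm (leading_term T \<omega>)) + ?L * r T \<omega>))" if T: "T \<ge> 1" for T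
      using r_rv[OF T] \<rho>_rv[OF T] Zn_rv by measurable
    have m: "random_variable borel (\<lambda>\<omega>. \<rho> T \<omega> * norm (leading_term T \<omega>))" if T: "T \<ge> 1" for T
      using \<rho>_rv[OF T] Zn_rv by measurable
    then have m2: "random_variable borel (\<lambda>\<omega>. 2 * (\<rho> T \<omega> * norm (leading_term T \<omega>)))" if T: "T \<ge> 1" for T
      using that by measurable
    show "tendsto_zero_in_prob M (\<lambda>T \<omega>. ?L * r T \<omega> + (2 * (\<rho> T \<omega> * norm (leading_term T \<omega>)) + ?L * r T \<omega>))"
      by (intro tendsto_zero_in_prob_add Lr_op Lr_rv m2 tendsto_zero_in_prob_cmult[OF m \<rho>Z_op] borel_measurable_add)
    show "{\<omega>\<in>space M. norm (\<Delta> T \<omega>) > \<epsilon>0} \<union> {\<omega>\<in>space M. norm (\<rho> T \<omega>) > 1/2} \<in> events" if T: "T \<ge> 1" for T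
      using \<Delta>_rv[OF T] \<rho>_rv[OF T] by measurable
    show "(\<lambda>T. prob ({\<omega>\<in>space M. norm (\<Delta> T \<omega>) > \<epsilon>0} \<union> {\<omega>\<in>space M. norm (\<rho> T \<omega>) > 1/2})) \<longlonglongrightarrow> 0"
    proof (rule tendsto_sandwich[OF _ _ tendsto_const])
      have "(\<lambda>T. prob {\<omega>\<in>space M. norm (\<Delta> T \<omega>) > \<epsilon>0} + prob {\<omega>\<in>space M. norm (\<rho> T \<omega>) > 1/2}) \<longlonglongrightarrow> 0 + 0"
        by (intro tendsto_add tendsto_zero_in_probD[OF \<Delta>_op \<epsilon>0_pos] tendsto_zero_in_probD[OF \<rho>_op]) simp
      then show "(\<lambda>T. prob {\<omega>\<in>space M. norm (\<Delta> T \<omega>) > \<epsilon>0} + prob {\<omega>\<in>space M. norm (\<rho> T \<omega>) > 1/2}) \<longlonglongrightarrow> 0" by simp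
      show "\<forall>\<^sub>F T in sequentially. prob ({\<omega>\<in>space M. norm (\<Delta> T \<omega>) > \<epsilon>0} \<union> {\<omega>\<in>space M. norm (\<rho> T \<omega>) > 1/2}) \<le> prob {\<omega>\<in>space M. norm (\<Delta> T \<omega>) > \<epsilon>0} + prob {\<omega>\<in>space M. norm (\<rho> T \<omega>) > 1/2}"
      proof (rule eventually_sequentiallyI[of 1], rule measure_Un_le)
        fix T :: nat assume T: "1 \<le> T"
        show "{\<omega>\<in>space M. norm (\<Delta> T \<omega>) > \<epsilon>0} \<in> events" using \<Delta>_rv[OF T] by measurable
        show "{\<omega>\<in>space M. norm (\<rho> T \<omega>) > 1/2} \<in> events" using \<rho>_rv[OF T] by measurable
      qed
    qed auto
    show "AE \<omega> in M. \<omega> \<notin> {\<omega>\<in>space M. norm (\<Delta> T \<omega>) > \<epsilon>0} \<union> {\<omega>\<in>space M. norm (\<rho> T \<omega>) > 1/2} \<longrightarrow>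
        norm (sqrt (real T) *\<^sub>R (?\<theta> T \<omega> - \<theta>s) - leading_term T \<omega>) \<le> ?L * r T \<omega> + (2 * (\<rho> T \<omega> * norm (leading_term T \<omega>)) + ?L * r T \<omega>)" for T
    proof (intro AE_I2 impI)
      fix \<omega> assume \<omega>: "\<omega> \<in> space M" and "\<omega> \<notin> {\<omega>\<in>space M. norm (\<Delta> T \<omega>) > \<epsilon>0} \<union> {\<omega>\<in>space M. norm (\<rho> T \<omega>) > 1/2}"
      then have good: "norm (\<Delta> T \<omega>) \<le> \<epsilon>0" "norm (\<rho> T \<omega>) \<le> 1/2" by (simp_all add: not_less)
      have Lr: "0 \<le> ?L * r T \<omega>" by (simp add: r_def spectral_norm_nonneg)
      have "norm (sqrt (real T) *\<^sub>R (?\<theta> T \<omega> - \<theta>s) - leading_term T \<omega>) \<le> ?L * r T \<omega> + 2 * \<rho> T \<omega> * (norm (leading_term T \<omega>) + ?L * r T \<omega>)"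
        unfolding r_def \<rho>_def \<Delta>_def
        using good[unfolded \<rho>_def \<Delta>_def] by (intro expansion_error \<omega> taylor_rate_nonneg) (auto dest: abs_le_D1)
      also have "2 * \<rho> T \<omega> * (norm (leading_term T \<omega>) + ?L * r T \<omega>) = 2 * (\<rho> T \<omega> * norm (leading_term T \<omega>)) + 2 * \<rho> T \<omega> * (?L * r T \<omega>)"
        by (simp only: distrib_left mult.assoc)
      also have "2 * \<rho> T \<omega> * (?L * r T \<omega>) \<le> 1 * (?L * r T \<omega>)" using good(2) by (intro mult_right_mono Lr) (auto dest: abs_le_D1)
      finally show "norm (sqrt (real T) *\<^sub>R (?\<theta> T \<omega> - \<theta>s) - leading_term T \<omega>) \<le> ?L * r T \<omega> + (2 * (\<rho> T \<omega> * norm (leading_term T \<omega>)) + ?L * r T \<omega>)"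
        by simp
    qed
  qed
  moreover obtain C where "\<And>T. T \<ge> 1 \<Longrightarrow> expectation (\<lambda>\<omega>. (norm (leading_term T \<omega>))\<^sup>2) \<le> C" using leading_term_moment(2) by blast
  moreover have "random_variable borel (\<lambda>\<omega>. sqrt (real T) *\<^sub>R (?\<theta> T \<omega> - \<theta>s))" if "T \<ge> 1" for T
    using rv[OF that] by measurable
  ultimately show ?thesis
    by (intro tendsto_in_distribution_slutsky[OF leading_term_rv _ leading_term_tendsto _ leading_term_moment(1)])
qed

text \<open>The witness is one Newton step from \<open>\<theta>s\<close>, replaced by \<open>\<theta>s\<close> when it leaves the ball.\<close>

lemma approx_root_exists: "\<exists>\<theta>hat. approx_root_estimator M \<pi> X Y A a g R \<theta>hat"
proof -
  \<comment> \<open>An estimator must be a measurable function of the history; the score at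
    \<open>\<theta>s\<close> is one, since its potential outcomes are observed wherever the weight
    is nonzero.\<close>
  have "\<forall>T. \<exists>F. F \<in> borel_measurable (hist_space T) \<and> (\<forall>\<omega>\<in>space M. F (hist T \<omega>) = G T \<theta>s \<omega>)"
  proof
    fix T
    have "\<forall>i. \<exists>F. F \<in> borel_measurable (hist_space T) \<and> (\<forall>\<omega>. F (hist T \<omega>) = (\<Sum>t=1..T. ipw t \<omega> * score_at (\<lambda>z. g_ext \<theta>s z $ i) t \<omega>))"
    proof
      fix i
      obtain F where "F \<in> borel_measurable (hist_space T)" "\<And>\<omega>. F (hist T \<omega>) = (\<Sum>t=1..T. ipw t \<omega> * score_at (\<lambda>z. g_ext \<theta>s z $ i) t \<omega> - 0)"
        by (rule ipw_sum_factor[OF g_ext_component_measurable, of T \<theta>s i 0], rule that)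
      then show "\<exists>F. F \<in> borel_measurable (hist_space T) \<and> (\<forall>\<omega>. F (hist T \<omega>) = (\<Sum>t=1..T. ipw t \<omega> * score_at (\<lambda>z. g_ext \<theta>s z $ i) t \<omega>))"
        unfolding diff_0_right by (intro exI conjI allI)
    qed
    then obtain F where F: "\<forall>i. F i \<in> borel_measurable (hist_space T) \<and> (\<forall>\<omega>. F i (hist T \<omega>) = (\<Sum>t=1..T. ipw t \<omega> * score_at (\<lambda>z. g_ext \<theta>s z $ i) t \<omega>))"
      by (rule choice[THEN exE])
    show "\<exists>F. F \<in> borel_measurable (hist_space T) \<and> (\<forall>\<omega>\<in>space M. F (hist T \<omega>) = G T \<theta>s \<omega>)"
    proof (intro exI[of _ "\<lambda>h. \<chi> i. F i h / real T"] conjI ballI)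
      show "(\<lambda>h. \<chi> i. F i h / real T) \<in> borel_measurable (hist_space T)"
        by (intro borel_measurable_vec_lambda borel_measurable_divide borel_measurable_const F[rule_format, THEN conjunct1])
      show "(\<chi> i. F i (hist T \<omega>) / real T) = G T \<theta>s \<omega>" if "\<omega> \<in> space M" for \<omega>
        by (simp add: vec_eq_iff G_component[OF that] F[rule_format, THEN conjunct2, rule_format])
    qed
  qed
  then obtain F where F': "\<forall>T. F T \<in> borel_measurable (hist_space T) \<and> (\<forall>\<omega>\<in>space M. F T (hist T \<omega>) = G T \<theta>s \<omega>)"
    by (rule choice[THEN exE])
  then have F: "F T \<in> borel_measurable (hist_space T)" "\<omega> \<in> space M \<Longrightarrow> F T (hist T \<omega>) = G T \<theta>s \<omega>" for T \<omega>
    by simp_all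
  define step where "step T h = - (Jinv *v F T h)" for T h
  define \<theta>hat where "\<theta>hat T h = (if norm (\<theta>s + step T h) \<le> R then \<theta>s + step T h else \<theta>s)" for T h
  have step_m: "step T \<in> borel_measurable (hist_space T)" for T
    unfolding step_def by (intro borel_measurable_uminus borel_measurable_matrix_vector_mult F(1))
  have \<theta>hat_m: "\<theta>hat T \<in> borel_measurable (hist_space T)" for T
    unfolding \<theta>hat_def using step_m[of T] by measurable
  define \<Delta> where "\<Delta> T \<omega> = norm (step T (hist T \<omega>))" for T \<omega>
  have \<Delta>_rv: "random_variable borel (\<Delta> T)" for T
    unfolding \<Delta>_def using measurable_compose[OF history_rv step_m] by measurable
  have Gs_op: "tendsto_zero_in_prob M (\<lambda>T \<omega>. norm (G T \<theta>s \<omega>))"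
    using G_tendsto[of \<theta>s] \<theta>s_bound by (simp add: root tendsto_zero_in_prob_def)
  have Gs_rv: "random_variable borel (\<lambda>\<omega>. norm (G T \<theta>s \<omega>))" for T using G_rv by measurable
  have \<Delta>_op: "tendsto_zero_in_prob M \<Delta>"
  proof (rule tendsto_zero_in_prob_le)
    show "tendsto_zero_in_prob M (\<lambda>T \<omega>. spectral_norm Jinv * norm (G T \<theta>s \<omega>))" by (rule tendsto_zero_in_prob_cmult[OF Gs_rv Gs_op])
    show "random_variable borel (\<lambda>\<omega>. spectral_norm Jinv * norm (G T \<theta>s \<omega>))" for T using Gs_rv by measurable
    show "AE \<omega> in M. norm (\<Delta> T \<omega>) \<le> spectral_norm Jinv * norm (G T \<theta>s \<omega>)" for T
      by (intro AE_I2) (simp add: \<Delta>_def step_def F spectral_norm_mult)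
  qed
  have Z: "leading_term T \<omega> = sqrt (real T) *\<^sub>R step T (hist T \<omega>)" if "\<omega> \<in> space M" for T \<omega>
    unfolding leading_term_eq step_def using F(2)[OF that] by simp
  have Zn_rv: "random_variable borel (\<lambda>\<omega>. norm (leading_term T \<omega>))" for T using leading_term_rv by measurable
  \<comment> \<open>A step of length at most \<open>c\<close> stays in the ball of radius
    \<open>R\<close>, so that the fallback is not taken, and in the region where the second-order
    expansion holds.\<close>
  define c where "c = min \<epsilon>0 (R - norm \<theta>s)"
  have c: "c > 0" using \<epsilon>0_pos \<theta>s_bound by (simp add: c_def)
  have "tendsto_zero_in_prob M (\<lambda>T \<omega>. sqrt (real T) *\<^sub>R G T (\<theta>hat T (hist T \<omega>)) \<omega>)"
  proof (rule tendsto_zero_in_prob_dominated[where B = "\<lambda>T. {\<omega>\<in>space M. norm (\<Delta> T \<omega>) > c}" and W = "\<lambda>T \<omega>. taylor_rate T \<omega> (\<Delta> T \<omega>) * norm (leading_term T \<omega>)"])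
    note rate = taylor_rate_tendsto[OF \<Delta>_rv \<Delta>_op]
    show "tendsto_zero_in_prob M (\<lambda>T \<omega>. taylor_rate T \<omega> (\<Delta> T \<omega>) * norm (leading_term T \<omega>))"
      by (rule tendsto_zero_in_prob_mult_bounded[OF rate(2) rate(1) Zn_rv leading_term_bounded])
    show "random_variable borel (\<lambda>\<omega>. taylor_rate T \<omega> (\<Delta> T \<omega>) * norm (leading_term T \<omega>))" if "T \<ge> 1" for T
      by (intro borel_measurable_times rate(2)[OF that] Zn_rv)
    show "{\<omega>\<in>space M. norm (\<Delta> T \<omega>) > c} \<in> events" for T using \<Delta>_rv by measurable
    show "(\<lambda>T. prob {\<omega>\<in>space M. norm (\<Delta> T \<omega>) > c}) \<longlonglongrightarrow> 0" by (rule tendsto_zero_in_probD[OF \<Delta>_op c])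
    show "AE \<omega> in M. \<omega> \<notin> {\<omega>\<in>space M. norm (\<Delta> T \<omega>) > c} \<longrightarrow> norm (sqrt (real T) *\<^sub>R G T (\<theta>hat T (hist T \<omega>)) \<omega>) \<le> taylor_rate T \<omega> (\<Delta> T \<omega>) * norm (leading_term T \<omega>)" for T
    proof (intro AE_I2 impI)
      fix \<omega> assume \<omega>: "\<omega> \<in> space M" and "\<omega> \<notin> {\<omega>\<in>space M. norm (\<Delta> T \<omega>) > c}"
      then have small: "norm (step T (hist T \<omega>)) \<le> \<epsilon>0" "norm (step T (hist T \<omega>)) \<le> R - norm \<theta>s"
        by (auto simp: \<Delta>_def c_def not_less)
      then have "norm (\<theta>s + step T (hist T \<omega>)) \<le> R" using norm_triangle_ineq[of \<theta>s "step T (hist T \<omega>)"] by linarith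
      then have th: "\<theta>hat T (hist T \<omega>) = \<theta>s + step T (hist T \<omega>)" by (simp add: \<theta>hat_def)
      \<comment> \<open>The step cancels the score at \<open>\<theta>s\<close> to first order,
        leaving only the Taylor remainder; scaled by \<open>sqrt (real T)\<close>, this is at most
        an o_p(1) multiplier times the norm of the leading term.\<close>
      have Js: "J *v step T (hist T \<omega>) = - G T \<theta>s \<omega>"
        unfolding step_def F(2)[OF \<omega>] using J_inverse(1)[of "- G T \<theta>s \<omega>"] linear_neg[OF matrix_vector_mul_linear, of Jinv "G T \<theta>s \<omega>"] by simp
      have "norm (G T (\<theta>s + step T (hist T \<omega>)) \<omega> - G T \<theta>s \<omega> - J *v (\<theta>s + step T (hist T \<omega>) - \<theta>s)) \<le>
          taylor_rate T \<omega> (norm (\<theta>s + step T (hist T \<omega>) - \<theta>s)) * norm (\<theta>s + step T (hist T \<omega>) - \<theta>s)"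
        using small(1) by (intro G_taylor \<omega>) simp
      then have "norm (G T (\<theta>hat T (hist T \<omega>)) \<omega>) \<le> taylor_rate T \<omega> (\<Delta> T \<omega>) * norm (step T (hist T \<omega>))"
        by (simp add: Js th \<Delta>_def)
      from mult_left_mono[OF this real_sqrt_ge_zero[OF of_nat_0_le_iff, of T]]
      show "norm (sqrt (real T) *\<^sub>R G T (\<theta>hat T (hist T \<omega>)) \<omega>) \<le> taylor_rate T \<omega> (\<Delta> T \<omega>) * norm (leading_term T \<omega>)"
        unfolding Z[OF \<omega>] by (simp add: mult_ac)
    qed
  qed
  moreover have "norm (\<theta>hat T h) \<le> R" for T h using \<theta>s_bound by (simp add: \<theta>hat_def)
  ultimately have "approx_root_estimator M \<pi> X Y A a g R \<theta>hat"
    unfolding approx_root_estimator_def using \<theta>hat_m by blast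
  then show ?thesis by (rule exI[of "approx_root_estimator M \<pi> X Y A a g R" \<theta>hat])
qed

end

theorem theorem3p2:
  fixes M :: "'w measure"
    and XX :: "(real^'p::finite) set"
    and X :: "nat \<Rightarrow> 'w \<Rightarrow> real^'p"
    and Y :: "nat \<Rightarrow> 'w \<Rightarrow> real^'k::finite"
    and A :: "nat \<Rightarrow> 'w \<Rightarrow> 'k"
    and \<pi> :: "('p, 'k) policies"
    and X0 :: "'w \<Rightarrow> real^'p"
    and Y0 :: "'w \<Rightarrow> real^'k"
    and a :: 'k
    and g :: "('p, 'd::finite) score"
    and \<theta>s :: "real^'d"
    and R M2 \<epsilon>0 \<pi>min :: real
    and \<phi> \<Phi> :: "real^'p \<Rightarrow> real \<Rightarrow> real"
    and \<pi>bar :: "real^'p \<Rightarrow> real^'k"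
  assumes bandit: "contextual_bandit M XX X Y A \<pi> X0 Y0"
    and g_measurable:
      "\<And>\<theta>. (\<lambda>(x, y). g x y \<theta>) \<in> borel_measurable (restrict_space borel XX \<Otimes>\<^sub>M borel)"
    and root: "(\<integral>\<omega>. g (X0 \<omega>) (Y0 \<omega> $ a) \<theta>s \<partial>M) = 0"
    and unconfoundedness:
      "\<And>t. t \<ge> 1 \<Longrightarrow>
         cond_indep_var M (sigma_hist_context M \<pi> X Y A t) (count_space UNIV) (A t) borel (Y t)"
    and well_separated:
      "\<And>\<epsilon>. \<epsilon> > 0 \<Longrightarrow>
         (INF \<theta>\<in>{\<theta>. norm (\<theta> - \<theta>s) > \<epsilon>}. norm (\<integral>\<omega>. g (X0 \<omega>) (Y0 \<omega> $ a) \<theta> \<partial>M)) > 0"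
    and cond_second_moment:
      "AE \<omega> in M.
         spectral_norm
           (\<chi> i j. real_cond_exp M (vimage_algebra (space M) X0 borel)
              (\<lambda>\<omega>. outer_prod (g (X0 \<omega>) (Y0 \<omega> $ a) \<theta>s) $ i $ j) \<omega>) \<le> M2"
    and \<theta>s_bound: "norm \<theta>s < R"
    and second_moment:
      "(SUP \<theta>\<in>{\<theta>. norm \<theta> \<le> R}. \<integral>\<^sup>+\<omega>. ennreal ((norm (g (X0 \<omega>) (Y0 \<omega> $ a) \<theta>))\<^sup>2) \<partial>M) < \<infinity>"
    and fourth_moment: "integrable M (\<lambda>\<omega>. norm (g (X0 \<omega>) (Y0 \<omega> $ a) \<theta>s) ^ 4)"
    and twice_diff: "\<And>x y. x \<in> XX \<Longrightarrow> twice_differentiable (g x y)"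
    and nonsingular: "invertible (score_jacobian M X0 Y0 a g \<theta>s)"
    and \<phi>_measurable: "(\<lambda>(x, y). \<phi> x y) \<in> borel_measurable (borel \<Otimes>\<^sub>M borel)"
    and \<phi>_bound:
      "\<And>x y \<theta>. x \<in> XX \<Longrightarrow> norm \<theta> \<le> R \<Longrightarrow> spectral_norm (jacobian (g x y) (at \<theta>)) \<le> \<phi> x y"
    and \<phi>_moment: "integrable M (\<lambda>\<omega>. (\<phi> (X0 \<omega>) (Y0 \<omega> $ a))\<^sup>2)"
    and \<epsilon>0_pos: "\<epsilon>0 > 0"
    and \<Phi>_measurable: "(\<lambda>(x, y). \<Phi> x y) \<in> borel_measurable (borel \<Otimes>\<^sub>M borel)"
    and \<Phi>_bound:
      "\<And>x y \<theta> i. x \<in> XX \<Longrightarrow> norm (\<theta> - \<theta>s) \<le> \<epsilon>0 \<Longrightarrow>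
         spectral_norm (hessian (\<lambda>\<theta>'. g x y \<theta>' $ i) \<theta>) \<le> \<Phi> x y"
    and \<Phi>_moment: "integrable M (\<lambda>\<omega>. \<Phi> (X0 \<omega>) (Y0 \<omega> $ a))"
    and \<pi>min: "0 < \<pi>min" "\<pi>min < 1"
    and min_prob: "\<And>t. t \<ge> 1 \<Longrightarrow> AE \<omega> in M. action_prob \<pi> X Y A t \<omega> $ a \<ge> \<pi>min"
    and \<pi>bar_measurable: "\<pi>bar \<in> borel_measurable (restrict_space borel XX)"
    and \<pi>bar_simplex: "\<And>x. x \<in> XX \<Longrightarrow> \<pi>bar x \<in> prob_simplex"
    and policy_converges:
      "tendsto_zero_in_prob M (\<lambda>t \<omega>. action_prob \<pi> X Y A t \<omega> $ a - \<pi>bar (X t \<omega>) $ a)"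
  shows "(\<exists>\<theta>hat. approx_root_estimator M \<pi> X Y A a g R \<theta>hat) \<and>
    (\<forall>\<theta>hat. approx_root_estimator M \<pi> X Y A a g R \<theta>hat \<longrightarrow>
       tendsto_in_distribution M
         (\<lambda>T \<omega>. sqrt (real T) *\<^sub>R (\<theta>hat T (history \<pi> X Y A T \<omega>) - \<theta>s))
         (multivariate_normal 0
            (matrix_inv (score_jacobian M X0 Y0 a g \<theta>s) **
             weighted_information M X0 Y0 \<pi>bar a g \<theta>s **
             transpose (matrix_inv (score_jacobian M X0 Y0 a g \<theta>s)))))"
proof -
  interpret contextual_bandit M XX X Y A \<pi> X0 Y0 by (rule bandit)
  interpret ipw_z_estimation M XX X Y A \<pi> X0 Y0 a \<pi>min g \<theta>s R \<epsilon>0 \<phi> \<Phi> \<pi>bar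
    by unfold_locales
       (fact unconfoundedness \<pi>min(1) min_prob g_measurable root well_separated \<theta>s_bound second_moment
          fourth_moment twice_diff nonsingular \<phi>_measurable \<phi>_bound \<phi>_moment \<epsilon>0_pos \<Phi>_measurable
          \<Phi>_bound \<Phi>_moment \<pi>bar_measurable \<pi>bar_simplex policy_converges)+
  show ?thesis using approx_root_exists asymptotic_normality by blast
qed

end
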